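(* The class of numerable open covers of topological spaces is the smallest class $C$ of open covers of topological spaces that satisfies the following conditions. (1) $C$ contains all numerable open covers with two elements. (2) $C$ contains all open covers with pairwise disjoint elements (indexed by arbitrary sets). (3) (Coarsening.) If $U$ and $V$ are open covers of a space $X$, $U\in C$, and $U$ refines $V$, then $V\in C$. (4) (Composition.) If an open cover $\{U_i\}_{i\in I}$ of a space $X$ belongs to $C$ and $\iota\colon X\to Y$ is an isomorphism (homeomorphism), then the open cover $\{\iota(U_i)\}_{i\in I}$ of $Y$ also belongs to $C$; and if an open cover $\{U_i\}_{i\in I}$ of a space $X$ belongs to $C$, and for every $i\in I$ we are given an open cover $\{V_{i,j}\}_{j\in J_i}$ of $U_i$ that belongs to $C$, then the open cover $\{V_{i,j}\}_{i\in I,j\in J_i}$ of $X$ belongs to $C$. More generally, the same statement holds with locales (and isomorphisms of locales) in place of topological spaces (and homeomorphisms).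
   Context: A positive partition on a topological space $X$ is a family of continuous functions $\{f_i\colon X\to[0,\infty)\}_{i\in I}$ such that $\sum_{i\in I}f_i$ is everywhere defined (finite) and is a strictly positive continuous function $X\to(0,\infty)$. An open cover $\{U_i\}_{i\in I}$ of $X$ is numerable if there is a positive partition $\{f_i\}_{i\in I}$ on $X$ with $f_i^{-1}(0,\infty)\subset U_i$ for all $i\in I$. Open covers of an open subset are taken with respect to the induced topology. An open cover $U$ refines an open cover $V$ of the same space if every element of $U$ is contained in some element of $V$. A locale is a poset (of "opens") with finite infima and arbitrary suprema such that $b\mapsto \inf(a,b)$ preserves suprema for any fixed $a$; a morphism of locales $L\to L'$ is an order-preserving map of posets in the opposite direction ("inverse image") preserving finite infima and arbitrary suprema. An open cover of a locale is a family of opens with supremum the top element, and numerability is defined by the same words, using morphisms of locales $f_i\colon L\to[0,\infty)$; here $f=\sum_i f_i$ means that $f^*(a,\infty)=\bigvee_{J}(\sum_{i\in J}f_i)^*(a,\infty)$ for all real $a$, where $J$ runs over finite subsets of $I$. *)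

theory Defs
  imports "HOL-Analysis.Analysis" "HOL-Algebra.Complete_Lattice"
begin

text \<open>
  Open covers are families. A class of open covers of spaces is a predicate
  \<open>C X I U\<close>, where the points of the space \<open>X\<close> form a subset of a type \<open>'a\<close>, the index set \<open>I\<close> is
  a subset of a type \<open>'i\<close>, and the cover is the restriction of \<open>U\<close> to \<open>I\<close>. The two types
  play the role of a universe and are otherwise arbitrary; values of \<open>U\<close> outside \<open>I\<close> carry no
  meaning. Likewise, the opens of a locale form a subset of a type \<open>'l\<close>.
\<close>

section \<open>Topological spaces\<close>

definition open_cover :: "'a topology \<Rightarrow> 'i set \<Rightarrow> ('i \<Rightarrow> 'a set) \<Rightarrow> bool" where
  "open_cover X I U \<longleftrightarrow> (\<forall>i\<in>I. openin X (U i)) \<and> (\<Union>i\<in>I. U i) = topspace X"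

definition positive_partition :: "'a topology \<Rightarrow> 'i set \<Rightarrow> ('i \<Rightarrow> 'a \<Rightarrow> real) \<Rightarrow> bool" where
  "positive_partition X I f \<longleftrightarrow>
     (\<forall>i\<in>I. continuous_map X (top_of_set {0..}) (f i)) \<and>
     (\<forall>x\<in>topspace X. (\<lambda>i. f i x) summable_on I) \<and>
     continuous_map X (top_of_set {0<..}) (\<lambda>x. infsum (\<lambda>i. f i x) I)"

definition numerable :: "'a topology \<Rightarrow> 'i set \<Rightarrow> ('i \<Rightarrow> 'a set) \<Rightarrow> bool" where
  "numerable X I U \<longleftrightarrow> open_cover X I U \<and>
     (\<exists>f. positive_partition X I f \<and> (\<forall>i\<in>I. {x \<in> topspace X. f i x > 0} \<subseteq> U i))"

text \<open>
  In the last condition the doubly indexed family is reindexed along an arbitrary bijection \<open>h\<close>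
  from some \<open>K :: 'i set\<close> to the set of pairs \<open>(i, j)\<close>. Such \<open>K\<close> and \<open>h\<close> always exist if \<open>'i\<close> is
  infinite.
\<close>

definition admissible_cover_class ::
  "('a topology \<Rightarrow> 'i set \<Rightarrow> ('i \<Rightarrow> 'a set) \<Rightarrow> bool) \<Rightarrow> bool" where
  "admissible_cover_class C \<longleftrightarrow>
     (\<forall>X I U. C X I U \<longrightarrow> open_cover X I U) \<and>
     (\<forall>X I U. numerable X I U \<and> card I = 2 \<longrightarrow> C X I U) \<and>
     (\<forall>X I U. open_cover X I U \<and> disjoint_family_on U I \<longrightarrow> C X I U) \<and>
     (\<forall>X I U J V. C X I U \<and> open_cover X J V \<and> (\<forall>i\<in>I. \<exists>j\<in>J. U i \<subseteq> V j) \<longrightarrow> C X J V) \<and>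
     (\<forall>X Y \<iota> I U. C X I U \<and> homeomorphic_map X Y \<iota> \<longrightarrow> C Y I (\<lambda>i. \<iota> ` U i)) \<and>
     (\<forall>X I U J V K h.
        C X I U \<and> (\<forall>i\<in>I. C (subtopology X (U i)) (J i) (V i)) \<and> bij_betw h K (SIGMA i:I. J i)
        \<longrightarrow> C X K (\<lambda>k. case h k of (i, j) \<Rightarrow> V i j))"


section \<open>Locales\<close>

text \<open>
  A locale in the sense of pointless topology is represented by its frame of opens. The
  ambient \<open>partial_order\<close> makes the equivalence of the \<open>gorder\<close> record the equality.
\<close>

locale frame = partial_order +
  assumes Sup_exists: "A \<subseteq> carrier L \<Longrightarrow> \<exists>s. least L s (Upper L A)"
    and finite_Inf_exists:
      "\<lbrakk>finite A; A \<subseteq> carrier L\<rbrakk> \<Longrightarrow> \<exists>i. greatest L i (Lower L A)"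
    and meet_Sup_distrib:
      "\<lbrakk>a \<in> carrier L; B \<subseteq> carrier L\<rbrakk> \<Longrightarrow> a \<sqinter> \<Squnion>B = \<Squnion>((\<lambda>b. a \<sqinter> b) ` B)"

text \<open>
  In \<open>locale_morphism L M f\<close>, the morphism goes from \<open>L\<close> to \<open>M\<close>; the function \<open>f\<close> is its inverse
  image map and goes from the opens of \<open>M\<close> to the opens of \<open>L\<close>.
\<close>

definition locale_morphism :: "'l gorder \<Rightarrow> 'm gorder \<Rightarrow> ('m \<Rightarrow> 'l) \<Rightarrow> bool" where
  "locale_morphism L M f \<longleftrightarrow>
     f \<in> carrier M \<rightarrow> carrier L \<and> isotone M L f \<and>
     (\<forall>A. A \<subseteq> carrier M \<and> finite A \<longrightarrow> f (\<Sqinter>\<^bsub>M\<^esub>A) = \<Sqinter>\<^bsub>L\<^esub>(f ` A)) \<and>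
     (\<forall>A. A \<subseteq> carrier M \<longrightarrow> f (\<Squnion>\<^bsub>M\<^esub>A) = \<Squnion>\<^bsub>L\<^esub>(f ` A))"

text \<open>
  Here \<open>f\<close> is the inverse image map of an isomorphism from \<open>L\<close> to \<open>M\<close>, and \<open>g\<close> is the inverse image
  map of the inverse isomorphism; thus the isomorphism sends an open \<open>u\<close> of \<open>L\<close> to \<open>g u\<close>.
\<close>

definition locale_isomorphism ::
  "'l gorder \<Rightarrow> 'm gorder \<Rightarrow> ('m \<Rightarrow> 'l) \<Rightarrow> ('l \<Rightarrow> 'm) \<Rightarrow> bool" where
  "locale_isomorphism L M f g \<longleftrightarrow>
     locale_morphism L M f \<and> locale_morphism M L g \<and>
     (\<forall>u\<in>carrier L. f (g u) = u) \<and> (\<forall>v\<in>carrier M. g (f v) = v)"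

definition opens :: "'a topology \<Rightarrow> 'a set gorder" where
  "opens X = \<lparr>carrier = {U. openin X U}, eq = (=), le = (\<subseteq>)\<rparr>"

definition open_sublocale :: "'l gorder \<Rightarrow> 'l \<Rightarrow> 'l gorder" where
  "open_sublocale L u = L\<lparr>carrier := {v \<in> carrier L. v \<sqsubseteq>\<^bsub>L\<^esub> u}\<rparr>"

text \<open>
  Inverse image map of the sum of a finite family of morphisms from \<open>L\<close> to \<open>[0,\<infinity>)\<close>: the tuple of
  the \<open>f i\<close> followed by addition \<open>[0,\<infinity>)\<^sup>J \<rightarrow> [0,\<infinity>)\<close>. The preimage of \<open>W\<close> under addition is the union
  of the open boxes with sides \<open>A i\<close> contained in it, and the tuple pulls such a box back to the
  infimum of the \<open>f i (A i)\<close>.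
\<close>

definition locale_sum ::
  "'l gorder \<Rightarrow> ('i \<Rightarrow> real set \<Rightarrow> 'l) \<Rightarrow> 'i set \<Rightarrow> real set \<Rightarrow> 'l" where
  "locale_sum L f J W =
     \<Squnion>\<^bsub>L\<^esub>{\<Sqinter>\<^bsub>L\<^esub>((\<lambda>i. f i (A i)) ` J) | A.
            (\<forall>i\<in>J. openin (top_of_set {0..}) (A i)) \<and>
            (\<forall>x. (\<forall>i\<in>J. x i \<in> A i) \<longrightarrow> (\<Sum>i\<in>J. x i) \<in> W)}"

definition locale_open_cover :: "'l gorder \<Rightarrow> 'i set \<Rightarrow> ('i \<Rightarrow> 'l) \<Rightarrow> bool" where
  "locale_open_cover L I U \<longleftrightarrow>
     frame L \<and> (\<forall>i\<in>I. U i \<in> carrier L) \<and> \<Squnion>\<^bsub>L\<^esub>(U ` I) = \<top>\<^bsub>L\<^esub>"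

text \<open>The morphism \<open>s\<close> from \<open>L\<close> to \<open>(0,\<infinity>)\<close> is the sum of the family \<open>f\<close>.\<close>

definition locale_positive_partition ::
  "'l gorder \<Rightarrow> 'i set \<Rightarrow> ('i \<Rightarrow> real set \<Rightarrow> 'l) \<Rightarrow> bool" where
  "locale_positive_partition L I f \<longleftrightarrow>
     (\<forall>i\<in>I. locale_morphism L (opens (top_of_set {0..})) (f i)) \<and>
     (\<exists>s. locale_morphism L (opens (top_of_set {0<..})) s \<and>
        (\<forall>a. s ({0<..} \<inter> {a<..}) =
             \<Squnion>\<^bsub>L\<^esub>{locale_sum L f J ({0..} \<inter> {a<..}) | J. J \<subseteq> I \<and> finite J}))"

definition locale_numerable :: "'l gorder \<Rightarrow> 'i set \<Rightarrow> ('i \<Rightarrow> 'l) \<Rightarrow> bool" where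
  "locale_numerable L I U \<longleftrightarrow> locale_open_cover L I U \<and>
     (\<exists>f. locale_positive_partition L I f \<and> (\<forall>i\<in>I. f i {0<..} \<sqsubseteq>\<^bsub>L\<^esub> U i))"

definition locale_admissible_cover_class ::
  "('l gorder \<Rightarrow> 'i set \<Rightarrow> ('i \<Rightarrow> 'l) \<Rightarrow> bool) \<Rightarrow> bool" where
  "locale_admissible_cover_class C \<longleftrightarrow>
     (\<forall>L I U. C L I U \<longrightarrow> locale_open_cover L I U) \<and>
     (\<forall>L I U. locale_numerable L I U \<and> card I = 2 \<longrightarrow> C L I U) \<and>
     (\<forall>L I U. locale_open_cover L I U \<and>
        (\<forall>i\<in>I. \<forall>j\<in>I. i \<noteq> j \<longrightarrow> U i \<sqinter>\<^bsub>L\<^esub> U j = \<bottom>\<^bsub>L\<^esub>) \<longrightarrow> C L I U) \<and>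
     (\<forall>L I U J V. C L I U \<and> locale_open_cover L J V \<and> (\<forall>i\<in>I. \<exists>j\<in>J. U i \<sqsubseteq>\<^bsub>L\<^esub> V j)
        \<longrightarrow> C L J V) \<and>
     (\<forall>L M f g I U. C L I U \<and> frame M \<and> locale_isomorphism L M f g \<longrightarrow> C M I (\<lambda>i. g (U i))) \<and>
     (\<forall>L I U J V K h.
        C L I U \<and> (\<forall>i\<in>I. C (open_sublocale L (U i)) (J i) (V i)) \<and> bij_betw h K (SIGMA i:I. J i)
        \<longrightarrow> C L K (\<lambda>k. case h k of (i, j) \<Rightarrow> V i j))"

end

theory Submission
  imports Defs
begin

text \<open>
  Minimality for a space. Let \<open>a\<^sub>k x\<close> be the \<open>k\<close>-th largest value of a positive partition \<open>f\<close> at \<open>x\<close>;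
  this is continuous in \<open>x\<close>. Where \<open>a\<^sub>k\<^sub>+\<^sub>1 < a\<^sub>k\<close>, the set of the \<open>k\<close> indices with the largest values is
  locally constant, so this open set is a disjoint union of open sets contained in members of the
  cover. The sets \<open>{a\<^sub>n < a\<^sub>1}\<close> are obtained from these by binary numerable covers, and the whole space
  by one more: it is covered by the non-zero loci of \<open>sin (\<pi> t / 2)\<close> and \<open>cos (\<pi> t / 2)\<close>, where
  \<open>t = (\<Sum>i. f i) / a\<^sub>1\<close>, each of which is a disjoint union of pieces on which \<open>t\<close> is bounded, and \<open>t < n\<close>
  implies \<open>a\<^sub>n < a\<^sub>1\<close>.

  Locales are reduced to spaces. Given a positive partition on a locale \<open>L\<close>, take the proper filters
  of opens that contain, for every \<open>\<epsilon>\<close>, an open on which every \<open>f i\<close> is known up to \<open>\<epsilon>\<close> and finitely many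
  of them exhaust the sum up to \<open>\<epsilon>\<close>. A Rasiowa--Sikorski argument shows that these filters separate
  the opens of \<open>L\<close>, and then there is a morphism from \<open>L\<close> to the space of these filters. The
  partition is the pullback of a positive partition on that space, and numerability and all steps of
  the minimality argument can be pulled back along the morphism. For composition, the filters must
  also determine the partition of the member \<open>U i\<close> of the cover unless they make \<open>f i\<close> vanish.
\<close>

section \<open>Sums of continuous functions and closure of numerable covers\<close>

text \<open>A locale may have no points, so "the k-th largest value" makes no sense on it; this is
  what forces the detour through a space. The filters need not be prime, hence they are not points
  of \<open>L\<close>. The comparison therefore runs from \<open>L\<close> to the space of filters,
  and its inverse image sends an open set of filters to an open of \<open>L\<close>. A descending
  sequence of opens can meet only countably many demands, whereas a partition may have uncountably
  many members. One demand per precision \<open>1 / (n + 1)\<close> still suffices: once the sum is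
  confined to a short interval and finitely many members nearly exhaust it, all other members are
  small simultaneously. On a space the obstacle is that the sets
  \<open>{a\<^sub>n < a\<^sub>1}\<close> increase with \<open>n\<close>, and the \<open>n\<close>
  that is needed may be unbounded, while only binary and disjoint covers are at hand. Cutting the
  range of \<open>t\<close> at the zeros of sine and of cosine turns this infinite chain into two
  disjoint families joined by a single binary cover. The infinite index type supplies labels for
  these families and for pairs of indices.\<close>

lemma less_infsum_iff:
  fixes f :: "'i \<Rightarrow> real"
  assumes "f summable_on I" and "\<And>i. i \<in> I \<Longrightarrow> 0 \<le> f i"
  shows "a < infsum f I \<longleftrightarrow> (\<exists>J\<subseteq>I. finite J \<and> a < sum f J)"
proof
  assume "a < infsum f I"
  then have "eventually (\<lambda>J. a < sum f J) (finite_subsets_at_top I)"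
    using order_tendstoD(1)[OF has_sum_infsum[OF assms(1), unfolded has_sum_def]] by blast
  then show "\<exists>J\<subseteq>I. finite J \<and> a < sum f J"
    unfolding eventually_finite_subsets_at_top by blast
next
  assume "\<exists>J\<subseteq>I. finite J \<and> a < sum f J"
  then show "a < infsum f I"
    using finite_sum_le_infsum[OF assms(1)] assms(2) by (metis DiffD1 less_le_trans)
qed

lemma positive_partition_iff:
  "positive_partition X I f \<longleftrightarrow>
     (\<forall>i\<in>I. continuous_map X euclideanreal (f i) \<and> (\<forall>x\<in>topspace X. 0 \<le> f i x)) \<and>
     (\<forall>x\<in>topspace X. (\<lambda>i. f i x) summable_on I) \<and>
     continuous_map X euclideanreal (\<lambda>x. \<Sum>\<^sub>\<infinity>i\<in>I. f i x) \<and>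
     (\<forall>x\<in>topspace X. 0 < (\<Sum>\<^sub>\<infinity>i\<in>I. f i x))"
  unfolding positive_partition_def continuous_map_in_subtopology by (auto simp: Pi_iff)

lemma positive_partitionD:
  assumes "positive_partition X I f"
  shows "i \<in> I \<Longrightarrow> continuous_map X euclideanreal (f i)"
    and "i \<in> I \<Longrightarrow> x \<in> topspace X \<Longrightarrow> 0 \<le> f i x"
    and "x \<in> topspace X \<Longrightarrow> (\<lambda>i. f i x) summable_on I"
    and "continuous_map X euclideanreal (\<lambda>x. \<Sum>\<^sub>\<infinity>i\<in>I. f i x)"
    and "x \<in> topspace X \<Longrightarrow> 0 < (\<Sum>\<^sub>\<infinity>i\<in>I. f i x)"
  using assms unfolding positive_partition_iff by blast+

lemma positive_partitionI:
  assumes "\<And>i. i \<in> I \<Longrightarrow> continuous_map X euclideanreal (f i)"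
    and "\<And>i x. i \<in> I \<Longrightarrow> x \<in> topspace X \<Longrightarrow> 0 \<le> f i x"
    and "\<And>x. x \<in> topspace X \<Longrightarrow> ((\<lambda>i. f i x) has_sum s x) I"
    and "continuous_map X euclideanreal s"
    and "\<And>x. x \<in> topspace X \<Longrightarrow> 0 < s x"
  shows "positive_partition X I f"
proof -
  have "continuous_map X euclideanreal (\<lambda>x. \<Sum>\<^sub>\<infinity>i\<in>I. f i x)"
    using assms(4) by (rule continuous_map_eq) (simp add: infsumI[OF assms(3)])
  moreover have "(\<lambda>i. f i x) summable_on I" "(\<Sum>\<^sub>\<infinity>i\<in>I. f i x) = s x" if "x \<in> topspace X" for x
    using assms(3)[OF that] infsumI unfolding summable_on_def by blast+
  ultimately show ?thesis
    unfolding positive_partition_iff using assms(1,2,5) by simp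
qed

lemma openin_superlevel:
  "continuous_map X euclideanreal f \<Longrightarrow> openin X {x \<in> topspace X. a < f x}"
  by (simp add: continuous_map_upper_lower_semicontinuous_lt)

lemma openin_sublevel:
  "continuous_map X euclideanreal f \<Longrightarrow> openin X {x \<in> topspace X. f x < a}"
  by (simp add: continuous_map_upper_lower_semicontinuous_lt)

lemma openin_less_infsum:
  fixes f :: "'i \<Rightarrow> 'a \<Rightarrow> real"
  assumes cont: "\<And>i. i \<in> I \<Longrightarrow> continuous_map X euclideanreal (f i)"
    and nonneg: "\<And>i x. i \<in> I \<Longrightarrow> x \<in> topspace X \<Longrightarrow> 0 \<le> f i x"
    and summ: "\<And>x. x \<in> topspace X \<Longrightarrow> (\<lambda>i. f i x) summable_on I"
  shows "openin X {x \<in> topspace X. a < (\<Sum>\<^sub>\<infinity>i\<in>I. f i x)}"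
proof -
  have "{x \<in> topspace X. a < (\<Sum>\<^sub>\<infinity>i\<in>I. f i x)}
      = (\<Union>J\<in>{J. J \<subseteq> I \<and> finite J}. {x \<in> topspace X. a < (\<Sum>i\<in>J. f i x)})"
    using less_infsum_iff[OF summ] nonneg by auto
  also have "openin X \<dots>"
    by (intro openin_Union ballI) (auto intro!: openin_superlevel continuous_map_sum cont)
  finally show ?thesis .
qed

text \<open>A sum of nonnegative continuous functions is lower semicontinuous, and so is its difference
  to a continuous dominating sum.\<close>

lemma continuous_map_infsum_dominated:
  fixes f h :: "'i \<Rightarrow> 'a \<Rightarrow> real"
  assumes contf: "\<And>i. i \<in> I \<Longrightarrow> continuous_map X euclideanreal (f i)"
    and conth: "\<And>i. i \<in> I \<Longrightarrow> continuous_map X euclideanreal (h i)"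
    and nonneg: "\<And>i x. i \<in> I \<Longrightarrow> x \<in> topspace X \<Longrightarrow> 0 \<le> h i x"
    and le: "\<And>i x. i \<in> I \<Longrightarrow> x \<in> topspace X \<Longrightarrow> h i x \<le> f i x"
    and summ: "\<And>x. x \<in> topspace X \<Longrightarrow> (\<lambda>i. f i x) summable_on I"
    and cont: "continuous_map X euclideanreal (\<lambda>x. \<Sum>\<^sub>\<infinity>i\<in>I. f i x)"
  shows "continuous_map X euclideanreal (\<lambda>x. \<Sum>\<^sub>\<infinity>i\<in>I. h i x)"
proof -
  have summh: "(\<lambda>i. h i x) summable_on I" if "x \<in> topspace X" for x
    using summable_on_comparison_test[OF summ[OF that], of "\<lambda>i. h i x"] le nonneg that by auto
  have summd: "(\<lambda>i. f i x - h i x) summable_on I" if "x \<in> topspace X" for x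
    using summable_on_add[OF summ[OF that] summable_on_uminus[THEN iffD2, OF summh[OF that]]] by simp
  have eq: "(\<Sum>\<^sub>\<infinity>i\<in>I. f i x - h i x) = (\<Sum>\<^sub>\<infinity>i\<in>I. f i x) - (\<Sum>\<^sub>\<infinity>i\<in>I. h i x)" if "x \<in> topspace X" for x
    using infsum_add[OF summ[OF that] summable_on_uminus[THEN iffD2, OF summh[OF that]]]
    by (simp add: infsum_uminus)
  have "openin X {x \<in> topspace X. (\<Sum>\<^sub>\<infinity>i\<in>I. h i x) < a}" for a
  proof -
    let ?A = "\<lambda>b. {x \<in> topspace X. (\<Sum>\<^sub>\<infinity>i\<in>I. f i x) < b} \<inter>
                  {x \<in> topspace X. b - a < (\<Sum>\<^sub>\<infinity>i\<in>I. f i x - h i x)}"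
    have "{x \<in> topspace X. (\<Sum>\<^sub>\<infinity>i\<in>I. h i x) < a} = (\<Union>b. ?A b)"
    proof (intro equalityI subsetI)
      fix x assume x: "x \<in> {x \<in> topspace X. (\<Sum>\<^sub>\<infinity>i\<in>I. h i x) < a}"
      \<comment> \<open>Membership in \<open>?A b\<close> places \<open>b\<close> strictly between
        the sum of \<open>f\<close> and that sum plus the slack left below \<open>a\<close> by the
        sum of \<open>h\<close>; the midpoint is chosen.\<close>
      let ?b = "(\<Sum>\<^sub>\<infinity>i\<in>I. f i x) + (a - (\<Sum>\<^sub>\<infinity>i\<in>I. h i x)) / 2"
      have "x \<in> ?A ?b" using x eq[of x] by (auto simp: field_simps)
      then show "x \<in> (\<Union>b. ?A b)" by blast
    qed (use eq in auto)
    moreover have "openin X (?A b)" for b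
      using openin_sublevel[OF cont]
        openin_less_infsum[of I X "\<lambda>i x. f i x - h i x", OF _ _ summd] contf conth le
      by (intro openin_Int) (auto intro!: continuous_map_diff)
    ultimately show ?thesis by auto
  qed
  moreover have "openin X {x \<in> topspace X. a < (\<Sum>\<^sub>\<infinity>i\<in>I. h i x)}" for a
    using openin_less_infsum[OF conth nonneg summh] by blast
  ultimately show ?thesis by (simp add: continuous_map_upper_lower_semicontinuous_lt)
qed

lemma nonneg_has_sum_SigmaI:
  fixes f :: "'i \<times> 'j \<Rightarrow> real"
  assumes "\<And>i. i \<in> I \<Longrightarrow> ((\<lambda>j. f (i, j)) has_sum g i) (J i)" and "(g has_sum s) I"
    and "\<And>i j. i \<in> I \<Longrightarrow> j \<in> J i \<Longrightarrow> 0 \<le> f (i, j)"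
  shows "(f has_sum s) (Sigma I J)"
proof (rule has_sum_SigmaI)
  show "f summable_on Sigma I J"
    using assms by (intro summable_on_SigmaI[where g = g]) (auto simp: summable_on_def)
qed (use assms in auto)

lemma bij_betw_swap: "bij_betw prod.swap (A \<times> B) (B \<times> A)"
  by (simp add: bij_betw_def product_swap)

section \<open>Closure of the numerable covers of spaces under the four operations\<close>

text \<open>A choice \<open>r\<close> of a larger member for every index groups the old partition:
  \<open>g j\<close> adds up the \<open>f i\<close> with \<open>r i = j\<close>. Writing this as a
  sum over all of \<open>I\<close> with zeros makes it a family dominated by \<open>f\<close>, which
  gives continuity even when infinitely many \<open>i\<close> share the same
  \<open>j\<close>.\<close>

lemma numerable_coarsening:
  assumes num: "numerable X I U" and cov: "open_cover X J V" and ref: "\<forall>i\<in>I. \<exists>j\<in>J. U i \<subseteq> V j"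
  shows "numerable X J V"
proof -
  obtain r where r: "\<And>i. i \<in> I \<Longrightarrow> r i \<in> J \<and> U i \<subseteq> V (r i)" using ref by metis
  obtain f where f: "positive_partition X I f" and sub: "\<forall>i\<in>I. {x \<in> topspace X. 0 < f i x} \<subseteq> U i"
    using num unfolding numerable_def by blast
  note f' = positive_partitionD[OF f]
  define h where "h j i x = (if r i = j then f i x else 0)" for j i x
  define g where "g j x = (\<Sum>\<^sub>\<infinity>i\<in>I. h j i x)" for j x
  have conth: "continuous_map X euclideanreal (h j i)" if "i \<in> I" for i j
    using f'(1)[OF that] unfolding h_def by (cases "r i = j") simp_all
  have le: "0 \<le> h j i x" "h j i x \<le> f i x" if "i \<in> I" "x \<in> topspace X" for x i j
    using f'(2)[OF that] by (auto simp: h_def)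
  have cont: "continuous_map X euclideanreal (g j)" for j
    unfolding g_def by (rule continuous_map_infsum_dominated[OF f'(1) conth le f'(3,4)])
  have summ: "(\<lambda>i. h j i x) summable_on I" if "x \<in> topspace X" for x j
    by (rule summable_on_comparison_test[OF f'(3)[OF that] le(2,1)[OF _ that]])
  have hs: "((\<lambda>j. g j x) has_sum (\<Sum>\<^sub>\<infinity>i\<in>I. f i x)) J" if x: "x \<in> topspace X" for x
  proof -
    \<comment> \<open>Row \<open>i\<close> can be non-zero only in column \<open>r i\<close>, so the
      row sums are the \<open>f i x\<close>; exchanging the factors then yields the column sums
      \<open>g j x\<close>.\<close>
    have "((\<lambda>(i, j). h j i x) has_sum (\<Sum>\<^sub>\<infinity>i\<in>I. f i x)) (I \<times> J)"
    proof (rule nonneg_has_sum_SigmaI)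
      show "((\<lambda>j. case (i, j) of (i, j) \<Rightarrow> h j i x) has_sum f i x) J" if "i \<in> I" for i
        using r[OF that] by (intro has_sum_finite_neutralI[of "{r i}"]) (auto simp: h_def)
    qed (use has_sum_infsum[OF f'(3)[OF x]] x le(1) in auto)
    then have "((\<lambda>(j, i). h j i x) has_sum (\<Sum>\<^sub>\<infinity>i\<in>I. f i x)) (J \<times> I)"
      using has_sum_reindex_bij_betw[OF bij_betw_swap[of J I], of "\<lambda>(i, j). h j i x"]
      by (simp add: case_prod_unfold)
    then show ?thesis
      by (rule has_sum_SigmaD) (use has_sum_infsum[OF summ[OF x]] in \<open>simp add: g_def\<close>)
  qed
  have "positive_partition X J g"
    by (rule positive_partitionI[OF cont _ hs f'(4,5)]) (use le(1) in \<open>auto simp: g_def intro!: infsum_nonneg\<close>)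
  moreover have "{x \<in> topspace X. 0 < g j x} \<subseteq> V j" if "j \<in> J" for j
  proof clarify
    fix x assume x: "x \<in> topspace X" "0 < g j x"
    then have "\<exists>i\<in>I. h j i x \<noteq> 0" unfolding g_def by (metis infsum_0 order_less_irrefl)
    then obtain i where "i \<in> I" "h j i x \<noteq> 0" by blast
    then have "r i = j" "f i x \<noteq> 0" by (auto simp: h_def split: if_splits)
    then have "0 < f i x" using f'(2) \<open>i \<in> I\<close> x(1) by (auto simp: less_le)
    then show "x \<in> V j" using r[OF \<open>i \<in> I\<close>] sub x \<open>i \<in> I\<close> \<open>r i = j\<close> by blast
  qed
  ultimately show ?thesis unfolding numerable_def using cov by blast
qed

text \<open>The indicator functions form a partition: each member is clopen, its complement being
  the union of the other members.\<close>

lemma numerable_disjoint: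
  assumes cov: "open_cover X I U" and dis: "disjoint_family_on U I"
  shows "numerable X I U"
proof -
  define f where "f i x = (if x \<in> U i then 1 else 0 :: real)" for i x
  have hs: "((\<lambda>i. f i x) has_sum 1) I" if x: "x \<in> topspace X" for x
  proof -
    obtain i where i: "i \<in> I" "x \<in> U i" using cov x unfolding open_cover_def by blast
    then have "f j x = 0" if "j \<in> I - {i}" for j
      using dis that unfolding disjoint_family_on_def f_def by auto
    then show ?thesis
      using i by (intro has_sum_finite_neutralI[of "{i}"]) (auto simp: f_def)
  qed
  have "continuous_map X euclideanreal (f i)" if i: "i \<in> I" for i
  proof -
    have op: "openin X (U i)" "openin X (\<Union>j\<in>I-{i}. U j)"
      using cov i unfolding open_cover_def by auto
    have "topspace X - U i = (\<Union>j\<in>I-{i}. U j)"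
      using cov i dis unfolding open_cover_def disjoint_family_on_def by blast
    then have op': "openin X (topspace X - U i)" using op by simp
    have *: "{x \<in> topspace X. f i x \<in> W} =
        (if 1 \<in> W then U i else {}) \<union> (if 0 \<in> W then topspace X - U i else {})" for W
      using openin_subset[OF op(1)] by (auto simp: f_def split: if_splits)
    show ?thesis unfolding continuous_map_def * using op op' by auto
  qed
  then have "positive_partition X I f"
    using hs by (intro positive_partitionI[where s = "\<lambda>_. 1"]) (auto simp: f_def)
  moreover have "{x \<in> topspace X. 0 < f i x} \<subseteq> U i" for i by (auto simp: f_def)
  ultimately show ?thesis unfolding numerable_def using cov by blast
qed

lemma numerable_homeomorphic_image:
  assumes num: "numerable X I U" and hom: "homeomorphic_map X Y h"
  shows "numerable Y I (\<lambda>i. h ` U i)"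
proof -
  obtain k where "homeomorphic_maps X Y h k" using hom homeomorphic_map_maps by blast
  then have k: "continuous_map Y X k" and kh: "\<And>x. x \<in> topspace X \<Longrightarrow> k (h x) = x"
    and hk: "\<And>y. y \<in> topspace Y \<Longrightarrow> h (k y) = y"
    unfolding homeomorphic_maps_def by auto
  have kY: "k y \<in> topspace X" if "y \<in> topspace Y" for y
    using k that unfolding continuous_map_def by blast
  obtain f where f: "positive_partition X I f" and sub: "\<forall>i\<in>I. {x \<in> topspace X. 0 < f i x} \<subseteq> U i"
    using num unfolding numerable_def by blast
  have cov: "open_cover X I U" using num unfolding numerable_def by blast
  have "openin Y (h ` U i)" if "i \<in> I" for i
    using homeomorphic_imp_open_map[OF hom] cov that unfolding open_map_def open_cover_def by blast
  moreover have "(\<Union>i\<in>I. h ` U i) = topspace Y"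
    using homeomorphic_imp_surjective_map[OF hom] cov unfolding open_cover_def by (metis image_UN)
  ultimately have "open_cover Y I (\<lambda>i. h ` U i)" unfolding open_cover_def by blast
  moreover have "positive_partition Y I (\<lambda>i y. f i (k y))"
  proof (rule positive_partitionI)
    note f' = positive_partitionD[OF f]
    show "continuous_map Y euclideanreal (\<lambda>y. f i (k y))" if "i \<in> I" for i
      using continuous_map_compose[OF k f'(1)[OF that]] by (simp add: o_def)
    show "continuous_map Y euclideanreal (\<lambda>y. \<Sum>\<^sub>\<infinity>i\<in>I. f i (k y))"
      using continuous_map_compose[OF k f'(4)] by (simp add: o_def)
    show "0 \<le> f i (k y)" if "i \<in> I" "y \<in> topspace Y" for i y
      using f'(2)[OF that(1) kY[OF that(2)]] .
    show "((\<lambda>i. f i (k y)) has_sum (\<Sum>\<^sub>\<infinity>i\<in>I. f i (k y))) I" if "y \<in> topspace Y" for y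
      using has_sum_infsum[OF f'(3)[OF kY[OF that]]] .
    show "0 < (\<Sum>\<^sub>\<infinity>i\<in>I. f i (k y))" if "y \<in> topspace Y" for y
      using f'(5)[OF kY[OF that]] .
  qed
  moreover have "{y \<in> topspace Y. 0 < f i (k y)} \<subseteq> h ` U i" if "i \<in> I" for i
  proof clarify
    fix y assume y: "y \<in> topspace Y" "0 < f i (k y)"
    then have "k y \<in> U i" using sub that kY by blast
    then show "y \<in> h ` U i" using hk[OF y(1)] by (metis imageI)
  qed
  ultimately show ?thesis unfolding numerable_def by blast
qed

text \<open>The only problem is at points outside \<open>U\<close>. There \<open>f\<close> vanishes,
  so it is small nearby, and the bound by \<open>f\<close> makes \<open>g\<close> small too,
  although \<open>g\<close> itself is given only on \<open>U\<close>.\<close>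

lemma continuous_map_extend_by_zero:
  fixes f g :: "'a \<Rightarrow> real"
  assumes U: "openin X U" and f: "continuous_map X euclideanreal f"
    and g: "continuous_map (subtopology X U) euclideanreal g"
    and fU: "\<And>x. x \<in> topspace X \<Longrightarrow> x \<notin> U \<Longrightarrow> f x = 0"
    and bd: "\<And>x. x \<in> U \<Longrightarrow> \<bar>g x\<bar> \<le> \<bar>f x\<bar>"
  shows "continuous_map X euclideanreal (\<lambda>x. if x \<in> U then g x else 0)"
proof -
  have "openin X {x \<in> topspace X. (if x \<in> U then g x else 0) \<in> W}" if W: "open W" for W
  proof (subst openin_subopen, intro ballI)
    fix x assume x: "x \<in> {x \<in> topspace X. (if x \<in> U then g x else 0) \<in> W}"
    show "\<exists>T. openin X T \<and> x \<in> T \<and> T \<subseteq> {x \<in> topspace X. (if x \<in> U then g x else 0) \<in> W}"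
    proof (cases "x \<in> U")
      case True
      have "openin (subtopology X U) {y \<in> topspace (subtopology X U). g y \<in> W}"
        using g W unfolding continuous_map_def by simp
      then have "openin X {y \<in> topspace (subtopology X U). g y \<in> W}"
        using U openin_open_subtopology by blast
      moreover have "x \<in> {y \<in> topspace (subtopology X U). g y \<in> W}" using True x by simp
      moreover have "{y \<in> topspace (subtopology X U). g y \<in> W}
          \<subseteq> {x \<in> topspace X. (if x \<in> U then g x else 0) \<in> W}" by auto
      ultimately show ?thesis by blast
    next
      case False
      then have "0 \<in> W" using x by simp
      then obtain e where e: "e > 0" "ball 0 e \<subseteq> W" using W by (meson openE)
      have "openin X {y \<in> topspace X. f y \<in> ball 0 e}"
        using f unfolding continuous_map_def by (metis open_ball open_openin)
      moreover have "x \<in> {y \<in> topspace X. f y \<in> ball 0 e}" using x False fU[of x] e(1) by simp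
      moreover have "{y \<in> topspace X. f y \<in> ball 0 e}
          \<subseteq> {x \<in> topspace X. (if x \<in> U then g x else 0) \<in> W}"
      proof clarify
        fix y assume y: "f y \<in> ball 0 e"
        have "(if y \<in> U then g y else 0) \<in> ball 0 e"
          using bd[of y] y e(1) by (cases "y \<in> U") (simp_all add: dist_real_def)
        then show "(if y \<in> U then g y else 0) \<in> W" using e(2) by blast
      qed
      ultimately show ?thesis by blast
    qed
  qed
  then show ?thesis unfolding continuous_map_def by simp
qed

lemma open_cover_composition:
  assumes cov: "open_cover X I U" and cov': "\<And>i. i \<in> I \<Longrightarrow> open_cover (subtopology X (U i)) (J i) (V i)"
    and h: "bij_betw h K (SIGMA i:I. J i)"
  shows "open_cover X K (\<lambda>k. case h k of (i, j) \<Rightarrow> V i j)"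
proof -
  have hK: "\<exists>i j. h k = (i, j) \<and> i \<in> I \<and> j \<in> J i" if "k \<in> K" for k
    using h that unfolding bij_betw_def by blast
  have U: "openin X (U i)" "topspace (subtopology X (U i)) = U i" if "i \<in> I" for i
    using cov that openin_subset[of X "U i"] unfolding open_cover_def by auto
  have V: "openin X (V i j)" if "i \<in> I" "j \<in> J i" for i j
    using cov'[OF that(1)] that(2) openin_open_subtopology[OF U(1)[OF that(1)]]
    unfolding open_cover_def by blast
  have VU: "(\<Union>j\<in>J i. V i j) = U i" if "i \<in> I" for i
    using cov'[OF that] U(2)[OF that] unfolding open_cover_def by simp
  have "(\<Union>k\<in>K. case h k of (i, j) \<Rightarrow> V i j) = (\<Union>(i, j)\<in>h ` K. V i j)" by auto
  also have "\<dots> = (\<Union>i\<in>I. \<Union>j\<in>J i. V i j)" using h unfolding bij_betw_def by auto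
  also have "\<dots> = topspace X" using VU cov unfolding open_cover_def by auto
  finally have "(\<Union>k\<in>K. case h k of (i, j) \<Rightarrow> V i j) = topspace X" .
  moreover have "openin X (case h k of (i, j) \<Rightarrow> V i j)" if "k \<in> K" for k
    using hK[OF that] V by auto
  ultimately show ?thesis unfolding open_cover_def by blast
qed

text \<open>The products \<open>f i * g i j\<close> are divided by the sum \<open>G i\<close> of the
  inner partition. Then row \<open>i\<close> adds up to \<open>f i\<close>, so the total is
  unchanged, and every entry is at most \<open>f i\<close>. This bound allows extension by zero
  beyond \<open>U i\<close>, where the inner partition is undefined and near which
  \<open>G i\<close> may blow up or tend to zero.\<close>

lemma numerable_composition:
  assumes num: "numerable X I U" and num': "\<And>i. i \<in> I \<Longrightarrow> numerable (subtopology X (U i)) (J i) (V i)"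
    and h: "bij_betw h K (SIGMA i:I. J i)"
  shows "numerable X K (\<lambda>k. case h k of (i, j) \<Rightarrow> V i j)"
proof -
  obtain f where f: "positive_partition X I f" and sub: "\<forall>i\<in>I. {x \<in> topspace X. 0 < f i x} \<subseteq> U i"
    using num unfolding numerable_def by blast
  have "\<exists>g. positive_partition (subtopology X (U i)) (J i) g \<and>
      (\<forall>j\<in>J i. {x \<in> topspace (subtopology X (U i)). 0 < g j x} \<subseteq> V i j)" if "i \<in> I" for i
    using num'[OF that] unfolding numerable_def by blast
  then obtain g where g: "\<And>i. i \<in> I \<Longrightarrow> positive_partition (subtopology X (U i)) (J i) (g i)"
    and gsub: "\<And>i j. i \<in> I \<Longrightarrow> j \<in> J i \<Longrightarrow> {x \<in> topspace (subtopology X (U i)). 0 < g i j x} \<subseteq> V i j"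
    by metis
  note f' = positive_partitionD[OF f]
  note g' = positive_partitionD[OF g]
  have U: "openin X (U i)" "U i \<subseteq> topspace X" if "i \<in> I" for i
    using num that openin_subset unfolding numerable_def open_cover_def by auto
  have top: "topspace (subtopology X (U i)) = U i" if "i \<in> I" for i using U[OF that] by auto
  have hK: "\<exists>i j. h k = (i, j) \<and> i \<in> I \<and> j \<in> J i" if "k \<in> K" for k
    using h that unfolding bij_betw_def by blast
  have cov: "open_cover X K (\<lambda>k. case h k of (i, j) \<Rightarrow> V i j)"
    using num num' unfolding numerable_def by (intro open_cover_composition[OF _ _ h]) blast+
  define G where "G i x = (\<Sum>\<^sub>\<infinity>j\<in>J i. g i j x)" for i x
  define p where "p i j x = (if x \<in> U i then f i x * g i j x / G i x else 0)" for i j x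
  have gnn: "0 \<le> g i j x" if "i \<in> I" "j \<in> J i" "x \<in> U i" for i j x
    using g'(2)[OF that(1,2)] top[OF that(1)] that(3) by blast
  have G: "0 < G i x" "((\<lambda>j. g i j x) has_sum G i x) (J i)" if "i \<in> I" "x \<in> U i" for i x
    using g'(5)[OF that(1)] has_sum_infsum[OF g'(3)[OF that(1)]] top[OF that(1)] that(2)
    unfolding G_def by blast+
  have nonneg: "0 \<le> p i j x" if "i \<in> I" "j \<in> J i" "x \<in> topspace X" for i j x
    using f'(2)[OF that(1,3)] gnn[OF that(1,2)] G(1)[OF that(1)] unfolding p_def
    by (auto intro!: divide_nonneg_pos mult_nonneg_nonneg)
  have f0: "f i x = 0" if "i \<in> I" "x \<in> topspace X" "x \<notin> U i" for i x
    using sub f'(2)[OF that(1,2)] that by (force simp: order_le_less)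
  have cont: "continuous_map X euclideanreal (p i j)" if i: "i \<in> I" and j: "j \<in> J i" for i j
    unfolding p_def
  proof (rule continuous_map_extend_by_zero[OF U(1)[OF i] f'(1)[OF i]])
    show "continuous_map (subtopology X (U i)) euclideanreal (\<lambda>x. f i x * g i j x / G i x)"
      using continuous_map_from_subtopology[OF f'(1)[OF i]] g'(1)[OF i j] g'(4)[OF i] G(1)[OF i] top[OF i]
      unfolding G_def
      by (intro continuous_map_real_divide continuous_map_real_mult) (auto simp: less_le)
    fix x assume x: "x \<in> U i"
    have "g i j x \<le> G i x"
      using finite_sum_le_has_sum[OF G(2)[OF i x], of "{j}"] gnn[OF i _ x] j by auto
    then have "\<bar>f i x\<bar> * g i j x \<le> \<bar>f i x\<bar> * G i x" by (rule mult_left_mono) simp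
    then show "\<bar>f i x * g i j x / G i x\<bar> \<le> \<bar>f i x\<bar>"
      using G(1)[OF i x] gnn[OF i j x] by (simp add: abs_mult field_simps)
  qed (use f0 i in blast)
  have "((\<lambda>(i, j). p i j x) has_sum (\<Sum>\<^sub>\<infinity>i\<in>I. f i x)) (SIGMA i:I. J i)" if x: "x \<in> topspace X" for x
  proof (rule nonneg_has_sum_SigmaI)
    show "((\<lambda>j. case (i, j) of (i, j) \<Rightarrow> p i j x) has_sum f i x) (J i)" if i: "i \<in> I" for i
    proof (cases "x \<in> U i")
      case True
      have "((\<lambda>j. f i x / G i x * g i j x) has_sum f i x / G i x * G i x) (J i)"
        using G(2)[OF i True] by (rule has_sum_cmult_right)
      then show ?thesis using True G(1)[OF i True] by (simp add: p_def)
    next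
      case False
      then show ?thesis using f0[OF i x False] by (simp add: p_def)
    qed
  qed (use has_sum_infsum[OF f'(3)[OF x]] x nonneg in auto)
  then have hs: "((\<lambda>k. case h k of (i, j) \<Rightarrow> p i j x) has_sum (\<Sum>\<^sub>\<infinity>i\<in>I. f i x)) K"
    if "x \<in> topspace X" for x
    using that has_sum_reindex_bij_betw[OF h, of "\<lambda>(i, j). p i j x"] by blast
  have "positive_partition X K (\<lambda>k x. case h k of (i, j) \<Rightarrow> p i j x)"
  proof (rule positive_partitionI[OF _ _ hs f'(4,5)])
    fix k assume "k \<in> K"
    then obtain i j where "h k = (i, j)" "i \<in> I" "j \<in> J i" using hK by blast
    then show "continuous_map X euclideanreal (\<lambda>x. case h k of (i, j) \<Rightarrow> p i j x)"
      and "x \<in> topspace X \<Longrightarrow> 0 \<le> (case h k of (i, j) \<Rightarrow> p i j x)" for x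
      using cont nonneg by auto
  qed
  moreover have "{x \<in> topspace X. 0 < (case h k of (i, j) \<Rightarrow> p i j x)}
      \<subseteq> (case h k of (i, j) \<Rightarrow> V i j)" if k: "k \<in> K" for k
  proof -
    obtain i j where ij: "h k = (i, j)" "i \<in> I" "j \<in> J i" using hK[OF k] by blast
    have "0 < g i j x" "x \<in> U i" if "0 < p i j x" "x \<in> topspace X" for x
    proof -
      show "x \<in> U i" using that by (auto simp: p_def split: if_splits)
      then show "0 < g i j x"
        using that gnn[OF ij(2,3)] unfolding p_def by (auto simp: less_le)
    qed
    then show ?thesis using gsub[OF ij(2,3)] ij top by auto
  qed
  ultimately show ?thesis
    unfolding numerable_def by (intro conjI[OF cov] exI[of _ "\<lambda>k x. case h k of (i, j) \<Rightarrow> p i j x"]) simp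
qed

lemma admissible_numerable: "admissible_cover_class numerable"
  unfolding admissible_cover_class_def
proof (intro conjI allI impI; (elim conjE)?)
  fix X :: "'a topology" and I J K :: "'i set" and U V W h
  show "open_cover X I U" if "numerable X I U" using that unfolding numerable_def by blast
  show "numerable X I U" if "open_cover X I U" "disjoint_family_on U I"
    using that by (rule numerable_disjoint)
  show "numerable X J V" if "numerable X I U" "open_cover X J V" "\<forall>i\<in>I. \<exists>j\<in>J. U i \<subseteq> V j"
    using that by (rule numerable_coarsening)
  show "numerable Y I (\<lambda>i. \<iota> ` U i)" if "numerable X I U" "homeomorphic_map X Y \<iota>" for Y :: "'a topology" and \<iota>
    using that by (rule numerable_homeomorphic_image)
  show "numerable X K (\<lambda>k. case h k of (i, j) \<Rightarrow> V i j)"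
    if "numerable X I U" "\<forall>i\<in>I. numerable (subtopology X (U i)) (J i) (V i)" "bij_betw h K (SIGMA i:I. J i)"
    for J and V :: "'i \<Rightarrow> 'i \<Rightarrow> 'a set"
    using that by (blast intro: numerable_composition)
qed

section \<open>Minimality among covers of spaces\<close>

text \<open>The element \<open>0\<close> takes care of index sets with fewer than \<open>k\<close> elements.\<close>

definition kth_largest :: "'i set \<Rightarrow> nat \<Rightarrow> ('i \<Rightarrow> real) \<Rightarrow> real" where
  "kth_largest I k a = Sup (insert 0 {c. \<exists>J\<subseteq>I. finite J \<and> card J = k \<and> (\<forall>i\<in>J. c \<le> a i)})"

lemma kth_largest_bdd:
  assumes bd: "\<And>i. i \<in> I \<Longrightarrow> a i \<le> B" and k: "0 < k"
  shows "bdd_above (insert (0 :: real) {c. \<exists>J\<subseteq>I. finite J \<and> card J = k \<and> (\<forall>i\<in>J. c \<le> a i)})"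
proof (rule bdd_aboveI)
  fix x assume x: "x \<in> insert 0 {c. \<exists>J\<subseteq>I. finite J \<and> card J = k \<and> (\<forall>i\<in>J. c \<le> a i)}"
  show "x \<le> max 0 B"
  proof (cases "x = 0")
    case False
    then obtain J where J: "J \<subseteq> I" "card J = k" "\<forall>i\<in>J. x \<le> a i" using x by blast
    then have "J \<noteq> {}" using k by auto
    then obtain i where "i \<in> J" by blast
    then show ?thesis using bd[of i] J by (meson max.coboundedI2 order_trans subsetD)
  qed simp
qed

text \<open>The condition \<open>0 \<le> c\<close> keeps the inserted element 0 from being a
  witness. Conversely, strict inequalities on a finite set leave room: the minimum of
  \<open>a\<close> on \<open>J\<close>, which is non-empty as \<open>0 < k\<close>, is an admissible
  value above \<open>c\<close>.\<close>

lemma less_kth_largest_iff: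
  assumes bd: "\<And>i. i \<in> I \<Longrightarrow> a i \<le> B" and k: "0 < k" and c: "0 \<le> c"
  shows "c < kth_largest I k a \<longleftrightarrow> (\<exists>J\<subseteq>I. finite J \<and> card J = k \<and> (\<forall>i\<in>J. c < a i))"
proof -
  let ?S = "insert 0 {c. \<exists>J\<subseteq>I. finite J \<and> card J = k \<and> (\<forall>i\<in>J. c \<le> a i)}"
  have bdd: "bdd_above ?S" using bd k by (rule kth_largest_bdd)
  show ?thesis
  proof
    assume "c < kth_largest I k a"
    then obtain d where "d \<in> ?S" "c < d"
      unfolding kth_largest_def using less_cSup_iff[OF _ bdd, of c] by blast
    then show "\<exists>J\<subseteq>I. finite J \<and> card J = k \<and> (\<forall>i\<in>J. c < a i)"
      using c by (smt (verit) insert_iff mem_Collect_eq)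
  next
    assume "\<exists>J\<subseteq>I. finite J \<and> card J = k \<and> (\<forall>i\<in>J. c < a i)"
    then obtain J where J: "J \<subseteq> I" "finite J" "card J = k" "\<forall>i\<in>J. c < a i" by blast
    then have ne: "J \<noteq> {}" using k by auto
    have "c < Min (a ` J)" using J ne by simp
    moreover have "Min (a ` J) \<in> ?S"
    proof -
      have "\<forall>i\<in>J. Min (a ` J) \<le> a i" using J(2) by simp
      then show ?thesis using J by blast
    qed
    then have "Min (a ` J) \<le> Sup ?S" using bdd by (rule cSup_upper)
    ultimately show "c < kth_largest I k a" unfolding kth_largest_def by linarith
  qed
qed

lemma kth_largest_nonneg:
  assumes bd: "\<And>i. i \<in> I \<Longrightarrow> a i \<le> B" and k: "0 < k"
  shows "0 \<le> kth_largest I k a"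
  unfolding kth_largest_def by (rule cSup_upper[OF insertI1 kth_largest_bdd[OF bd k]])

lemma kth_largest_Suc_le:
  assumes bd: "\<And>i. i \<in> I \<Longrightarrow> a i \<le> B" and k: "0 < k"
  shows "kth_largest I (Suc k) a \<le> kth_largest I k a"
proof (rule ccontr)
  let ?c = "kth_largest I k a"
  assume "\<not> ?thesis"
  then have "?c < kth_largest I (Suc k) a" by simp
  then obtain J where J: "J \<subseteq> I" "finite J" "card J = Suc k" "\<forall>i\<in>J. ?c < a i"
    using less_kth_largest_iff[of I a B "Suc k" ?c] bd kth_largest_nonneg[of I a B, OF bd k] by blast
  then obtain i where "i \<in> J" by fastforce
  then have "card (J - {i}) = k" "finite (J - {i})" "J - {i} \<subseteq> I" using J by auto
  then have "?c < ?c"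
    using less_kth_largest_iff[of I a B k ?c] bd k kth_largest_nonneg[of I a B, OF bd k] J(4) by blast
  then show False by simp
qed

section \<open>The ranked values of a positive partition on a space\<close>

locale partition =
  fixes X :: "'a topology" and I :: "'i set" and f :: "'i \<Rightarrow> 'a \<Rightarrow> real"
  assumes part: "positive_partition X I f"
begin

abbreviation total :: "'a \<Rightarrow> real" where
  "total x \<equiv> \<Sum>\<^sub>\<infinity>i\<in>I. f i x"

abbreviation ranked :: "nat \<Rightarrow> 'a \<Rightarrow> real" where
  "ranked k x \<equiv> kth_largest I k (\<lambda>i. f i x)"

lemmas cont = positive_partitionD(1)[OF part]
  and nonneg = positive_partitionD(2)[OF part]
  and summable = positive_partitionD(3)[OF part]
  and cont_total = positive_partitionD(4)[OF part]
  and total_pos = positive_partitionD(5)[OF part]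

lemma sum_le_total: "x \<in> topspace X \<Longrightarrow> J \<subseteq> I \<Longrightarrow> finite J \<Longrightarrow> (\<Sum>i\<in>J. f i x) \<le> total x"
  using finite_sum_le_infsum[OF summable, of x J] nonneg by auto

lemma le_total: "x \<in> topspace X \<Longrightarrow> i \<in> I \<Longrightarrow> f i x \<le> total x"
  using sum_le_total[of x "{i}"] by simp

lemma less_ranked_iff:
  assumes "x \<in> topspace X" "0 < k" "0 \<le> c"
  shows "c < ranked k x \<longleftrightarrow> (\<exists>J\<subseteq>I. finite J \<and> card J = k \<and> (\<forall>i\<in>J. c < f i x))"
  using less_kth_largest_iff[where a = "\<lambda>i. f i x" and I = I, OF le_total[OF assms(1)] assms(2,3)] .

lemma ranked_nonneg: "x \<in> topspace X \<Longrightarrow> 0 < k \<Longrightarrow> 0 \<le> ranked k x"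
  using kth_largest_nonneg[where a = "\<lambda>i. f i x" and I = I, OF le_total] .

lemma ranked_Suc_le: "x \<in> topspace X \<Longrightarrow> 0 < k \<Longrightarrow> ranked (Suc k) x \<le> ranked k x"
  using kth_largest_Suc_le[where a = "\<lambda>i. f i x" and I = I, OF le_total] .

lemma ranked_le_1:
  assumes x: "x \<in> topspace X" and k: "0 < k"
  shows "ranked k x \<le> ranked 1 x"
  using k
proof (induction k rule: nat_induct_non_zero)
  case (Suc k)
  then show ?case using ranked_Suc_le[OF x, of k] by linarith
qed simp

lemma ranked_1_pos:
  assumes x: "x \<in> topspace X"
  shows "0 < ranked 1 x"
proof -
  obtain J where "J \<subseteq> I" "0 < (\<Sum>i\<in>J. f i x)"
    using less_infsum_iff[OF summable[OF x], of 0] nonneg[OF _ x] total_pos[OF x] by blast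
  then obtain i where i: "i \<in> I" "0 < f i x" by (metis not_le subsetD sum_nonpos)
  then show ?thesis using x less_ranked_iff[OF x, of 1 0] by (auto intro!: exI[of _ "{i}"])
qed

text \<open>If \<open>k\<close> of the values exceeded \<open>total x / k\<close>, their sum would
  exceed the total. This converts a bound on the ratio of the total to the largest value into a
  bound on the rank.\<close>

lemma ranked_le:
  assumes x: "x \<in> topspace X" and k: "0 < k"
  shows "k * ranked k x \<le> total x"
proof (rule ccontr)
  assume "\<not> ?thesis"
  then have "total x / k < ranked k x" using k by (simp add: field_simps)
  moreover have "0 \<le> total x / k" using total_pos[OF x] by simp
  ultimately obtain J where J: "J \<subseteq> I" "finite J" "card J = k" "\<forall>i\<in>J. total x / k < f i x"
    using less_ranked_iff[OF x k] by blast
  then have "J \<noteq> {}" using k by auto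
  then have "(\<Sum>i\<in>J. total x / k) < (\<Sum>i\<in>J. f i x)" using J by (intro sum_strict_mono) auto
  then have "total x < (\<Sum>i\<in>J. f i x)" using J(3) k by simp
  then show False using sum_le_total[OF x J(1,2)] by simp
qed

text \<open>The supports of the \<open>f i\<close> need not be locally finite, but up to
  \<open>e\<close> the family is: the tail \<open>total - (\<Sum>i\<in>J. f i)\<close> is
  continuous, small at \<open>x\<close> for a suitable finite \<open>J\<close>, and dominates every
  \<open>f i\<close> with \<open>i\<close> outside \<open>J\<close>.\<close>

lemma locally_finite:
  assumes x: "x \<in> topspace X" and e: "0 < e"
  obtains N J where "openin X N" "x \<in> N" "finite J" "J \<subseteq> I" "\<And>y i. y \<in> N \<Longrightarrow> i \<in> I - J \<Longrightarrow> f i y < e"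
proof -
  obtain J where J: "J \<subseteq> I" "finite J" "total x - e < (\<Sum>i\<in>J. f i x)"
    using less_infsum_iff[OF summable[OF x], of "total x - e"] nonneg[OF _ x] e by auto
  let ?N = "{y \<in> topspace X. total y - (\<Sum>i\<in>J. f i y) < e}"
  have "openin X ?N"
    using J cont by (intro openin_sublevel continuous_map_diff cont_total continuous_map_sum) auto
  moreover have "f i y < e" if "y \<in> ?N" "i \<in> I - J" for y i
    using sum_le_total[of y "insert i J"] that J by auto
  ultimately show thesis using that[of ?N J] x J by auto
qed

text \<open>Having \<open>k\<close> values above \<open>c\<close> is an open condition, which gives
  one semicontinuity. For the other, infinitely many indices could grow near \<open>x\<close>;
  \<open>locally_finite\<close> leaves only finitely many to control.\<close>

lemma continuous_ranked:
  assumes k: "0 < k"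
  shows "continuous_map X euclideanreal (ranked k)"
  unfolding continuous_map_upper_lower_semicontinuous_lt
proof (intro conjI allI)
  fix c
  show "openin X {x \<in> topspace X. c < ranked k x}"
  proof (cases "0 \<le> c")
    case True
    have "{x \<in> topspace X. c < ranked k x}
        = (\<Union>J\<in>{J. J \<subseteq> I \<and> finite J \<and> card J = k}. {x \<in> topspace X. \<forall>i\<in>J. c < f i x})"
      using less_ranked_iff[OF _ k True] by auto
    moreover have "openin X {x \<in> topspace X. \<forall>i\<in>J. c < f i x}" if J: "J \<subseteq> I" "finite J" for J
      using J(2,1)
    proof (induction J)
      case (insert i J)
      have "{x \<in> topspace X. \<forall>i\<in>insert i J. c < f i x}
          = {x \<in> topspace X. c < f i x} \<inter> {x \<in> topspace X. \<forall>i\<in>J. c < f i x}" by auto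
      moreover have "openin X {x \<in> topspace X. c < f i x}"
        using insert.prems by (intro openin_superlevel cont) simp
      ultimately show ?case using insert.IH insert.prems by (simp add: openin_Int)
    qed simp
    ultimately show ?thesis by auto
  next
    case False
    then have "{x \<in> topspace X. c < ranked k x} = topspace X" using ranked_nonneg[OF _ k] by force
    then show ?thesis by simp
  qed
  show "openin X {x \<in> topspace X. ranked k x < c}"
  proof (subst openin_subopen, intro ballI)
    fix x assume "x \<in> {x \<in> topspace X. ranked k x < c}"
    then have x: "x \<in> topspace X" "ranked k x < c" by auto
    \<comment> \<open>Below \<open>d\<close> lie all indices outside \<open>J\<close> near
      \<open>x\<close>, and \<open>d\<close> separates the small from the large values at
      \<open>x\<close>. The gap up to \<open>d'\<close> lets the finitely many small values grow, so
      an index above \<open>d'\<close> near \<open>x\<close> was already above \<open>d\<close> at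
      \<open>x\<close>. The gap from \<open>d'\<close> to \<open>c\<close> makes the conclusion
      strict.\<close>
    then obtain d d' where d: "ranked k x < d" "d < d'" "d' < c" by (meson dense)
    then have d0: "0 < d" using ranked_nonneg[OF x(1) k] by linarith
    obtain N J where N: "openin X N" "x \<in> N" "finite J" "J \<subseteq> I"
      "\<And>y i. y \<in> N \<Longrightarrow> i \<in> I - J \<Longrightarrow> f i y < d" using locally_finite[OF x(1) d0] by metis
    let ?J = "{i \<in> J. f i x \<le> d}"
    let ?M = "N \<inter> (topspace X \<inter> (\<Inter>i\<in>?J. {y \<in> topspace X. f i y < d'}))"
    have "openin X (topspace X \<inter> (\<Inter>i\<in>?J. {y \<in> topspace X. f i y < d'}))"
      using N(3,4) cont by (intro openin_Int_Inter) (auto intro: openin_sublevel)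
    then have "openin X ?M" using N(1) by blast
    moreover have "x \<in> ?M" using N(2) x(1) d(2) by auto
    moreover have "?M \<subseteq> {x \<in> topspace X. ranked k x < c}"
    proof clarify
      fix y assume y: "y \<in> N" "y \<in> topspace X" "y \<in> (\<Inter>i\<in>?J. {y \<in> topspace X. f i y < d'})"
      have "\<not> d' < ranked k y"
      proof
        assume "d' < ranked k y"
        then obtain K where K: "K \<subseteq> I" "finite K" "card K = k" "\<forall>i\<in>K. d' < f i y"
          using less_ranked_iff[OF y(2) k, of d'] d d0 by auto
        have "d < f i x" if i: "i \<in> K" for i
        proof (rule ccontr)
          assume "\<not> d < f i x"
          moreover have "i \<in> J" using N(5)[OF y(1), of i] K i d(2) by force
          ultimately have "f i y < d'" using y(3) by auto
          then show False using K(4) i by force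
        qed
        then have "d < ranked k x" using less_ranked_iff[OF x(1) k, of d] K d0 by auto
        then show False using d(1) by simp
      qed
      then show "ranked k y < c" using d(3) by simp
    qed
    ultimately show "\<exists>T. openin X T \<and> x \<in> T \<and> T \<subseteq> {x \<in> topspace X. ranked k x < c}" by blast
  qed
qed

text \<open>Without a gap between the two ranked values at \<open>k\<close> and \<open>Suc k\<close>
  this set can have fewer than \<open>k\<close> elements; it is used only where there is a
  gap.\<close>

definition leading :: "nat \<Rightarrow> 'a \<Rightarrow> 'i set" where
  "leading k x = {i \<in> I. ranked (Suc k) x < f i x}"

text \<open>Every threshold in the gap cuts out the same \<open>k\<close> indices, since one more
  index above the lower end would raise the next ranked value. The freedom in \<open>c\<close>
  allows the same threshold to serve for all points near a given one.\<close>

lemma leading_eq: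
  assumes x: "x \<in> topspace X" and k: "0 < k" and c: "ranked (Suc k) x \<le> c" "c < ranked k x"
  shows "leading k x = {i \<in> I. c < f i x}" and "finite (leading k x)" and "card (leading k x) = k"
proof -
  have c0: "0 \<le> c" using ranked_nonneg[OF x, of "Suc k"] c by simp
  obtain J where J: "J \<subseteq> I" "finite J" "card J = k" "\<forall>i\<in>J. c < f i x"
    using less_ranked_iff[OF x k c0] c by blast
  have sub: "J \<subseteq> {i \<in> I. c < f i x}" "{i \<in> I. c < f i x} \<subseteq> leading k x"
    using J c unfolding leading_def by auto
  have "leading k x \<subseteq> J"
  proof
    fix i assume i: "i \<in> leading k x"
    show "i \<in> J"
    proof (rule ccontr)
      assume "i \<notin> J"
      then have "card (insert i J) = Suc k" "finite (insert i J)" "insert i J \<subseteq> I"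
        "\<forall>j\<in>insert i J. ranked (Suc k) x < f j x"
        using J i sub unfolding leading_def by auto
      then have "ranked (Suc k) x < ranked (Suc k) x"
        using less_ranked_iff[OF x, of "Suc k" "ranked (Suc k) x"] ranked_nonneg[OF x] by blast
      then show False by simp
    qed
  qed
  then have "leading k x = J" using sub by blast
  then show "leading k x = {i \<in> I. c < f i x}" "finite (leading k x)" "card (leading k x) = k"
    using sub J by auto
qed

text \<open>Local constancy of the leading set: a threshold strictly inside the gap at
  \<open>x\<close> stays inside it nearby, and the leading indices at \<open>x\<close> stay above
  it. Nearby leading sets thus contain the one at \<open>x\<close>, and having the same finite
  cardinality they coincide with it.\<close>

lemma openin_leading_fibre:
  assumes k: "0 < k" and W: "openin X W" and lt: "\<And>x. x \<in> W \<Longrightarrow> ranked (Suc k) x < ranked k x"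
  shows "openin X {x \<in> W. P (leading k x)}"
proof (subst openin_subopen, intro ballI)
  fix x assume "x \<in> {x \<in> W. P (leading k x)}"
  then have x: "x \<in> topspace X" "x \<in> W" "P (leading k x)" using openin_subset[OF W] by auto
  obtain c where c: "ranked (Suc k) x < c" "c < ranked k x" using lt[OF x(2)] dense by blast
  let ?L = "leading k x"
  let ?T = "W \<inter> ({y \<in> topspace X. ranked (Suc k) y < c} \<inter> {y \<in> topspace X. c < ranked k y}
      \<inter> (\<Inter>i\<in>?L. {y \<in> topspace X. c < f i y}))"
  have L: "?L = {i \<in> I. c < f i x}" "finite ?L" "card ?L = k"
    using leading_eq[OF x(1) k _ c(2)] c(1) by auto
  have "openin X ({y \<in> topspace X. ranked (Suc k) y < c} \<inter> {y \<in> topspace X. c < ranked k y}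
      \<inter> (\<Inter>i\<in>?L. {y \<in> topspace X. c < f i y}))"
    using L cont continuous_ranked k
    by (intro openin_Int_Inter) (auto intro!: openin_Int openin_sublevel openin_superlevel)
  then have "openin X ?T" using W by blast
  moreover have "x \<in> ?T" using x c L(1) by auto
  moreover have "?T \<subseteq> {x \<in> W. P (leading k x)}"
  proof clarify
    fix y assume y: "y \<in> W" "y \<in> topspace X" "ranked (Suc k) y < c" "c < ranked k y"
      "y \<in> (\<Inter>i\<in>?L. {y \<in> topspace X. c < f i y})"
    have L': "leading k y = {i \<in> I. c < f i y}" "finite (leading k y)" "card (leading k y) = k"
      using leading_eq[OF y(2) k _ y(4)] y(3) by auto
    have "?L \<subseteq> leading k y" using y(5) L(1) unfolding L'(1) by auto
    then have "leading k y = ?L" using card_subset_eq[OF L'(2)] L(3) L'(3) by metis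
    then show "P (leading k y)" using x(3) by simp
  qed
  ultimately show "\<exists>T. openin X T \<and> x \<in> T \<and> T \<subseteq> {x \<in> W. P (leading k x)}" by blast
qed

text \<open>The analytic core, freed from covers: \<open>G W\<close> stands for the restriction of
  the given cover to \<open>W\<close> lying in the class. The premise \<open>fibres\<close> encodes
  a disjoint open cover of \<open>W\<close> labelled by indices, and \<open>binary\<close> a
  two-element numerable cover.\<close>

lemma cover_induct:
  fixes G :: "'a set \<Rightarrow> bool"
  assumes inf: "infinite (UNIV :: 'i set)"
    and empty: "G {}"
    and small: "\<And>W i. openin X W \<Longrightarrow> i \<in> I \<Longrightarrow> W \<subseteq> {x \<in> topspace X. 0 < f i x} \<Longrightarrow> G W"
    and fibres: "\<And>W \<kappa>. openin X W \<Longrightarrow> (\<And>j :: 'i. openin X {x \<in> W. \<kappa> x = j})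
          \<Longrightarrow> (\<And>j. G {x \<in> W. \<kappa> x = j}) \<Longrightarrow> G W"
    and binary: "\<And>W a b. openin X W \<Longrightarrow> continuous_map X euclideanreal a
          \<Longrightarrow> continuous_map X euclideanreal b
          \<Longrightarrow> (\<And>x. x \<in> W \<Longrightarrow> 0 \<le> a x \<and> 0 \<le> b x \<and> 0 < a x + b x)
          \<Longrightarrow> G {x \<in> W. 0 < a x} \<Longrightarrow> G {x \<in> W. 0 < b x} \<Longrightarrow> G W"
  shows "G (topspace X)"
proof -
  have open_Int: "openin X {x \<in> W. a < g x}"
    if "openin X W" "continuous_map X euclideanreal g" for W a g
  proof -
    have "{x \<in> W. a < g x} = W \<inter> {x \<in> topspace X. a < g x}" using openin_subset[OF that(1)] by auto
    then show ?thesis using openin_Int[OF that(1) openin_superlevel[OF that(2)]] by simp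
  qed
  have level: "G W" if W: "openin X W" and k: "0 < k" and lt: "\<And>x. x \<in> W \<Longrightarrow> ranked (Suc k) x < ranked k x"
    for W k
  \<comment> \<open>The chosen index depends on \<open>x\<close> only through the locally constant
    leading set, so its fibres are open. On a fibre the chosen function exceeds the next ranked
    value, hence is positive.\<close>
  proof (rule fibres[OF W, of "\<lambda>x. SOME i. i \<in> leading k x"])
    fix j
    show op: "openin X {x \<in> W. (SOME i. i \<in> leading k x) = j}"
      using openin_leading_fibre[OF k W lt, of "\<lambda>L. (SOME i. i \<in> L) = j"] by simp
    have j: "j \<in> leading k x" if "x \<in> W" "(SOME i. i \<in> leading k x) = j" for x
    proof -
      have "card (leading k x) = k"
        using leading_eq(3)[OF _ k order_refl lt] that(1) openin_subset[OF W] by blast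
      then have "leading k x \<noteq> {}" using k by auto
      then show ?thesis using that(2) some_in_eq by metis
    qed
    show "G {x \<in> W. (SOME i. i \<in> leading k x) = j}"
    proof (cases "j \<in> I")
      case True
      have "0 < f j x" if "x \<in> W" "(SOME i. i \<in> leading k x) = j" for x
        using j[OF that] ranked_nonneg[of x "Suc k"] openin_subset[OF W] that(1) unfolding leading_def
        by (auto intro: order_le_less_trans)
      then show ?thesis using small[OF op True] openin_subset[OF W] by blast
    next
      case False
      then have "{x \<in> W. (SOME i. i \<in> leading k x) = j} = {}" using j unfolding leading_def by blast
      then show ?thesis using empty by metis
    qed
  qed
  have finite_levels: "G W" if "openin X W" "0 < n" "\<And>x. x \<in> W \<Longrightarrow> ranked n x < ranked 1 x" for W n
    using that(2,1,3)
  proof (induction n arbitrary: W rule: nat_induct_non_zero)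
    case 1
    then have "W = {}" by fastforce
    then show ?case using empty by simp
  next
    case (Suc n)
    \<comment> \<open>The drop from rank 1 to rank \<open>Suc n\<close> telescopes into
      \<open>?a + ?b\<close>. The locus of \<open>?a\<close> is covered by the induction hypothesis,
      that of \<open>?b\<close> by the gap right after rank \<open>n\<close>.\<close>
    let ?a = "\<lambda>x. ranked 1 x - ranked n x" and ?b = "\<lambda>x. ranked n x - ranked (Suc n) x"
    have mono: "ranked n x \<le> ranked 1 x" if "x \<in> topspace X" for x
      using ranked_le_1[OF that Suc(1)] .
    have ca: "continuous_map X euclideanreal ?a" "continuous_map X euclideanreal ?b"
      using Suc(1) by (auto intro!: continuous_map_diff continuous_ranked)
    show ?case
    proof (rule binary[OF Suc(3) ca])
      show "0 \<le> ?a x \<and> 0 \<le> ?b x \<and> 0 < ?a x + ?b x" if "x \<in> W" for x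
      proof -
        have "x \<in> topspace X" using openin_subset[OF Suc(3)] that by blast
        then show ?thesis using mono[of x] ranked_Suc_le[of x n] Suc(1) Suc(4)[OF that] by linarith
      qed
      show "G {x \<in> W. 0 < ?a x}" by (rule Suc(2)[OF open_Int[OF Suc(3) ca(1)]]) auto
      show "G {x \<in> W. 0 < ?b x}" by (rule level[OF open_Int[OF Suc(3) ca(2)] Suc(1)]) auto
    qed
  qed
  \<comment> \<open>Division is legitimate because the largest value never vanishes. Bounding
    \<open>t\<close> bounds the rank by which the values must have dropped, but \<open>t\<close> may
    be unbounded on the whole space.\<close>
  define t where "t x = total x / ranked 1 x" for x
  have t0: "0 < t x" if "x \<in> topspace X" for x
    using total_pos[OF that] ranked_1_pos[OF that] unfolding t_def by simp
  have tcont: "continuous_map X euclideanreal t"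
    unfolding t_def using ranked_1_pos
    by (intro continuous_map_real_divide cont_total continuous_ranked) (auto simp: less_le)
  have bounded: "G W" if W: "openin X W" and b: "\<And>x. x \<in> W \<Longrightarrow> t x < c" for W c
  proof -
    obtain n :: nat where n: "max 1 c \<le> n" using real_arch_simple by blast
    show ?thesis
    proof (rule finite_levels[OF W, of n])
      fix x assume x: "x \<in> W"
      then have xX: "x \<in> topspace X" using openin_subset[OF W] by blast
      have "t x < n" using b[OF x] n by simp
      then have "total x < n * ranked 1 x"
        using ranked_1_pos[OF xX] unfolding t_def by (simp add: field_simps)
      moreover have "n * ranked n x \<le> total x" using ranked_le[OF xX, of n] n by simp
      ultimately have "n * ranked n x < n * ranked 1 x" by linarith
      then show "ranked n x < ranked 1 x" using n by (simp add: mult_less_cancel_left_pos)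
    qed (use n in simp)
  qed
  \<comment> \<open>The pieces below are numbered by naturals, whereas \<open>fibres\<close> expects
    labels in the index type.\<close>
  obtain e :: "nat \<Rightarrow> 'i" where e: "inj e" using infinite_countable_subset[OF inf] by blast
  have acont: "continuous_map X euclideanreal (\<lambda>x. \<bar>g (t x)\<bar>)" if "continuous_on UNIV g" for g :: "real \<Rightarrow> real"
    using continuous_map_real_abs[OF continuous_map_compose[OF tcont, of euclideanreal g]] that
    by (simp add: o_def)
  \<comment> \<open>The shift \<open>d\<close> is 0 for the sine and 1 for the cosine of
    \<open>pi * t / 2\<close>. In both cases the zeros are the points where
    \<open>(t x + d) / 2\<close> is an integer.\<close>
  have pieces: "G {x \<in> topspace X. 0 < \<bar>sin (pi * ((t x + d) / 2))\<bar>}" if d: "0 \<le> d" for d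
  proof -
    define g :: "real \<Rightarrow> real" where "g = (\<lambda>s. sin (pi * ((s + d) / 2)))"
    have g: "continuous_on UNIV g" unfolding g_def by (intro continuous_intros) simp
    have shift: "g s = 0 \<longleftrightarrow> (s + d) / 2 \<in> \<int>" for s
      unfolding g_def sin_zero_iff_int2 Ints_def by (auto simp: mult.commute)
    let ?W = "{x \<in> topspace X. 0 < \<bar>g (t x)\<bar>}"
    have "continuous_map X euclideanreal (\<lambda>x. \<bar>g (t x)\<bar>)"
      using g by (rule acont)
    then have W: "openin X ?W" by (rule openin_superlevel)
    let ?u = "\<lambda>x. (t x + d) / 2"
    let ?n = "\<lambda>x. nat \<lfloor>?u x\<rfloor>"
    have ucont: "continuous_map X euclideanreal ?u"
      using tcont by (intro continuous_map_real_divide continuous_map_add) auto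
    \<comment> \<open>Away from the zeros \<open>?u\<close> avoids the integers, so its floor is
      described by two strict inequalities and the fibres are open. Since \<open>?u\<close> is
      nonnegative, truncation by \<open>nat\<close> loses nothing.\<close>
    have fib: "{x \<in> ?W. ?n x = n} = ?W \<inter> ({x \<in> topspace X. real n < ?u x} \<inter> {x \<in> topspace X. ?u x < real n + 1})" for n
    proof (intro equalityI subsetI)
      fix x assume "x \<in> {x \<in> ?W. ?n x = n}"
      then have x: "x \<in> topspace X" "g (t x) \<noteq> 0" "?n x = n" by auto
      have "0 \<le> ?u x" using t0[OF x(1)] d by simp
      then have fl: "\<lfloor>?u x\<rfloor> = int n" using x(3) by (smt (verit) int_nat_eq zero_le_floor)
      then have "real n \<le> ?u x" "?u x < real n + 1" by linarith+
      moreover have "?u x \<noteq> n" using shift[of "t x"] x(2) by (metis Ints_of_nat)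
      ultimately show "x \<in> ?W \<inter> ({x \<in> topspace X. real n < ?u x} \<inter> {x \<in> topspace X. ?u x < real n + 1})"
        using x by auto
    next
      fix x assume x: "x \<in> ?W \<inter> ({x \<in> topspace X. real n < ?u x} \<inter> {x \<in> topspace X. ?u x < real n + 1})"
      then have "\<lfloor>?u x\<rfloor> = int n" by (simp add: floor_eq_iff)
      then show "x \<in> {x \<in> ?W. ?n x = n}" using x by simp
    qed
    have fopen: "openin X {x \<in> ?W. ?n x = n}" for n
      unfolding fib using W openin_superlevel[OF ucont] openin_sublevel[OF ucont] by blast
    have fG: "G {x \<in> ?W. ?n x = n}" for n
    proof (rule bounded[OF fopen, of _ "2 * real n + 2"])
      fix x assume "x \<in> {x \<in> ?W. ?n x = n}"
      then have "?u x < real n + 1" unfolding fib by blast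
      then have "t x + d < 2 * real n + 2" by (simp add: field_simps)
      then show "t x < 2 * real n + 2" using d by linarith
    qed
    have "G ?W"
    proof (rule fibres[OF W, of "\<lambda>x. e (?n x)"])
      fix j
      show "openin X {x \<in> ?W. e (?n x) = j}"
      proof (cases "j \<in> range e")
        case True
        then obtain n where "j = e n" by blast
        then show ?thesis using fopen[of n] by (simp only: inj_eq[OF e])
      next
        case False
        then have "{x \<in> ?W. e (?n x) = j} = {}" by auto
        then show ?thesis by (simp only: openin_empty)
      qed
      show "G {x \<in> ?W. e (?n x) = j}"
      proof (cases "j \<in> range e")
        case True
        then obtain n where "j = e n" by blast
        then show ?thesis using fG[of n] by (simp only: inj_eq[OF e])
      next
        case False
        then have "{x \<in> ?W. e (?n x) = j} = {}" by auto
        then show ?thesis using empty by (simp only:)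
      qed
    qed
    then show ?thesis unfolding g_def .
  qed
  let ?s = "\<lambda>d x. \<bar>sin (pi * ((t x + d) / 2))\<bar>"
  have scont: "continuous_map X euclideanreal (?s d)" for d
    by (rule acont[of "\<lambda>s. sin (pi * ((s + d) / 2))"]) (intro continuous_intros, simp)
  have "0 < ?s 0 x + ?s 1 x" for x
  proof -
    have "sin (pi * ((t x + 1) / 2)) = cos (pi * (t x / 2))"
      by (simp add: sin_add add_divide_distrib distrib_left)
    then show ?thesis using sin_zero_norm_cos_one[of "pi * (t x / 2)"] by (cases "sin (pi * (t x / 2)) = 0") auto
  qed
  then show ?thesis
    using pieces[of 0] pieces[of 1] by (intro binary[OF openin_topspace scont scont, of 0 1]) auto
qed

end

section \<open>An induction principle for numerable covers of one space\<close>

text \<open>An infinite type is equinumerous with its square, so families indexed by pairs can be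
  reindexed by the same type.\<close>

lemma ex_bij_betw_Sigma:
  assumes "infinite (UNIV :: 'i set)"
  obtains h :: "'i \<Rightarrow> 'i \<times> 'i" and K where "bij_betw h K (SIGMA i:I. J i)"
proof -
  obtain e :: "'i \<times> 'i \<Rightarrow> 'i" where e: "bij e"
    using card_of_ordIso[THEN iffD2, OF card_of_Times_same_infinite[OF assms]] by auto
  show thesis
  proof
    show "bij_betw (inv e) (e ` (SIGMA i:I. J i)) (SIGMA i:I. J i)"
      using bij_betw_inv_into_subset[of e UNIV UNIV "SIGMA i:I. J i"] e by blast
  qed
qed

text \<open>The predicate is abstract and speaks only of open subsets of one fixed space, so that it
  can serve twice: \<open>D W\<close> is read either as membership of a cover of the subspace
  \<open>W\<close> in a class, or as membership of its image among covers of an open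
  sublocale.\<close>

theorem numerable_cover_induct:
  fixes D :: "'a set \<Rightarrow> 'i set \<Rightarrow> ('i \<Rightarrow> 'a set) \<Rightarrow> bool"
  assumes inf: "infinite (UNIV :: 'i set)"
    and two: "\<And>W I U. openin X W \<Longrightarrow> numerable (subtopology X W) I U \<Longrightarrow> card I = 2 \<Longrightarrow> D W I U"
    and disjoint: "\<And>W I U. openin X W \<Longrightarrow> open_cover (subtopology X W) I U \<Longrightarrow> disjoint_family_on U I \<Longrightarrow> D W I U"
    and coarse: "\<And>W I U J V. openin X W \<Longrightarrow> D W I U \<Longrightarrow> open_cover (subtopology X W) J V
          \<Longrightarrow> \<forall>i\<in>I. \<exists>j\<in>J. U i \<subseteq> V j \<Longrightarrow> D W J V"
    and comp: "\<And>W I U J V K h. openin X W \<Longrightarrow> open_cover (subtopology X W) I U \<Longrightarrow> D W I U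
          \<Longrightarrow> \<forall>i\<in>I. D (U i) (J i) (V i) \<Longrightarrow> bij_betw h K (SIGMA i:I. J i)
          \<Longrightarrow> D W K (\<lambda>k. case h k of (i, j) \<Rightarrow> V i j)"
    and num: "numerable X I U"
  shows "D (topspace X) I U"
proof -
  obtain f where f: "positive_partition X I f" and sub: "\<And>i. i \<in> I \<Longrightarrow> {x \<in> topspace X. 0 < f i x} \<subseteq> U i"
    and cov: "open_cover X I U"
    using num unfolding numerable_def by blast
  interpret partition X I f by standard (rule f)
  define G where "G W = D W I (\<lambda>i. U i \<inter> W)" for W
  have top: "topspace (subtopology X W) = W" if "openin X W" for W
    using openin_subset[OF that] by auto
  have op: "openin (subtopology X W) V \<longleftrightarrow> openin X V \<and> V \<subseteq> W" if "openin X W" for V W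
    using openin_open_subtopology[OF that] .
  have covW: "open_cover (subtopology X W) I (\<lambda>i. U i \<inter> W)" if W: "openin X W" for W
    using cov openin_subset[OF W] unfolding open_cover_def top[OF W] op[OF W] by (auto intro: W)
  \<comment> \<open>Composition produces the sets \<open>U i \<inter> S n\<close> indexed by pairs;
    coarsening then forgets \<open>n\<close>.\<close>
  have compose: "G W" if W: "openin X W" and S: "open_cover (subtopology X W) N S" "D W N S"
    and G: "\<And>n. n \<in> N \<Longrightarrow> G (S n)" for W N S
  proof -
    obtain h :: "'i \<Rightarrow> 'i \<times> 'i" and K where h: "bij_betw h K (SIGMA n:N. I)"
      using ex_bij_betw_Sigma[OF inf] by blast
    have "D W K (\<lambda>k. case h k of (n, i) \<Rightarrow> U i \<inter> S n)"
      using comp[OF W S _ h, of "\<lambda>n i. U i \<inter> S n"] G unfolding G_def by blast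
    moreover have "\<forall>k\<in>K. \<exists>i\<in>I. (case h k of (n, i) \<Rightarrow> U i \<inter> S n) \<subseteq> U i \<inter> W"
    proof
      fix k assume "k \<in> K"
      then obtain n i where "h k = (n, i)" "n \<in> N" "i \<in> I" using h unfolding bij_betw_def by blast
      moreover have "S n \<subseteq> W"
        using S(1) \<open>n \<in> N\<close> unfolding open_cover_def op[OF W] by blast
      ultimately show "\<exists>i\<in>I. (case h k of (n, i) \<Rightarrow> U i \<inter> S n) \<subseteq> U i \<inter> W" by auto
    qed
    ultimately show ?thesis unfolding G_def by (rule coarse[OF W _ covW[OF W]])
  qed
  have "G (topspace X)"
  proof (rule cover_induct[OF inf])
    have "D {} {} U"
      by (rule disjoint) (simp_all add: open_cover_def disjoint_family_on_def)
    then show "G {}" unfolding G_def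
      by (rule coarse[OF openin_empty _ covW[OF openin_empty]]) simp
  next
    fix W i assume W: "openin X W" "i \<in> I" "W \<subseteq> {x \<in> topspace X. 0 < f i x}"
    \<comment> \<open>A one-element cover is vacuously disjoint, and here it refines the restricted
      cover.\<close>
    have "D W {i} (\<lambda>_. W)"
      using openin_subset[OF W(1)]
      by (intro disjoint W(1)) (auto simp: open_cover_def disjoint_family_on_def op W(1))
    then show "G W" unfolding G_def
      by (rule coarse[OF W(1) _ covW[OF W(1)]]) (use W(2,3) sub[OF W(2)] in blast)
  next
    fix W and \<kappa> :: "'a \<Rightarrow> 'i"
    assume W: "openin X W" and fib: "\<And>j. openin X {x \<in> W. \<kappa> x = j}" and G: "\<And>j. G {x \<in> W. \<kappa> x = j}"
    have c: "open_cover (subtopology X W) UNIV (\<lambda>j. {x \<in> W. \<kappa> x = j})"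
      unfolding open_cover_def top[OF W] op[OF W] using fib by auto
    show "G W"
      by (rule compose[OF W c disjoint[OF W c] G]) (auto simp: disjoint_family_on_def)
  next
    fix W and a b :: "'a \<Rightarrow> real"
    assume W: "openin X W" and ab: "continuous_map X euclideanreal a" "continuous_map X euclideanreal b"
      and pos: "\<And>x. x \<in> W \<Longrightarrow> 0 \<le> a x \<and> 0 \<le> b x \<and> 0 < a x + b x"
      and G: "G {x \<in> W. 0 < a x}" "G {x \<in> W. 0 < b x}"
    obtain i j :: 'i where ij: "i \<noteq> j" using ex_new_if_finite[OF inf, of "{undefined}"] by auto
    define g where "g k = (if k = i then a else b)" for k
    have gc: "continuous_map X euclideanreal (g k)" for k using ab unfolding g_def by simp
    have Weq: "{x \<in> W. 0 < g k x} = W \<inter> {x \<in> topspace X. 0 < g k x}" for k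
      using openin_subset[OF W] by auto
    have c: "open_cover (subtopology X W) {i, j} (\<lambda>k. {x \<in> W. 0 < g k x})"
      unfolding open_cover_def top[OF W] op[OF W]
    proof (intro conjI ballI)
      show "openin X {x \<in> W. 0 < g k x}" for k
        unfolding Weq using openin_Int[OF W openin_superlevel[OF gc]] .
      show "(\<Union>k\<in>{i, j}. {x \<in> W. 0 < g k x}) = W"
        using pos ij unfolding g_def by force
    qed auto
    have "positive_partition (subtopology X W) {i, j} g"
    proof (rule positive_partitionI[where s = "\<lambda>x. a x + b x"])
      show "((\<lambda>k. g k x) has_sum (a x + b x)) {i, j}" for x
        using has_sum_finite[of "{i, j}" "\<lambda>k. g k x"] ij by (simp add: g_def)
      show "continuous_map (subtopology X W) euclideanreal (\<lambda>x. a x + b x)"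
        using ab by (intro continuous_map_from_subtopology continuous_map_add)
      show "continuous_map (subtopology X W) euclideanreal (g k)" for k
        using gc by (rule continuous_map_from_subtopology)
    qed (use pos in \<open>auto simp: g_def\<close>)
    then have "numerable (subtopology X W) {i, j} (\<lambda>k. {x \<in> W. 0 < g k x})"
      unfolding numerable_def using c top[OF W] by blast
    moreover have "card {i, j} = 2" using ij by simp
    ultimately have "D W {i, j} (\<lambda>k. {x \<in> W. 0 < g k x})" by (rule two[OF W])
    then show "G W" by (rule compose[OF W c]) (use G in \<open>auto simp: g_def\<close>)
  qed
  then show ?thesis
    unfolding G_def by (rule coarse[OF openin_topspace _ _]) (use cov in auto)
qed

section \<open>Frames\<close>

lemma (in partial_order) sup_eqI: "least L s (Upper L A) \<Longrightarrow> \<Squnion>A = s"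
  unfolding sup_def by (metis least_unique someI)

lemma (in partial_order) inf_eqI: "greatest L i (Lower L A) \<Longrightarrow> \<Sqinter>A = i"
  unfolding inf_def by (metis greatest_unique someI)

text \<open>A complete lattice also has infima of infinite sets; these are the suprema of the sets
  of lower bounds.\<close>

sublocale frame \<subseteq> weak_complete_lattice
proof
  show Sup: "\<exists>s. least L s (Upper L A)" if "A \<subseteq> carrier L" for A
    using that by (rule Sup_exists)
  show "\<exists>i. greatest L i (Lower L A)" if A: "A \<subseteq> carrier L" for A
  proof -
    obtain s where s: "least L s (Upper L (Lower L A))" using Sup[OF Lower_closed] by blast
    have "greatest L s (Lower L A)"
      unfolding greatest_def
    proof (intro conjI ballI)
      show "s \<in> Lower L A"
        using A s unfolding least_def Lower_def Upper_def by blast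
      show "x \<sqsubseteq> s" if "x \<in> Lower L A" for x
        using s that unfolding least_def Upper_def Lower_def by blast
    qed simp
    then show ?thesis by blast
  qed
qed

context frame
begin

lemma Sup_eqI:
  assumes "A \<subseteq> carrier L" "s \<in> carrier L" "\<And>a. a \<in> A \<Longrightarrow> a \<sqsubseteq> s"
    and "\<And>u. u \<in> carrier L \<Longrightarrow> (\<And>a. a \<in> A \<Longrightarrow> a \<sqsubseteq> u) \<Longrightarrow> s \<sqsubseteq> u"
  shows "\<Squnion>A = s"
  using sup_least[OF assms(1,2,3)] assms(4)[OF sup_closed[OF assms(1)] sup_upper[OF assms(1)]]
  by (rule le_antisym) (use assms(1,2) in auto)

lemma Inf_eqI:
  assumes "A \<subseteq> carrier L" "s \<in> carrier L" "\<And>a. a \<in> A \<Longrightarrow> s \<sqsubseteq> a"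
    and "\<And>u. u \<in> carrier L \<Longrightarrow> (\<And>a. a \<in> A \<Longrightarrow> u \<sqsubseteq> a) \<Longrightarrow> u \<sqsubseteq> s"
  shows "\<Sqinter>A = s"
  using assms(4)[OF inf_closed[OF assms(1)] inf_lower[OF assms(1)]] inf_greatest[OF assms(1,2,3)]
  by (rule le_antisym) (use assms(1,2) in auto)

lemma Inf_empty: "\<Sqinter>{} = \<top>"
  by (rule Inf_eqI) (auto simp: top_higher)

lemma Sup_empty: "\<Squnion>{} = \<bottom>"
  by (rule Sup_eqI) (auto simp: bottom_lower)

lemma Inf_insert: "a \<in> carrier L \<Longrightarrow> A \<subseteq> carrier L \<Longrightarrow> \<Sqinter>(insert a A) = a \<sqinter> \<Sqinter>A"
  using weak_inf_insert by (simp add: eq_is_equal)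

lemma le_meet_iff:
  "a \<in> carrier L \<Longrightarrow> b \<in> carrier L \<Longrightarrow> w \<in> carrier L \<Longrightarrow> w \<sqsubseteq> a \<sqinter> b \<longleftrightarrow> w \<sqsubseteq> a \<and> w \<sqsubseteq> b"
  by (meson meet_closed meet_le meet_left meet_right le_trans)

lemma meet_absorb: "a \<in> carrier L \<Longrightarrow> b \<in> carrier L \<Longrightarrow> a \<sqsubseteq> b \<Longrightarrow> a \<sqinter> b = a"
  by (rule le_antisym) (auto simp: le_meet_iff meet_left)

lemma le_bottom_iff: "a \<in> carrier L \<Longrightarrow> a \<sqsubseteq> \<bottom> \<longleftrightarrow> a = \<bottom>"
  by (meson bottom_closed bottom_lower le_antisym le_refl)

lemma le_Inf_iff:
  "A \<subseteq> carrier L \<Longrightarrow> w \<in> carrier L \<Longrightarrow> w \<sqsubseteq> \<Sqinter>A \<longleftrightarrow> (\<forall>a\<in>A. w \<sqsubseteq> a)"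
  by (meson inf_closed inf_greatest inf_lower le_trans subsetD)

text \<open>Distributivity in the form of a density argument: if all meets of \<open>w\<close> with
  members of \<open>S\<close> were below \<open>v\<close>, so would be their supremum, which is
  \<open>w\<close>. It allows one to pass from \<open>w\<close> to a smaller open inside one member
  of a cover without falling below \<open>v\<close>.\<close>

lemma refine_Sup:
  assumes S: "S \<subseteq> carrier L" and w: "w \<in> carrier L" "w \<sqsubseteq> \<Squnion>S" and v: "v \<in> carrier L" "\<not> w \<sqsubseteq> v"
  obtains s w' where "s \<in> S" "w' \<in> carrier L" "w' \<sqsubseteq> w" "w' \<sqsubseteq> s" "\<not> w' \<sqsubseteq> v"
proof -
  have "\<exists>s\<in>S. \<not> w \<sqinter> s \<sqsubseteq> v"
  proof (rule ccontr)
    assume "\<not> ?thesis"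
    then have "\<Squnion>((\<lambda>s. w \<sqinter> s) ` S) \<sqsubseteq> v" using S w v by (intro sup_least) auto
    then have "w \<sqinter> \<Squnion>S \<sqsubseteq> v" using meet_Sup_distrib[OF w(1) S] by simp
    then show False using meet_absorb[OF w(1) _ w(2)] S v(2) by simp
  qed
  then obtain s where s: "s \<in> S" "\<not> w \<sqinter> s \<sqsubseteq> v" by blast
  then show thesis using that[of s "w \<sqinter> s"] S w(1) meet_left meet_right by auto
qed

section \<open>Separation of opens by filters\<close>

definition proper_filter :: "'a set \<Rightarrow> bool" where
  "proper_filter p \<longleftrightarrow> p \<subseteq> carrier L \<and> \<top> \<in> p \<and> \<bottom> \<notin> p \<and> (\<forall>a\<in>p. \<forall>b\<in>p. a \<sqinter> b \<in> p) \<and>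
     (\<forall>a\<in>p. \<forall>b\<in>carrier L. a \<sqsubseteq> b \<longrightarrow> b \<in> p)"

lemma proper_filterD:
  assumes "proper_filter p"
  shows "p \<subseteq> carrier L" "\<top> \<in> p" "\<bottom> \<notin> p" "a \<in> p \<Longrightarrow> b \<in> p \<Longrightarrow> a \<sqinter> b \<in> p"
    "a \<in> p \<Longrightarrow> b \<in> carrier L \<Longrightarrow> a \<sqsubseteq> b \<Longrightarrow> b \<in> p"
  using assms unfolding proper_filter_def by blast+

lemma proper_filter_Inf:
  assumes p: "proper_filter p" and A: "finite A" "A \<subseteq> p"
  shows "\<Sqinter>A \<in> p"
  using A
proof (induction A)
  case empty
  then show ?case using proper_filterD(2)[OF p] by (simp add: Inf_empty)
next
  case (insert a A)
  then have "\<Sqinter>(insert a A) = a \<sqinter> \<Sqinter>A"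
    using proper_filterD(1)[OF p] by (intro Inf_insert) auto
  then show ?case using insert proper_filterD(4)[OF p] by simp
qed

text \<open>The demands are met one after another along a descending sequence, and \<open>p\<close>
  is the filter generated by it. Staying "not below \<open>v\<close>" replaces the usual "non-zero":
  it keeps \<open>v\<close> out of \<open>p\<close>, and therefore also the bottom, which lies below
  \<open>v\<close>.\<close>

lemma rasiowa_sikorski:
  fixes R :: "nat \<Rightarrow> 'a \<Rightarrow> bool"
  assumes u: "u \<in> carrier L" and v: "v \<in> carrier L" and uv: "\<not> u \<sqsubseteq> v"
    and dense: "\<And>n w. w \<in> carrier L \<Longrightarrow> \<not> w \<sqsubseteq> v \<Longrightarrow> \<exists>w'\<in>carrier L. w' \<sqsubseteq> w \<and> \<not> w' \<sqsubseteq> v \<and> R n w'"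
  obtains p where "proper_filter p" "u \<in> p" "v \<notin> p" "\<And>n. \<exists>w\<in>p. R n w"
proof -
  obtain w0 where w0: "w0 \<in> carrier L" "w0 \<sqsubseteq> u" "\<not> w0 \<sqsubseteq> v" "R 0 w0" using dense[OF u uv] by blast
  have "\<exists>w. \<forall>n. (w n \<in> carrier L \<and> w n \<sqsubseteq> u \<and> \<not> w n \<sqsubseteq> v \<and> R n (w n)) \<and> w (Suc n) \<sqsubseteq> w n"
  proof (rule dependent_nat_choice)
    show "\<exists>x. x \<in> carrier L \<and> x \<sqsubseteq> u \<and> \<not> x \<sqsubseteq> v \<and> R 0 x" using w0 by blast
    fix x n assume x: "x \<in> carrier L \<and> x \<sqsubseteq> u \<and> \<not> x \<sqsubseteq> v \<and> R n x"
    then obtain y where "y \<in> carrier L" "y \<sqsubseteq> x" "\<not> y \<sqsubseteq> v" "R (Suc n) y"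
      using dense[of x "Suc n"] by blast
    then show "\<exists>y. (y \<in> carrier L \<and> y \<sqsubseteq> u \<and> \<not> y \<sqsubseteq> v \<and> R (Suc n) y) \<and> y \<sqsubseteq> x"
      using x u le_trans[of y x u] by blast
  qed
  then obtain w where w: "\<And>n. w n \<in> carrier L" "\<And>n. w n \<sqsubseteq> u" "\<And>n. \<not> w n \<sqsubseteq> v"
      "\<And>n. R n (w n)" "\<And>n. w (Suc n) \<sqsubseteq> w n"
    by blast
  have mono: "w n \<sqsubseteq> w m" if "m \<le> n" for m n
    using that
  proof (induction n rule: dec_induct)
    case base
    show ?case using w(1) by simp
  next
    case (step n)
    show ?case using le_trans[OF w(5)[of n] step.IH] w(1) by simp
  qed
  define p where "p = {a \<in> carrier L. \<exists>n. w n \<sqsubseteq> a}"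
  have "a \<sqinter> b \<in> p" if ab: "a \<in> p" "b \<in> p" for a b
  proof -
    obtain m n where mn: "w m \<sqsubseteq> a" "w n \<sqsubseteq> b" "a \<in> carrier L" "b \<in> carrier L"
      using ab unfolding p_def by blast
    have "w (max m n) \<sqsubseteq> a \<sqinter> b"
      using mn w(1) le_trans[OF mono[of m "max m n"], of a] le_trans[OF mono[of n "max m n"], of b]
      by (simp add: le_meet_iff)
    then show ?thesis using mn unfolding p_def by auto
  qed
  moreover have "\<bottom> \<notin> p"
    using w(1,3) v le_trans[OF _ bottom_lower[OF v]] unfolding p_def by blast
  moreover have "b \<in> p" if ab: "a \<in> p" "b \<in> carrier L" "a \<sqsubseteq> b" for a b
  proof -
    obtain n where "w n \<sqsubseteq> a" "a \<in> carrier L" using ab(1) unfolding p_def by blast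
    then have "w n \<sqsubseteq> b" using le_trans[of "w n" a b] w(1) ab by blast
    then show ?thesis using ab(2) unfolding p_def by blast
  qed
  moreover have "\<top> \<in> p" using w(1) top_higher unfolding p_def by auto
  moreover have "p \<subseteq> carrier L" unfolding p_def by blast
  ultimately have "proper_filter p" unfolding proper_filter_def by blast
  moreover have "u \<in> p" "v \<notin> p" using w(2,3) u unfolding p_def by auto
  moreover have "\<exists>a\<in>p. R n a" for n
    using w(1,4) le_refl unfolding p_def by (intro bexI[of _ "w n"]) blast+
  ultimately show thesis by (rule that)
qed

end

section \<open>Morphisms from locales to spaces\<close>

lemma opens_simps [simp]:
  "carrier (opens X) = {U. openin X U}" "le (opens X) = (\<subseteq>)"
  by (simp_all add: opens_def)

lemma partial_order_opens: "partial_order (opens X)"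
  by unfold_locales (auto simp: opens_def)

lemma Sup_opens:
  assumes "A \<subseteq> carrier (opens X)"
  shows "\<Squnion>\<^bsub>opens X\<^esub>A = \<Union>A"
  using assms
  by (intro partial_order.sup_eqI[OF partial_order_opens])
     (auto simp: least_def Upper_def)

lemma Inf_opens:
  assumes "A \<subseteq> carrier (opens X)" "finite A"
  shows "\<Sqinter>\<^bsub>opens X\<^esub>A = topspace X \<inter> \<Inter>A"
  using assms openin_subset[of X]
  by (intro partial_order.inf_eqI[OF partial_order_opens])
     (auto simp: greatest_def Lower_def intro!: openin_Int_Inter)

locale spatial_morphism = frame L for L :: "'l gorder" (structure) +
  fixes X :: "'x topology" and h :: "'x set \<Rightarrow> 'l"
  assumes morphism: "locale_morphism L (opens X) h"
begin

lemma closed [simp]: "openin X A \<Longrightarrow> h A \<in> carrier L"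
  using morphism unfolding locale_morphism_def by auto

lemma mono: "openin X A \<Longrightarrow> openin X B \<Longrightarrow> A \<subseteq> B \<Longrightarrow> h A \<sqsubseteq> h B"
  using morphism unfolding locale_morphism_def isotone_def by auto

lemma Inf:
  assumes "finite A" "\<And>a. a \<in> A \<Longrightarrow> openin X a"
  shows "h (topspace X \<inter> \<Inter>A) = \<Sqinter>(h ` A)"
proof -
  have "A \<subseteq> carrier (opens X)" using assms by auto
  then show ?thesis
    using morphism Inf_opens[of A X] assms(1) unfolding locale_morphism_def by metis
qed

lemma Sup:
  assumes "\<And>a. a \<in> A \<Longrightarrow> openin X a"
  shows "h (\<Union>A) = \<Squnion>(h ` A)"
proof -
  have "A \<subseteq> carrier (opens X)" using assms by auto
  then show ?thesis
    using morphism Sup_opens[of A X] unfolding locale_morphism_def by metis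
qed

lemma top: "h (topspace X) = \<top>"
  using Inf[of "{}"] by (simp add: Inf_empty)

lemma bottom: "h {} = \<bottom>"
  using Sup[of "{}"] by (simp add: Sup_empty)

lemma meet:
  assumes "openin X A" "openin X B"
  shows "h (A \<inter> B) = h A \<sqinter> h B"
proof -
  have "topspace X \<inter> \<Inter>{A, B} = A \<inter> B" using openin_subset[OF assms(1)] by auto
  then show ?thesis using Inf[of "{A, B}"] assms unfolding meet_def by auto
qed

lemma UN: "(\<And>i. i \<in> I \<Longrightarrow> openin X (A i)) \<Longrightarrow> h (\<Union>i\<in>I. A i) = \<Squnion>((\<lambda>i. h (A i)) ` I)"
  using Sup[of "A ` I"] by (auto simp: image_image)

end

lemma spatial_morphismI:
  assumes "frame L" and "\<And>A. openin X A \<Longrightarrow> h A \<in> carrier L"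
    and "h (topspace X) = \<top>\<^bsub>L\<^esub>"
    and meet: "\<And>A B. openin X A \<Longrightarrow> openin X B \<Longrightarrow> h (A \<inter> B) = h A \<sqinter>\<^bsub>L\<^esub> h B"
    and "\<And>\<A>. (\<And>A. A \<in> \<A> \<Longrightarrow> openin X A) \<Longrightarrow> h (\<Union>\<A>) = \<Squnion>\<^bsub>L\<^esub>(h ` \<A>)"
  shows "spatial_morphism L X h"
proof -
  interpret frame L by fact
  have mono: "h A \<sqsubseteq>\<^bsub>L\<^esub> h B" if "openin X A" "openin X B" "A \<subseteq> B" for A B
    using meet[OF that(1,2)] meet_right[of "h A" "h B"] assms(2) that by (simp add: Int_absorb2)
  have Inf: "h (topspace X \<inter> \<Inter>\<A>) = \<Sqinter>\<^bsub>L\<^esub>(h ` \<A>)" if "finite \<A>" "\<A> \<subseteq> {A. openin X A}" for \<A>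
    using that
  proof (induction \<A>)
    case empty
    then show ?case using assms(3) by (simp add: Inf_empty)
  next
    case (insert A \<A>)
    have "topspace X \<inter> \<Inter>(insert A \<A>) = A \<inter> (topspace X \<inter> \<Inter>\<A>)" by auto
    moreover have "openin X (topspace X \<inter> \<Inter>\<A>)"
      using insert by (intro openin_Int_Inter) auto
    ultimately have "h (topspace X \<inter> \<Inter>(insert A \<A>)) = h A \<sqinter>\<^bsub>L\<^esub> \<Sqinter>\<^bsub>L\<^esub>(h ` \<A>)"
      using meet insert by simp
    also have "\<dots> = \<Sqinter>\<^bsub>L\<^esub>(insert (h A) (h ` \<A>))"
    proof (rule Inf_insert[symmetric])
      show "h A \<in> carrier L" using insert.prems by (intro assms(2)) simp
      show "h ` \<A> \<subseteq> carrier L" using insert.prems by (auto intro: assms(2))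
    qed
    also have "\<dots> = \<Sqinter>\<^bsub>L\<^esub>(h ` insert A \<A>)" by simp
    finally show ?case .
  qed
  have "locale_morphism L (opens X) h"
    unfolding locale_morphism_def
  proof (intro conjI allI impI)
    show "h \<in> carrier (opens X) \<rightarrow> carrier L" using assms(2) by auto
    show "isotone (opens X) L h"
      unfolding isotone_def
      using mono partial_order.axioms(1)[OF partial_order_opens] weak_partial_order_axioms by simp
    show "h (\<Sqinter>\<^bsub>opens X\<^esub>\<A>) = \<Sqinter>\<^bsub>L\<^esub>(h ` \<A>)" if "\<A> \<subseteq> carrier (opens X) \<and> finite \<A>" for \<A>
      using Inf[of \<A>] Inf_opens[of \<A> X] that by auto
    show "h (\<Squnion>\<^bsub>opens X\<^esub>\<A>) = \<Squnion>\<^bsub>L\<^esub>(h ` \<A>)" if "\<A> \<subseteq> carrier (opens X)" for \<A>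
      using assms(5)[of \<A>] Sup_opens[OF that] that by auto
  qed
  then show ?thesis by unfold_locales
qed

section \<open>Spaces of filters\<close>

text \<open>For proper filters the sets \<open>{q \<in> Q. u \<in> q}\<close> form a base, because
  filters are closed under binary meets.\<close>

definition filter_space :: "'l set set \<Rightarrow> 'l set topology" where
  "filter_space Q = topology (\<lambda>W. W \<subseteq> Q \<and> (\<forall>p\<in>W. \<exists>u\<in>p. {q \<in> Q. u \<in> q} \<subseteq> W))"

locale separating_filters = frame L for L :: "'l gorder" (structure) +
  fixes Q :: "'l set set"
  assumes filter: "p \<in> Q \<Longrightarrow> proper_filter p"
    and separating: "u \<in> carrier L \<Longrightarrow> v \<in> carrier L \<Longrightarrow> \<not> u \<sqsubseteq> v \<Longrightarrow> \<exists>p\<in>Q. u \<in> p \<and> v \<notin> p"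
begin

lemma filter_carrier: "p \<in> Q \<Longrightarrow> u \<in> p \<Longrightarrow> u \<in> carrier L"
  using proper_filterD(1)[OF filter] by blast

lemma Int_basic:
  assumes "u \<in> carrier L" "v \<in> carrier L"
  shows "{q \<in> Q. u \<sqinter> v \<in> q} = {q \<in> Q. u \<in> q} \<inter> {q \<in> Q. v \<in> q}"
  using proper_filterD(4)[OF filter, of _ u v] proper_filterD(5)[OF filter, of _ "u \<sqinter> v"]
    meet_left[OF assms] meet_right[OF assms] assms by blast

lemma openin_iff: "openin (filter_space Q) W \<longleftrightarrow> W \<subseteq> Q \<and> (\<forall>p\<in>W. \<exists>u\<in>p. {q \<in> Q. u \<in> q} \<subseteq> W)"
proof -
  have Int: "\<exists>u\<in>p. {q \<in> Q. u \<in> q} \<subseteq> V \<inter> W"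
    if p: "p \<in> Q" and uv: "u \<in> p" "{q \<in> Q. u \<in> q} \<subseteq> V" "v \<in> p" "{q \<in> Q. v \<in> q} \<subseteq> W" for p u v V W
  proof (rule bexI)
    show "{q \<in> Q. u \<sqinter> v \<in> q} \<subseteq> V \<inter> W"
      unfolding Int_basic[OF filter_carrier[OF p uv(1)] filter_carrier[OF p uv(3)]] using uv by blast
    show "u \<sqinter> v \<in> p" using proper_filterD(4)[OF filter[OF p] uv(1,3)] .
  qed
  have "istopology (\<lambda>W. W \<subseteq> Q \<and> (\<forall>p\<in>W. \<exists>u\<in>p. {q \<in> Q. u \<in> q} \<subseteq> W))"
    unfolding istopology_def
  proof (intro conjI allI impI ballI)
    fix V W p
    assume V: "V \<subseteq> Q \<and> (\<forall>p\<in>V. \<exists>u\<in>p. {q \<in> Q. u \<in> q} \<subseteq> V)"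
      and W: "W \<subseteq> Q \<and> (\<forall>p\<in>W. \<exists>u\<in>p. {q \<in> Q. u \<in> q} \<subseteq> W)"
    then show "V \<inter> W \<subseteq> Q" by blast
    assume p: "p \<in> V \<inter> W"
    obtain u where u: "u \<in> p" "{q \<in> Q. u \<in> q} \<subseteq> V" using V p by blast
    obtain v where v: "v \<in> p" "{q \<in> Q. v \<in> q} \<subseteq> W" using W p by blast
    show "\<exists>u\<in>p. {q \<in> Q. u \<in> q} \<subseteq> V \<inter> W" using Int[OF _ u v] V p by blast
  next
    fix \<K> p assume K: "\<forall>W\<in>\<K>. W \<subseteq> Q \<and> (\<forall>p\<in>W. \<exists>u\<in>p. {q \<in> Q. u \<in> q} \<subseteq> W)"
    then show "\<Union>\<K> \<subseteq> Q" by blast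
    assume "p \<in> \<Union>\<K>"
    then obtain W where W: "W \<in> \<K>" "p \<in> W" by blast
    then obtain u where "u \<in> p" "{q \<in> Q. u \<in> q} \<subseteq> W" using K by blast
    then show "\<exists>u\<in>p. {q \<in> Q. u \<in> q} \<subseteq> \<Union>\<K>" using W(1) by blast
  qed
  then show ?thesis unfolding filter_space_def by (simp add: topology_inverse')
qed

lemma topspace [simp]: "topspace (filter_space Q) = Q"
proof -
  have "openin (filter_space Q) Q" unfolding openin_iff using proper_filterD(2)[OF filter] by blast
  moreover have "topspace (filter_space Q) \<subseteq> Q"
    using openin_topspace[of "filter_space Q"] unfolding openin_iff by blast
  ultimately show ?thesis using openin_subset by blast
qed

lemma openin_basic: "openin (filter_space Q) {q \<in> Q. u \<in> q}"
  unfolding openin_iff by blast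

text \<open>Approximation from below by basic sets. With separating filters the value on the basic
  set of an open \<open>v\<close> is \<open>v\<close> itself.\<close>

definition open_of :: "'l set set \<Rightarrow> 'l" where
  "open_of W = \<Squnion>{u \<in> carrier L. {q \<in> Q. u \<in> q} \<subseteq> W}"

lemma open_of_closed [simp]: "open_of W \<in> carrier L"
  unfolding open_of_def by (rule sup_closed) blast

lemma le_open_ofI: "u \<in> carrier L \<Longrightarrow> {q \<in> Q. u \<in> q} \<subseteq> W \<Longrightarrow> u \<sqsubseteq> open_of W"
  unfolding open_of_def by (rule sup_upper) auto

lemma open_of_leI:
  assumes "v \<in> carrier L" "\<And>u. u \<in> carrier L \<Longrightarrow> {q \<in> Q. u \<in> q} \<subseteq> W \<Longrightarrow> u \<sqsubseteq> v"
  shows "open_of W \<sqsubseteq> v"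
  unfolding open_of_def using assms by (intro sup_least) auto

text \<open>This is separation: an open \<open>u\<close> not below \<open>v\<close> would be
  contained in some filter that omits \<open>v\<close>, so the basic set of \<open>u\<close> would
  not fit into that of \<open>v\<close>.\<close>

lemma open_of_le: "v \<in> carrier L \<Longrightarrow> W \<subseteq> {q \<in> Q. v \<in> q} \<Longrightarrow> open_of W \<sqsubseteq> v"
  using separating by (intro open_of_leI) blast+

text \<open>Meets are preserved because refining below \<open>V\<close> and then below
  \<open>W\<close> leads to a basic set inside both. For unions, suppose \<open>u\<close> is not
  below the supremum \<open>?v\<close>. A filter containing \<open>u\<close> but not
  \<open>?v\<close> lies in some \<open>W\<close>, and openness of \<open>W\<close> puts
  \<open>open_of W\<close>, hence \<open>?v\<close>, into that filter. No primality of filters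
  enters.\<close>

lemma spatial_morphism_open_of: "spatial_morphism L (filter_space Q) open_of"
proof (rule spatial_morphismI)
  show "frame L" by unfold_locales
  show "open_of W \<in> carrier L" for W by simp
  show "open_of (topspace (filter_space Q)) = \<top>"
    using le_open_ofI[of \<top> Q] by (intro le_antisym) (auto simp: top_higher)
next
  fix V W assume VW: "openin (filter_space Q) V" "openin (filter_space Q) W"
  have "open_of V \<sqinter> open_of W \<sqsubseteq> open_of (V \<inter> W)"
  proof (rule ccontr)
    assume not_le: "\<not> ?thesis"
    define w where "w = open_of V \<sqinter> open_of W"
    have w: "w \<in> carrier L" "w \<sqsubseteq> open_of V \<sqinter> open_of W" "\<not> w \<sqsubseteq> open_of (V \<inter> W)"
      using not_le le_refl[of w] unfolding w_def by simp_all
    then have le: "w \<sqsubseteq> open_of V" "w \<sqsubseteq> open_of W" by (simp_all add: le_meet_iff)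
    obtain u w' where u': "u \<in> {u \<in> carrier L. {q \<in> Q. u \<in> q} \<subseteq> V}"
      and w': "w' \<in> carrier L" "w' \<sqsubseteq> w" "w' \<sqsubseteq> u" "\<not> w' \<sqsubseteq> open_of (V \<inter> W)"
      by (rule refine_Sup[OF _ w(1) le(1)[unfolded open_of_def] open_of_closed w(3)]) blast
    from u' have u: "u \<in> carrier L" "{q \<in> Q. u \<in> q} \<subseteq> V" by blast+
    have le': "w' \<sqsubseteq> open_of W" using le_trans[OF w'(2) le(2)] w' w by simp
    obtain v w'' where v': "v \<in> {v \<in> carrier L. {q \<in> Q. v \<in> q} \<subseteq> W}"
      and w'': "w'' \<in> carrier L" "w'' \<sqsubseteq> w'" "w'' \<sqsubseteq> v" "\<not> w'' \<sqsubseteq> open_of (V \<inter> W)"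
      by (rule refine_Sup[OF _ w'(1) le'[unfolded open_of_def] open_of_closed w'(4)]) blast
    from v' have v: "v \<in> carrier L" "{q \<in> Q. v \<in> q} \<subseteq> W" by blast+
    have "u \<sqinter> v \<sqsubseteq> open_of (V \<inter> W)"
      using Int_basic[OF u(1) v(1)] u v by (intro le_open_ofI) auto
    moreover have "w'' \<sqsubseteq> u \<sqinter> v"
      using le_trans[OF w''(2) w'(3)] w' w'' u v by (simp add: le_meet_iff)
    ultimately show False using le_trans[of w'' "u \<sqinter> v"] w'' u v by auto
  qed
  moreover have "open_of (V \<inter> W) \<sqsubseteq> open_of V \<sqinter> open_of W"
    by (intro open_of_leI) (auto simp: le_meet_iff intro: le_open_ofI)
  ultimately show "open_of (V \<inter> W) = open_of V \<sqinter> open_of W" by (intro le_antisym) auto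
next
  fix \<W> assume \<W>: "\<And>W. W \<in> \<W> \<Longrightarrow> openin (filter_space Q) W"
  let ?v = "\<Squnion>(open_of ` \<W>)"
  have v: "?v \<in> carrier L" by (rule sup_closed) auto
  have "open_of (\<Union>\<W>) \<sqsubseteq> ?v"
  proof (rule open_of_leI[OF v])
    fix u assume u: "u \<in> carrier L" "{q \<in> Q. u \<in> q} \<subseteq> \<Union>\<W>"
    show "u \<sqsubseteq> ?v"
    proof (rule ccontr)
      assume "\<not> ?thesis"
      then obtain p where p: "p \<in> Q" "u \<in> p" "?v \<notin> p" using separating[OF u(1) v] by blast
      then obtain W where W: "W \<in> \<W>" "p \<in> W" using u(2) by blast
      then obtain u' where u': "u' \<in> p" "{q \<in> Q. u' \<in> q} \<subseteq> W"
        using \<W>[OF W(1)] unfolding openin_iff by blast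
      have "u' \<sqsubseteq> open_of W" using filter_carrier[OF p(1) u'(1)] u'(2) by (rule le_open_ofI)
      then have "open_of W \<in> p" using proper_filterD(5)[OF filter[OF p(1)] u'(1)] by simp
      moreover have "open_of W \<sqsubseteq> ?v" using W(1) by (intro sup_upper) auto
      ultimately show False using proper_filterD(5)[OF filter[OF p(1)] _ v] p(3) by blast
    qed
  qed
  moreover have "?v \<sqsubseteq> open_of (\<Union>\<W>)"
  proof (rule sup_least)
    fix w assume "w \<in> open_of ` \<W>"
    then obtain W where W: "W \<in> \<W>" "w = open_of W" by blast
    show "w \<sqsubseteq> open_of (\<Union>\<W>)"
      unfolding W(2) using W(1) by (intro open_of_leI) (auto intro!: le_open_ofI)
  qed auto
  ultimately show "open_of (\<Union>\<W>) = ?v" using v by (intro le_antisym) auto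
qed

end

section \<open>Pulling back numerable covers\<close>

lemma spatial_morphism_preimage:
  assumes "spatial_morphism L X h" and g: "continuous_map X Y g"
  shows "spatial_morphism L Y (\<lambda>A. h {x \<in> topspace X. g x \<in> A})"
proof -
  interpret spatial_morphism L X h by fact
  have op: "openin X {x \<in> topspace X. g x \<in> A}" if "openin Y A" for A
    using g that by (rule openin_continuous_map_preimage)
  show ?thesis
  proof (rule spatial_morphismI)
    show "frame L" by unfold_locales
    show "h {x \<in> topspace X. g x \<in> A} \<in> carrier L" if "openin Y A" for A
      using op[OF that] by simp
    have "{x \<in> topspace X. g x \<in> topspace Y} = topspace X" using g unfolding continuous_map_def by auto
    then show "h {x \<in> topspace X. g x \<in> topspace Y} = \<top>\<^bsub>L\<^esub>" using top by simp
    fix A B assume AB: "openin Y A" "openin Y B"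
    have "{x \<in> topspace X. g x \<in> A \<inter> B} = {x \<in> topspace X. g x \<in> A} \<inter> {x \<in> topspace X. g x \<in> B}" by blast
    then show "h {x \<in> topspace X. g x \<in> A \<inter> B} = h {x \<in> topspace X. g x \<in> A} \<sqinter>\<^bsub>L\<^esub> h {x \<in> topspace X. g x \<in> B}"
      using meet[OF op[OF AB(1)] op[OF AB(2)]] by simp
  next
    fix \<A> assume A: "\<And>A. A \<in> \<A> \<Longrightarrow> openin Y A"
    have "{x \<in> topspace X. g x \<in> \<Union>\<A>} = (\<Union>A\<in>\<A>. {x \<in> topspace X. g x \<in> A})" by blast
    then show "h {x \<in> topspace X. g x \<in> \<Union>\<A>} = \<Squnion>\<^bsub>L\<^esub>((\<lambda>A. h {x \<in> topspace X. g x \<in> A}) ` \<A>)"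
      using UN[of \<A> "\<lambda>A. {x \<in> topspace X. g x \<in> A}"] op A by simp
  qed
qed

text \<open>Continuity of addition: every point whose sum lies in \<open>W\<close> has an open box
  around its coordinates on which the sum stays in \<open>W\<close>. The preimage is thus a union of
  boxes, and \<open>h\<close> preserves unions and finite intersections.\<close>

lemma (in spatial_morphism) locale_sum_preimage:
  fixes f :: "'i \<Rightarrow> 'x \<Rightarrow> real"
  assumes J: "finite J" and f: "\<And>i. i \<in> J \<Longrightarrow> continuous_map X (top_of_set {0..}) (f i)"
    and W: "openin (top_of_set {0..}) W"
  shows "locale_sum L (\<lambda>i A. h {x \<in> topspace X. f i x \<in> A}) J W = h {x \<in> topspace X. (\<Sum>i\<in>J. f i x) \<in> W}"
proof -
  define \<B> where "\<B> = {A. (\<forall>i\<in>J. openin (top_of_set {0..}) (A i)) \<and> (\<forall>x. (\<forall>i\<in>J. x i \<in> A i) \<longrightarrow> (\<Sum>i\<in>J. x i) \<in> W)}"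
  define box where "box A = topspace X \<inter> \<Inter>((\<lambda>i. {x \<in> topspace X. f i x \<in> A i}) ` J)" for A
  have op: "openin X {x \<in> topspace X. f i x \<in> A i}" if "A \<in> \<B>" "i \<in> J" for A i
    using that f[OF that(2)] unfolding \<B>_def by (auto intro: openin_continuous_map_preimage)
  have opbox: "openin X (box A)" if "A \<in> \<B>" for A
    unfolding box_def using J op[OF that] by (intro openin_Int_Inter) auto
  have hbox: "h (box A) = \<Sqinter>((\<lambda>i. h {x \<in> topspace X. f i x \<in> A i}) ` J)" if "A \<in> \<B>" for A
    unfolding box_def using Inf[of "(\<lambda>i. {x \<in> topspace X. f i x \<in> A i}) ` J"] J op[OF that]
    by (auto simp: image_image)
  have "\<exists>A\<in>\<B>. x \<in> box A" if x: "x \<in> topspace X" "(\<Sum>i\<in>J. f i x) \<in> W" for x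
  proof -
    obtain O' where O: "open O'" "W = {0..} \<inter> O'" using W openin_open by blast
    then obtain e where e: "0 < e" "ball (\<Sum>i\<in>J. f i x) e \<subseteq> O'" using x(2) by (meson IntD2 openE)
    \<comment> \<open>With \<open>card J\<close> errors below \<open>?d\<close> the total error is
      strictly less than \<open>e\<close>; the added 1 also covers empty \<open>J\<close>.\<close>
    let ?d = "e / (card J + 1)"
    let ?A = "\<lambda>i. {0..} \<inter> ball (f i x) ?d"
    have d: "0 < ?d" using e by simp
    have fx: "0 \<le> f i x" if "i \<in> J" for i
      using f[OF that] x(1) unfolding continuous_map_in_subtopology by auto
    have "(\<Sum>i\<in>J. y i) \<in> W" if y: "\<And>i. i \<in> J \<Longrightarrow> y i \<in> ?A i" for y
    proof -
      have "\<bar>(\<Sum>i\<in>J. f i x) - (\<Sum>i\<in>J. y i)\<bar> \<le> (\<Sum>i\<in>J. \<bar>f i x - y i\<bar>)"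
        unfolding sum_subtractf[symmetric] by (rule sum_abs)
      also have "\<dots> \<le> (\<Sum>i\<in>J. ?d)" using y by (intro sum_mono) (auto simp: dist_real_def intro: less_imp_le)
      also have "\<dots> < e" using e(1) by (simp add: field_simps)
      finally have "(\<Sum>i\<in>J. y i) \<in> O'" using e(2) by (auto simp: dist_real_def)
      moreover have "0 \<le> (\<Sum>i\<in>J. y i)" using y by (intro sum_nonneg) auto
      ultimately show ?thesis using O(2) by auto
    qed
    then have "?A \<in> \<B>" unfolding \<B>_def by (auto simp: openin_open)
    moreover have "x \<in> box ?A" unfolding box_def using x(1) fx d by auto
    ultimately show ?thesis by blast
  qed
  then have "{x \<in> topspace X. (\<Sum>i\<in>J. f i x) \<in> W} = (\<Union>A\<in>\<B>. box A)"
    unfolding \<B>_def box_def by auto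
  then have "h {x \<in> topspace X. (\<Sum>i\<in>J. f i x) \<in> W} = \<Squnion>((\<lambda>A. h (box A)) ` \<B>)"
    using UN[of \<B> box, OF opbox] by simp
  also have "(\<lambda>A. h (box A)) ` \<B> = {\<Sqinter>((\<lambda>i. h {x \<in> topspace X. f i x \<in> A i}) ` J) | A. A \<in> \<B>}"
    using hbox by (auto simp: image_def)
  finally show ?thesis unfolding locale_sum_def \<B>_def by simp
qed

lemma (in spatial_morphism) locale_open_cover_image:
  assumes "open_cover X I U"
  shows "locale_open_cover L I (\<lambda>i. h (U i))"
  unfolding locale_open_cover_def
  using assms UN[of I U] top closed frame_axioms unfolding open_cover_def by auto

lemma (in frame) top_leD: "a \<in> carrier L \<Longrightarrow> \<top> \<sqsubseteq> a \<Longrightarrow> a = \<top>"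
  by (rule le_antisym) (auto simp: top_higher)

text \<open>All numerability of locale covers below is obtained here, by pulling a partition back
  from a space. The supremum over finite partial sums is already a union of open sets upstairs, by
  \<open>less_infsum_iff\<close>. The opens \<open>U i\<close> need not come from the space; it is
  enough that they contain pullbacks.\<close>

lemma (in spatial_morphism) locale_numerableI:
  assumes num: "numerable X I W" and U: "\<And>i. i \<in> I \<Longrightarrow> U i \<in> carrier L"
    and le: "\<And>i. i \<in> I \<Longrightarrow> h (W i) \<sqsubseteq> U i"
  shows "locale_numerable L I U"
proof -
  obtain f where f: "positive_partition X I f" and sub: "\<forall>i\<in>I. {x \<in> topspace X. 0 < f i x} \<subseteq> W i"
    and cov: "open_cover X I W"
    using num unfolding numerable_def by blast
  have W: "openin X (W i)" if "i \<in> I" for i using cov that unfolding open_cover_def by blast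
  have UI: "U ` I \<subseteq> carrier L" using U by blast
  have "\<top> = \<Squnion>((\<lambda>i. h (W i)) ` I)"
    using locale_open_cover_image[OF cov] unfolding locale_open_cover_def by simp
  moreover have "\<dots> \<sqsubseteq> \<Squnion>(U ` I)"
  proof (rule sup_least)
    fix w assume "w \<in> (\<lambda>i. h (W i)) ` I"
    then obtain i where i: "i \<in> I" "w = h (W i)" by blast
    show "w \<sqsubseteq> \<Squnion>(U ` I)"
      unfolding i(2) using le_trans[OF le[OF i(1)] sup_upper[OF UI]] i W U UI by simp
  qed (use W UI in auto)
  ultimately have "\<Squnion>(U ` I) = \<top>" using UI by (intro top_leD) auto
  then have "locale_open_cover L I U" unfolding locale_open_cover_def using U frame_axioms by blast
  moreover
  have fc: "continuous_map X (top_of_set {0..}) (f i)" if "i \<in> I" for i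
    using f that unfolding positive_partition_def by blast
  let ?f = "\<lambda>i A. h {x \<in> topspace X. f i x \<in> A}"
  let ?t = "\<lambda>x. \<Sum>\<^sub>\<infinity>i\<in>I. f i x"
  let ?s = "\<lambda>A. h {x \<in> topspace X. ?t x \<in> A}"
  have sc: "continuous_map X (top_of_set {0<..}) ?t"
    using f unfolding positive_partition_def by blast
  have "?s ({0<..} \<inter> {a<..}) = \<Squnion>{locale_sum L ?f J ({0..} \<inter> {a<..}) | J. J \<subseteq> I \<and> finite J}" for a
  proof -
    let ?\<J> = "{J. J \<subseteq> I \<and> finite J}"
    let ?P = "\<lambda>J. {x \<in> topspace X. (\<Sum>i\<in>J. f i x) \<in> {0..} \<inter> {a<..}}"
    have o: "openin (top_of_set {0..}) ({0..} \<inter> {a<..})" by (simp add: openin_open_Int)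
    have c: "continuous_map X (top_of_set {0..}) (\<lambda>x. \<Sum>i\<in>J. f i x)" if "J \<in> ?\<J>" for J
      using that positive_partitionD(1,2)[OF f]
      by (intro continuous_map_into_subtopology continuous_map_sum) (auto intro!: sum_nonneg)
    have "{x \<in> topspace X. ?t x \<in> {0<..} \<inter> {a<..}} = (\<Union>J\<in>?\<J>. ?P J)"
    proof -
      have "?t x \<in> {0<..} \<inter> {a<..} \<longleftrightarrow> (\<exists>J\<in>?\<J>. (\<Sum>i\<in>J. f i x) \<in> {0..} \<inter> {a<..})" if x: "x \<in> topspace X" for x
      proof -
        have "0 < ?t x" using positive_partitionD(5)[OF f x] .
        moreover have "0 \<le> (\<Sum>i\<in>J. f i x)" if "J \<in> ?\<J>" for J
          using that positive_partitionD(2)[OF f _ x] by (intro sum_nonneg) auto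
        ultimately show ?thesis
          using less_infsum_iff[OF positive_partitionD(3)[OF f x] positive_partitionD(2)[OF f _ x], of a] by auto
      qed
      then show ?thesis by blast
    qed
    moreover have "openin X (?P J)" if "J \<in> ?\<J>" for J
      using c[OF that] o by (rule openin_continuous_map_preimage)
    ultimately have "?s ({0<..} \<inter> {a<..}) = \<Squnion>((\<lambda>J. h (?P J)) ` ?\<J>)"
      using UN[of ?\<J> ?P] by simp
    also have "(\<lambda>J. h (?P J)) ` ?\<J> = (\<lambda>J. locale_sum L ?f J ({0..} \<inter> {a<..})) ` ?\<J>"
    proof (rule image_cong[OF HOL.refl])
      fix J assume "J \<in> ?\<J>"
      then show "h (?P J) = locale_sum L ?f J ({0..} \<inter> {a<..})"
        by (intro locale_sum_preimage[symmetric] o fc) auto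
    qed
    also have "\<dots> = {locale_sum L ?f J ({0..} \<inter> {a<..}) | J. J \<subseteq> I \<and> finite J}" by blast
    finally show ?thesis .
  qed
  then have "locale_positive_partition L I ?f"
    unfolding locale_positive_partition_def
    using spatial_morphism_preimage[OF spatial_morphism_axioms] fc sc
    by (blast intro: spatial_morphism.morphism)
  moreover have "?f i {0<..} \<sqsubseteq> U i" if i: "i \<in> I" for i
  proof -
    have "openin X {x \<in> topspace X. f i x \<in> {0<..}}"
      using openin_superlevel[OF positive_partitionD(1)[OF f i], of 0] by simp
    moreover from this have "h {x \<in> topspace X. f i x \<in> {0<..}} \<sqsubseteq> h (W i)"
      using sub i W by (intro mono) auto
    ultimately show ?thesis using le_trans[OF _ le[OF i]] W[OF i] U[OF i] by simp
  qed
  ultimately show ?thesis unfolding locale_numerable_def by blast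
qed

section \<open>Open sublocales\<close>

context
  fixes L :: "'l gorder" (structure) and u
  assumes L: "frame L" and u: "u \<in> carrier L"
begin

interpretation frame L by (rule L)

lemma open_sublocale_simps [simp]:
  "carrier (open_sublocale L u) = {v \<in> carrier L. v \<sqsubseteq> u}"
  "le (open_sublocale L u) = le L" "eq (open_sublocale L u) = eq L"
  by (simp_all add: open_sublocale_def)

lemma partial_order_open_sublocale: "partial_order (open_sublocale L u)"
  by unfold_locales (auto simp: eq_is_equal intro: le_trans le_antisym)

lemma Sup_open_sublocale:
  assumes A: "A \<subseteq> carrier (open_sublocale L u)"
  shows "least (open_sublocale L u) (\<Squnion>A) (Upper (open_sublocale L u) A)"
    and "\<Squnion>\<^bsub>open_sublocale L u\<^esub>A = \<Squnion>A"
proof -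
  have A': "A \<subseteq> carrier L" "\<And>a. a \<in> A \<Longrightarrow> a \<sqsubseteq> u" using A by auto
  then have "\<Squnion>A \<sqsubseteq> u" using u by (intro sup_least)
  then show *: "least (open_sublocale L u) (\<Squnion>A) (Upper (open_sublocale L u) A)"
    unfolding least_def
  proof (intro conjI ballI)
    show "\<Squnion>A \<in> Upper (open_sublocale L u) A"
      using A' sup_upper[OF A'(1)] \<open>\<Squnion>A \<sqsubseteq> u\<close> unfolding Upper_def by auto
    show "\<Squnion>A \<sqsubseteq>\<^bsub>open_sublocale L u\<^esub> v" if v: "v \<in> Upper (open_sublocale L u) A" for v
    proof -
      have "a \<sqsubseteq> v" if "a \<in> A" for a using v A' that unfolding Upper_def by auto
      moreover have "v \<in> carrier L" using v unfolding Upper_def by auto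
      ultimately show ?thesis using sup_least[OF A'(1)] by simp
    qed
  qed (use A in \<open>auto simp: Upper_def\<close>)
  show "\<Squnion>\<^bsub>open_sublocale L u\<^esub>A = \<Squnion>A"
    by (rule partial_order.sup_eqI[OF partial_order_open_sublocale *])
qed

text \<open>Meeting with \<open>u\<close> makes the empty family come out right: its infimum in the
  sublocale is \<open>u\<close>, not the top of \<open>L\<close>.\<close>

lemma Inf_open_sublocale:
  assumes A: "A \<subseteq> carrier (open_sublocale L u)"
  shows "greatest (open_sublocale L u) (u \<sqinter> \<Sqinter>A) (Lower (open_sublocale L u) A)"
    and "\<Sqinter>\<^bsub>open_sublocale L u\<^esub>A = u \<sqinter> \<Sqinter>A"
proof -
  have A': "A \<subseteq> carrier L" using A by auto
  then have c: "\<Sqinter>A \<in> carrier L" "u \<sqinter> \<Sqinter>A \<in> carrier L" using u by auto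
  have "u \<sqinter> \<Sqinter>A \<sqsubseteq> a" if "a \<in> A" for a
    using le_trans[OF meet_right[OF u c(1)] inf_lower[OF A' that]] c A' that by blast
  then show *: "greatest (open_sublocale L u) (u \<sqinter> \<Sqinter>A) (Lower (open_sublocale L u) A)"
    unfolding greatest_def
  proof (intro conjI ballI)
    assume lower: "\<And>a. a \<in> A \<Longrightarrow> u \<sqinter> \<Sqinter>A \<sqsubseteq> a"
    then show "u \<sqinter> \<Sqinter>A \<in> Lower (open_sublocale L u) A"
      using A' c meet_left[OF u c(1)] unfolding Lower_def by auto
    show "v \<sqsubseteq>\<^bsub>open_sublocale L u\<^esub> u \<sqinter> \<Sqinter>A" if v: "v \<in> Lower (open_sublocale L u) A" for v
    proof -
      have "v \<sqsubseteq> a" if "a \<in> A" for a using v A that unfolding Lower_def by auto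
      moreover have "v \<in> carrier L" "v \<sqsubseteq> u" using v unfolding Lower_def by auto
      ultimately show ?thesis using c u A' by (simp add: le_meet_iff le_Inf_iff)
    qed
  qed (use A in \<open>auto simp: Lower_def\<close>)
  show "\<Sqinter>\<^bsub>open_sublocale L u\<^esub>A = u \<sqinter> \<Sqinter>A"
    by (rule partial_order.inf_eqI[OF partial_order_open_sublocale *])
qed

lemma meet_open_sublocale:
  assumes "a \<in> carrier (open_sublocale L u)" "b \<in> carrier (open_sublocale L u)"
  shows "a \<sqinter>\<^bsub>open_sublocale L u\<^esub> b = a \<sqinter> b"
proof -
  have "a \<sqinter>\<^bsub>open_sublocale L u\<^esub> b = u \<sqinter> (a \<sqinter> b)"
    using Inf_open_sublocale(2)[of "{a, b}"] assms unfolding meet_def by auto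
  also have "\<dots> = a \<sqinter> b"
  proof (rule le_antisym)
    have ab: "a \<in> carrier L" "b \<in> carrier L" "a \<sqsubseteq> u" "a \<sqinter> b \<in> carrier L" using assms by auto
    then show "u \<sqinter> (a \<sqinter> b) \<sqsubseteq> a \<sqinter> b" using u by (intro meet_right)
    have "a \<sqinter> b \<sqsubseteq> u" using le_trans[OF meet_left[OF ab(1,2)] ab(3)] ab u by simp
    then show "a \<sqinter> b \<sqsubseteq> u \<sqinter> (a \<sqinter> b)" using ab u by (simp add: le_meet_iff[OF u ab(4,4)])
  qed (use assms u in auto)
  finally show ?thesis .
qed

lemma frame_open_sublocale: "frame (open_sublocale L u)"
proof -
  interpret S: partial_order "open_sublocale L u" by (rule partial_order_open_sublocale)
  show ?thesis
  proof
    fix A assume "A \<subseteq> carrier (open_sublocale L u)"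
    then show "\<exists>s. least (open_sublocale L u) s (Upper (open_sublocale L u) A)"
      and "\<exists>i. greatest (open_sublocale L u) i (Lower (open_sublocale L u) A)"
      using Sup_open_sublocale(1) Inf_open_sublocale(1) by blast+
  next
    fix a B assume aB: "a \<in> carrier (open_sublocale L u)" "B \<subseteq> carrier (open_sublocale L u)"
    then have c: "a \<in> carrier L" "B \<subseteq> carrier L" by auto
    have S: "\<Squnion>B \<in> carrier (open_sublocale L u)"
      using Sup_open_sublocale(1)[OF aB(2)] unfolding least_def Upper_def by auto
    have m: "a \<sqinter> b \<in> carrier (open_sublocale L u)" if "b \<in> B" for b
      using le_trans[OF meet_left[of a b], of u] that aB u by auto
    have "a \<sqinter>\<^bsub>open_sublocale L u\<^esub> \<Squnion>\<^bsub>open_sublocale L u\<^esub>B = a \<sqinter> \<Squnion>B"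
      using Sup_open_sublocale(2)[OF aB(2)] meet_open_sublocale[OF aB(1) S] by simp
    also have "\<dots> = \<Squnion>((\<lambda>b. a \<sqinter> b) ` B)" by (rule meet_Sup_distrib[OF c])
    also have "\<dots> = \<Squnion>\<^bsub>open_sublocale L u\<^esub>((\<lambda>b. a \<sqinter> b) ` B)"
      using m by (intro Sup_open_sublocale(2)[symmetric]) blast
    also have "(\<lambda>b. a \<sqinter> b) ` B = (\<lambda>b. a \<sqinter>\<^bsub>open_sublocale L u\<^esub> b) ` B"
      using meet_open_sublocale[OF aB(1)] aB(2) by (intro image_cong) auto
    finally show "a \<sqinter>\<^bsub>open_sublocale L u\<^esub> \<Squnion>\<^bsub>open_sublocale L u\<^esub>B
      = \<Squnion>\<^bsub>open_sublocale L u\<^esub>((\<lambda>b. a \<sqinter>\<^bsub>open_sublocale L u\<^esub> b) ` B)" .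
  qed
qed

lemma top_open_sublocale: "\<top>\<^bsub>open_sublocale L u\<^esub> = u"
proof -
  interpret S: frame "open_sublocale L u" by (rule frame_open_sublocale)
  show ?thesis using u S.top_higher[of u] S.top_closed by (intro le_antisym) auto
qed

lemma bottom_open_sublocale: "\<bottom>\<^bsub>open_sublocale L u\<^esub> = \<bottom>"
proof -
  interpret S: frame "open_sublocale L u" by (rule frame_open_sublocale)
  show ?thesis using S.Sup_empty Sup_open_sublocale(2)[of "{}"] Sup_empty by simp
qed

end

lemma (in spatial_morphism) spatial_morphism_subtopology:
  assumes W: "openin X W"
  shows "spatial_morphism (open_sublocale L (h W)) (subtopology X W) h"
proof -
  have op: "openin X A" "A \<subseteq> W" if "openin (subtopology X W) A" for A
    using that openin_open_subtopology[OF W] by auto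
  have hW: "frame L" "h W \<in> carrier L" using frame_axioms W by auto
  have car: "h A \<in> carrier (open_sublocale L (h W))" if "openin (subtopology X W) A" for A
    using op[OF that] mono[OF _ W] open_sublocale_simps[OF hW] by simp
  show ?thesis
  proof (rule spatial_morphismI)
    show "frame (open_sublocale L (h W))" by (rule frame_open_sublocale[OF hW])
    show "h A \<in> carrier (open_sublocale L (h W))" if "openin (subtopology X W) A" for A
      by (rule car[OF that])
    have "topspace (subtopology X W) = W" using openin_subset[OF W] by auto
    then show "h (topspace (subtopology X W)) = \<top>\<^bsub>open_sublocale L (h W)\<^esub>"
      using top_open_sublocale[OF hW] by simp
    show "h (A \<inter> B) = h A \<sqinter>\<^bsub>open_sublocale L (h W)\<^esub> h B"
      if "openin (subtopology X W) A" "openin (subtopology X W) B" for A B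
      using meet_open_sublocale[OF hW car[OF that(1)] car[OF that(2)]] meet[OF op(1)[OF that(1)] op(1)[OF that(2)]]
      by simp
    show "h (\<Union>\<A>) = \<Squnion>\<^bsub>open_sublocale L (h W)\<^esub>(h ` \<A>)"
      if "\<And>A. A \<in> \<A> \<Longrightarrow> openin (subtopology X W) A" for \<A>
    proof -
      have "h ` \<A> \<subseteq> carrier (open_sublocale L (h W))" using car[OF that] by blast
      then have "\<Squnion>\<^bsub>open_sublocale L (h W)\<^esub>(h ` \<A>) = \<Squnion>(h ` \<A>)" by (rule Sup_open_sublocale(2)[OF hW])
      then show ?thesis using Sup[OF op(1)[OF that]] by simp
    qed
  qed
qed

section \<open>Positive partitions on locales\<close>

text \<open>The limit of the image filter of \<open>p\<close> on \<open>D\<close>, as a real number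
  that may lie on the boundary of \<open>D\<close>; this is why positivity of the mass later needs
  its own argument.\<close>

definition filter_value :: "real set \<Rightarrow> (real set \<Rightarrow> 'l) \<Rightarrow> 'l set \<Rightarrow> real" where
  "filter_value D h p = (SOME x. \<forall>e>0. h (D \<inter> {x-e<..<x+e}) \<in> p)"

locale real_morphism = spatial_morphism L "top_of_set D" h
  for L :: "'l gorder" (structure) and D :: "real set" and h
begin

lemma openin_Int: "open A \<Longrightarrow> openin (top_of_set D) (D \<inter> A)"
  by (rule openin_open_Int)

lemma closed_Int [simp]: "open A \<Longrightarrow> h (D \<inter> A) \<in> carrier L"
  by (intro closed openin_Int)

lemma mono_Int: "open A \<Longrightarrow> open B \<Longrightarrow> D \<inter> A \<subseteq> B \<Longrightarrow> h (D \<inter> A) \<sqsubseteq> h (D \<inter> B)"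
  by (intro mono openin_Int) auto

lemma mem_mono:
  assumes "proper_filter p" "open A" "open B" "h (D \<inter> A) \<in> p" "D \<inter> A \<subseteq> B"
  shows "h (D \<inter> B) \<in> p"
  using proper_filterD(5)[OF assms(1,4) _ mono_Int] assms by simp

text \<open>The bottom is not in \<open>p\<close>, so two conditions on a real number that
  \<open>p\<close> contains are satisfied by a common number.\<close>

lemma meets:
  assumes p: "proper_filter p" and AB: "open A" "open B" "h (D \<inter> A) \<in> p" "h (D \<inter> B) \<in> p"
  obtains x where "x \<in> D" "x \<in> A" "x \<in> B"
proof -
  have "h (D \<inter> A \<inter> (D \<inter> B)) \<in> p"
    using proper_filterD(4)[OF p AB(3,4)] meet[OF openin_Int openin_Int] AB(1,2) by simp
  then have "D \<inter> A \<inter> (D \<inter> B) \<noteq> {}" using proper_filterD(3)[OF p] bottom by metis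
  then show thesis using that by blast
qed

text \<open>The Cauchy condition for the image filter.\<close>

definition decides :: "'l set \<Rightarrow> bool" where
  "decides p \<longleftrightarrow> proper_filter p \<and> (\<forall>e>0. \<exists>a. h (D \<inter> {a<..<a+e}) \<in> p)"

lemma proper_filter_of_decides: "decides p \<Longrightarrow> proper_filter p"
  unfolding decides_def by blast

text \<open>Completeness of the reals: the limit is the supremum of the left endpoints of all
  intervals that belong to the image filter.\<close>

lemma filter_value:
  assumes p: "decides p" and e: "0 < e"
  shows "h (D \<inter> {filter_value D h p - e<..<filter_value D h p + e}) \<in> p"
proof -
  have pf: "proper_filter p" using p unfolding decides_def by blast
  define S where "S = {a. \<exists>b. h (D \<inter> {a<..<b}) \<in> p}"
  have ub: "a \<le> b'" if "h (D \<inter> {a<..<b}) \<in> p" "h (D \<inter> {a'<..<b'}) \<in> p" for a b a' b'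
    using meets[OF pf _ _ that] by fastforce
  obtain a0 where a0: "h (D \<inter> {a0<..<a0+1}) \<in> p" using p unfolding decides_def by (meson zero_less_one)
  have bdd: "bdd_above S" by (rule bdd_aboveI[of _ "a0 + 1"]) (use ub[OF _ a0] in \<open>auto simp: S_def\<close>)
  have ne: "S \<noteq> {}" using a0 unfolding S_def by blast
  have "\<forall>e>0. h (D \<inter> {Sup S - e<..<Sup S + e}) \<in> p"
  proof (intro allI impI)
    fix e :: real assume e: "0 < e"
    obtain a where a: "h (D \<inter> {a<..<a+e/2}) \<in> p" using p e unfolding decides_def by (meson half_gt_zero)
    then have "a \<in> S" unfolding S_def by blast
    then have "a \<le> Sup S" using bdd by (rule cSup_upper)
    moreover have "Sup S \<le> a + e/2" by (rule cSup_least[OF ne]) (use ub[OF _ a] in \<open>auto simp: S_def\<close>)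
    ultimately show "h (D \<inter> {Sup S - e<..<Sup S + e}) \<in> p"
      using e by (intro mem_mono[OF pf _ _ a]) auto
  qed
  then have "\<forall>e>0. h (D \<inter> {filter_value D h p - e<..<filter_value D h p + e}) \<in> p"
    unfolding filter_value_def by (rule someI)
  then show ?thesis using e by blast
qed

lemma filter_value_ge:
  assumes p: "decides p" and a: "h (D \<inter> {a<..}) \<in> p"
  shows "a \<le> filter_value D h p"
proof (rule ccontr)
  let ?x = "filter_value D h p"
  assume "\<not> ?thesis"
  then have "h (D \<inter> {?x - (a - ?x)<..<?x + (a - ?x)}) \<in> p" using filter_value[OF p, of "a - ?x"] by linarith
  then obtain x where "x \<in> {a<..}" "x \<in> {?x - (a - ?x)<..<?x + (a - ?x)}"
    using meets[OF proper_filter_of_decides[OF p] _ _ a] by (metis open_greaterThan open_greaterThanLessThan)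
  then show False by simp
qed

lemma filter_value_le:
  assumes p: "decides p" and b: "h (D \<inter> {..<b}) \<in> p"
  shows "filter_value D h p \<le> b"
proof (rule ccontr)
  let ?x = "filter_value D h p"
  assume "\<not> ?thesis"
  then have "h (D \<inter> {?x - (?x - b)<..<?x + (?x - b)}) \<in> p" using filter_value[OF p, of "?x - b"] by linarith
  then obtain x where "x \<in> {..<b}" "x \<in> {?x - (?x - b)<..<?x + (?x - b)}"
    using meets[OF proper_filter_of_decides[OF p] _ _ b] by (metis open_lessThan open_greaterThanLessThan)
  then show False by simp
qed

text \<open>The intermediate \<open>b\<close> matters: a filter may contain the pullback of the ray
  above \<open>a\<close> while its value is exactly \<open>a\<close>.\<close>

lemma less_filter_value_iff:
  assumes p: "decides p"
  shows "a < filter_value D h p \<longleftrightarrow> (\<exists>b>a. h (D \<inter> {b<..}) \<in> p)"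
proof
  let ?x = "filter_value D h p"
  assume a: "a < ?x"
  have mem: "h (D \<inter> {?x - (?x - a)/2<..<?x + (?x - a)/2}) \<in> p" using filter_value[OF p] a by simp
  have "h (D \<inter> {?x - (?x - a)/2<..}) \<in> p"
    by (rule mem_mono[OF proper_filter_of_decides[OF p] _ _ mem]) auto
  moreover have "a < ?x - (?x - a)/2" using a by (simp add: field_simps)
  ultimately show "\<exists>b>a. h (D \<inter> {b<..}) \<in> p" by blast
qed (use filter_value_ge[OF p] in force)

lemma filter_value_less_iff:
  assumes p: "decides p"
  shows "filter_value D h p < a \<longleftrightarrow> (\<exists>b<a. h (D \<inter> {..<b}) \<in> p)"
proof
  let ?x = "filter_value D h p"
  assume a: "?x < a"
  have mem: "h (D \<inter> {?x - (a - ?x)/2<..<?x + (a - ?x)/2}) \<in> p" using filter_value[OF p] a by simp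
  have "h (D \<inter> {..<?x + (a - ?x)/2}) \<in> p"
    by (rule mem_mono[OF proper_filter_of_decides[OF p] _ _ mem]) auto
  moreover have "?x + (a - ?x)/2 < a" using a by (simp add: field_simps)
  ultimately show "\<exists>b<a. h (D \<inter> {..<b}) \<in> p" by blast
qed (use filter_value_le[OF p] in force)

text \<open>The filters are parametrised by \<open>P\<close> because, besides the filters of the
  space themselves, their restrictions to open sublocales will be evaluated. The two
  characterisations of strict inequality exhibit preimages of rays as unions of the sets in
  \<open>op\<close>.\<close>

lemma continuous_map_filter_value:
  assumes P: "\<And>y. y \<in> topspace Y \<Longrightarrow> decides (P y)"
    and op: "\<And>u. u \<in> carrier L \<Longrightarrow> openin Y {y \<in> topspace Y. u \<in> P y}"
  shows "continuous_map Y euclideanreal (\<lambda>y. filter_value D h (P y))"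
  unfolding continuous_map_upper_lower_semicontinuous_lt
proof (intro conjI allI)
  fix a
  have "{y \<in> topspace Y. a < filter_value D h (P y)}
      = (\<Union>b\<in>{a<..}. {y \<in> topspace Y. h (D \<inter> {b<..}) \<in> P y})"
    using less_filter_value_iff[OF P] by auto
  then show "openin Y {y \<in> topspace Y. a < filter_value D h (P y)}" using op by auto
  have "{y \<in> topspace Y. filter_value D h (P y) < a}
      = (\<Union>b\<in>{..<a}. {y \<in> topspace Y. h (D \<inter> {..<b}) \<in> P y})"
    using filter_value_less_iff[OF P] by auto
  then show "openin Y {y \<in> topspace Y. filter_value D h (P y) < a}" using op by auto
qed

end

locale locale_partition = frame L for L :: "'l gorder" (structure) +
  fixes I :: "'i set" and f :: "'i \<Rightarrow> real set \<Rightarrow> 'l" and s :: "real set \<Rightarrow> 'l"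
  assumes f: "i \<in> I \<Longrightarrow> locale_morphism L (opens (top_of_set {0..})) (f i)"
    and s: "locale_morphism L (opens (top_of_set {0<..})) s"
    and sum: "s ({0<..} \<inter> {a<..}) = \<Squnion>{locale_sum L f J ({0..} \<inter> {a<..}) | J. J \<subseteq> I \<and> finite J}"
begin

sublocale s: real_morphism L "{0<..}" s
  by unfold_locales (rule s)

lemma f_morphism: "i \<in> I \<Longrightarrow> real_morphism L {0..} (f i)"
  by unfold_locales (rule f)

lemma f_closed [simp]: "i \<in> I \<Longrightarrow> openin (top_of_set {0..}) A \<Longrightarrow> f i A \<in> carrier L"
  using spatial_morphism.closed[OF real_morphism.axioms[OF f_morphism]] .

lemma box_closed:
  assumes "J \<subseteq> I" "\<forall>i\<in>J. openin (top_of_set {0..}) (A i)"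
  shows "\<Sqinter>((\<lambda>i. f i (A i)) ` J) \<in> carrier L"
  using assms by (intro inf_closed) auto

lemma boxes_closed:
  assumes "J \<subseteq> I"
  shows "{\<Sqinter>((\<lambda>i. f i (A i)) ` J) | A. (\<forall>i\<in>J. openin (top_of_set {0..}) (A i)) \<and>
            (\<forall>x. (\<forall>i\<in>J. x i \<in> A i) \<longrightarrow> (\<Sum>i\<in>J. x i) \<in> W)} \<subseteq> carrier L"
  using box_closed[OF assms] by blast

lemma locale_sum_closed: "J \<subseteq> I \<Longrightarrow> locale_sum L f J W \<in> carrier L"
  unfolding locale_sum_def by (rule sup_closed[OF boxes_closed])

lemma sums_closed: "{locale_sum L f J W | J. J \<subseteq> I \<and> finite J} \<subseteq> carrier L"
  using locale_sum_closed by blast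

text \<open>The pullback of a box lies below a finite sum, which lies below \<open>s\<close>. The
  sides of the box consist of nonnegative numbers, so only the bound by \<open>a\<close> has to be
  checked.\<close>

lemma box_le:
  assumes J: "J \<subseteq> I" "finite J" and A: "\<And>i. i \<in> J \<Longrightarrow> openin (top_of_set {0..}) (A i)"
    and w: "w \<in> carrier L" "\<And>i. i \<in> J \<Longrightarrow> w \<sqsubseteq> f i (A i)"
    and gt: "\<And>x. (\<And>i. i \<in> J \<Longrightarrow> x i \<in> A i) \<Longrightarrow> a < (\<Sum>i\<in>J. x i)"
  shows "w \<sqsubseteq> s ({0<..} \<inter> {a<..})"
proof -
  let ?b = "\<Sqinter>((\<lambda>i. f i (A i)) ` J)" and ?l = "locale_sum L f J ({0..} \<inter> {a<..})"
  have b: "?b \<in> carrier L" using J A by (intro box_closed) auto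
  have l: "?l \<in> carrier L" using J by (intro locale_sum_closed)
  have "w \<sqsubseteq> ?b" using J A w by (intro inf_greatest) auto
  also have "?b \<sqsubseteq> ?l"
    unfolding locale_sum_def
  proof (rule sup_upper[OF boxes_closed[OF J(1)]], intro CollectI exI conjI)
    show "\<forall>x. (\<forall>i\<in>J. x i \<in> A i) \<longrightarrow> (\<Sum>i\<in>J. x i) \<in> {0..} \<inter> {a<..}"
    proof (intro allI impI)
      fix x assume x: "\<forall>i\<in>J. x i \<in> A i"
      have "0 \<le> x i" if "i \<in> J" for i
        using openin_subset[OF A[OF that]] x that by auto
      then show "(\<Sum>i\<in>J. x i) \<in> {0..} \<inter> {a<..}" using gt[of x] x by (auto intro: sum_nonneg)
    qed
  qed (use A in auto)
  also have "?l \<sqsubseteq> s ({0<..} \<inter> {a<..})"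
    unfolding sum using J by (intro sup_upper[OF sums_closed]) blast
  finally show ?thesis using w(1) b l by simp
qed

text \<open>The clause \<open>a i < 0\<close> makes \<open>f i\<close> smaller than \<open>e\<close> on \<open>w\<close> for all but finitely many \<open>i\<close>.\<close>

definition level :: "real \<Rightarrow> 'l \<Rightarrow> bool" where
  "level e w \<longleftrightarrow> (\<exists>J a c d. J \<subseteq> I \<and> finite J \<and> 0 < c \<and> d < c + e \<and> d < (\<Sum>i\<in>J. a i) + e \<and>
     (\<forall>i\<in>I-J. a i < 0) \<and> w \<sqsubseteq> s ({0<..} \<inter> {c<..<d}) \<and> (\<forall>i\<in>I. w \<sqsubseteq> f i ({0..} \<inter> {a i<..<a i+e})))"

lemma level_mono:
  assumes "level e w" "e \<le> e'" "w \<in> carrier L" "w' \<in> carrier L" "w' \<sqsubseteq> w"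
  shows "level e' w'"
proof -
  obtain J a c d where *: "J \<subseteq> I" "finite J" "0 < c" "d < c + e" "d < (\<Sum>i\<in>J. a i) + e" "\<forall>i\<in>I-J. a i < 0"
    and ws: "w \<sqsubseteq> s ({0<..} \<inter> {c<..<d})" and wf: "\<And>i. i \<in> I \<Longrightarrow> w \<sqsubseteq> f i ({0..} \<inter> {a i<..<a i+e})"
    using assms(1) unfolding level_def by blast
  have "w' \<sqsubseteq> s ({0<..} \<inter> {c<..<d})" using le_trans[OF assms(5) ws] assms by simp
  moreover have "w' \<sqsubseteq> f i ({0..} \<inter> {a i<..<a i+e'})" if i: "i \<in> I" for i
  proof -
    interpret fi: real_morphism L "{0..}" "f i" by (rule f_morphism[OF i])
    have "w' \<sqsubseteq> f i ({0..} \<inter> {a i<..<a i+e})" using le_trans[OF assms(5) wf[OF i]] assms by simp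
    moreover have "f i ({0..} \<inter> {a i<..<a i+e}) \<sqsubseteq> f i ({0..} \<inter> {a i<..<a i+e'})"
      using assms(2) by (intro fi.mono_Int) auto
    ultimately show ?thesis using le_trans assms(4) by simp
  qed
  moreover have "d < c + e'" "d < (\<Sum>i\<in>J. a i) + e'" using * assms(2) by linarith+
  ultimately show ?thesis unfolding level_def using *(1,2,3,6) by blast
qed

section \<open>Density of the opens on which the partition is known up to a given error\<close>

text \<open>Intervals of length \<open>e\<close> cover the half-line, so \<open>refine_Sup\<close>
  fixes one coordinate; finitely many are fixed one after another.\<close>

lemma refine_coordinates:
  assumes J: "finite J" "J \<subseteq> I" and w: "w \<in> carrier L" "\<not> w \<sqsubseteq> v" and v: "v \<in> carrier L" and e: "0 < e"
  shows "\<exists>w'\<in>carrier L. w' \<sqsubseteq> w \<and> \<not> w' \<sqsubseteq> v \<and> (\<exists>a. \<forall>i\<in>J. w' \<sqsubseteq> f i ({0..} \<inter> {a i<..<a i+e}))"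
  using J
proof (induction J)
  case empty
  then show ?case using w le_refl by blast
next
  case (insert i J)
  then obtain w' a where w': "w' \<in> carrier L" "w' \<sqsubseteq> w" "\<not> w' \<sqsubseteq> v"
    and a: "\<forall>i\<in>J. w' \<sqsubseteq> f i ({0..} \<inter> {a i<..<a i+e})" by blast
  interpret fi: real_morphism L "{0..}" "f i" using insert.prems by (intro f_morphism) simp
  have "{0..} = (\<Union>b. {0..} \<inter> {b<..<b+e})"
  proof -
    have "x \<in> {x-e/2<..<x-e/2+e}" for x :: real using e by simp
    then show ?thesis by blast
  qed
  then have "\<top> = \<Squnion>(range (\<lambda>b. f i ({0..} \<inter> {b<..<b+e})))"
    using fi.UN[of UNIV "\<lambda>b. {0..} \<inter> {b<..<b+e}"] fi.top fi.openin_Int by simp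
  then have top: "w' \<sqsubseteq> \<Squnion>(range (\<lambda>b. f i ({0..} \<inter> {b<..<b+e})))" using top_higher w'(1) by metis
  obtain x w'' where x: "x \<in> range (\<lambda>b. f i ({0..} \<inter> {b<..<b+e}))" and w'': "w'' \<in> carrier L" "w'' \<sqsubseteq> w'" "w'' \<sqsubseteq> x" "\<not> w'' \<sqsubseteq> v"
    by (rule refine_Sup[OF _ w'(1) top v w'(3)]) auto
  obtain b where b: "x = f i ({0..} \<inter> {b<..<b+e})" using x by blast
  have "w'' \<sqsubseteq> f j ({0..} \<inter> {(a(i := b)) j<..<(a(i := b)) j+e})" if j: "j \<in> insert i J" for j
  proof (cases "j = i")
    case True
    then show ?thesis using w''(3) b by simp
  next
    case False
    then have "w' \<sqsubseteq> f j ({0..} \<inter> {a j<..<a j+e})" "j \<in> I" using a j insert.prems by auto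
    then show ?thesis using le_trans[OF w''(2)] w'' w' False by (simp add: openin_open_Int)
  qed
  moreover have "w'' \<sqsubseteq> w" using le_trans[OF w''(2) w'(2)] w'' w w' by simp
  ultimately show ?case using w'' by blast
qed

text \<open>By distributivity \<open>w\<close> is the join of its meets with the two pullbacks, and
  the second meet is empty.\<close>

lemma le_of_cover:
  assumes i: "i \<in> I" and w: "w \<in> carrier L" and AB: "openin (top_of_set {0..}) A" "openin (top_of_set {0..}) B"
    and un: "A \<union> B = {0..}" and bot: "w \<sqinter> f i B = \<bottom>"
  shows "w \<sqsubseteq> f i A"
proof (rule ccontr)
  interpret fi: real_morphism L "{0..}" "f i" by (rule f_morphism[OF i])
  assume nle: "\<not> ?thesis"
  have "\<top> = \<Squnion>{f i A, f i B}" using fi.Sup[of "{A, B}"] fi.top un AB by auto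
  then have top: "w \<sqsubseteq> \<Squnion>{f i A, f i B}" using top_higher w by metis
  obtain x w' where x: "x \<in> {f i A, f i B}" and w': "w' \<in> carrier L" "w' \<sqsubseteq> w" "w' \<sqsubseteq> x" "\<not> w' \<sqsubseteq> f i A"
    by (rule refine_Sup[OF _ w top _ nle]) (use AB i in auto)
  then have "w' \<sqsubseteq> w \<sqinter> f i B" using w AB by (auto simp: le_meet_iff)
  then show False using w'(1,4) bot AB le_bottom_iff bottom_lower by auto
qed

text \<open>Successive refinements confine the sum to a short interval above \<open>c\<close>, pick
  a finite \<open>J\<close> whose partial sum exceeds \<open>c\<close>, and localise the coordinates
  in \<open>J\<close>. The remaining coordinates then need no further refinement: any of them that
  was large would push the sum out of its interval.\<close>

lemma dense_level:
  assumes w: "w \<in> carrier L" "\<not> w \<sqsubseteq> v" and v: "v \<in> carrier L" and e: "0 < e"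
  shows "\<exists>w'\<in>carrier L. w' \<sqsubseteq> w \<and> \<not> w' \<sqsubseteq> v \<and> level e w'"
proof -
  \<comment> \<open>The estimate for indices outside \<open>J\<close> needs
    \<open>2 * k < e / 2\<close>; the other errors are of order \<open>k\<close> and fit below
    \<open>e\<close> as well.\<close>
  define k where "k = e / 8"
  have k: "0 < k" using e unfolding k_def by simp
  have "{0<..} = (\<Union>c\<in>{0<..}. {0<..} \<inter> {c<..<c+k})"
  proof -
    \<comment> \<open>This left endpoint is within \<open>k\<close> of \<open>x\<close> and yet
      positive, as \<open>level\<close> demands of \<open>c\<close>.\<close>
    have "max (x/2) (x - k/2) \<in> {0<..}" "x \<in> {max (x/2) (x - k/2)<..<max (x/2) (x - k/2)+k}" if "0 < x" for x
      using that k by (auto simp: max_def)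
    then show ?thesis by blast
  qed
  then have "\<top> = \<Squnion>((\<lambda>c. s ({0<..} \<inter> {c<..<c+k})) ` {0<..})"
    using s.UN[of "{0<..}" "\<lambda>c. {0<..} \<inter> {c<..<c+k}"] s.top s.openin_Int by simp
  then have top: "w \<sqsubseteq> \<Squnion>((\<lambda>c. s ({0<..} \<inter> {c<..<c+k})) ` {0<..})" using top_higher w(1) by metis
  obtain x w1 where x: "x \<in> (\<lambda>c. s ({0<..} \<inter> {c<..<c+k})) ` {0<..}"
    and w1: "w1 \<in> carrier L" "w1 \<sqsubseteq> w" "w1 \<sqsubseteq> x" "\<not> w1 \<sqsubseteq> v"
    by (rule refine_Sup[OF _ w(1) top v w(2)]) auto
  obtain c where c: "0 < c" "x = s ({0<..} \<inter> {c<..<c+k})" using x by auto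
  have "s ({0<..} \<inter> {c<..<c+k}) \<sqsubseteq> s ({0<..} \<inter> {c<..})" by (intro s.mono_Int) auto
  then have w1s: "w1 \<sqsubseteq> \<Squnion>{locale_sum L f J ({0..} \<inter> {c<..}) | J. J \<subseteq> I \<and> finite J}"
    using le_trans[OF w1(3)] w1(1) c unfolding sum[symmetric] by simp
  obtain y w2 where y: "y \<in> {locale_sum L f J ({0..} \<inter> {c<..}) | J. J \<subseteq> I \<and> finite J}"
    and w2: "w2 \<in> carrier L" "w2 \<sqsubseteq> w1" "w2 \<sqsubseteq> y" "\<not> w2 \<sqsubseteq> v"
    by (rule refine_Sup[OF sums_closed w1(1) w1s v w1(4)])
  obtain J where J: "J \<subseteq> I" "finite J" "y = locale_sum L f J ({0..} \<inter> {c<..})" using y by blast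
  obtain z w3 where z: "z \<in> {\<Sqinter>((\<lambda>i. f i (A i)) ` J) | A. (\<forall>i\<in>J. openin (top_of_set {0..}) (A i)) \<and>
            (\<forall>x. (\<forall>i\<in>J. x i \<in> A i) \<longrightarrow> (\<Sum>i\<in>J. x i) \<in> {0..} \<inter> {c<..})}"
    and w3: "w3 \<in> carrier L" "w3 \<sqsubseteq> w2" "w3 \<sqsubseteq> z" "\<not> w3 \<sqsubseteq> v"
    by (rule refine_Sup[OF boxes_closed[OF J(1)] w2(1) w2(3)[unfolded J(3) locale_sum_def] v w2(4)])
  obtain A where A: "z = \<Sqinter>((\<lambda>i. f i (A i)) ` J)" "\<And>i. i \<in> J \<Longrightarrow> openin (top_of_set {0..}) (A i)"
    "\<And>x. (\<forall>i\<in>J. x i \<in> A i) \<Longrightarrow> c < (\<Sum>i\<in>J. x i)"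
    using z by auto
  \<comment> \<open>The errors of all coordinates in \<open>J\<close> together amount to at most
    \<open>k\<close>.\<close>
  define \<delta> where "\<delta> = k / (card J + 1)"
  have \<delta>: "0 < \<delta>" "card J * \<delta> \<le> k" "\<delta> \<le> e" using k unfolding \<delta>_def k_def by (auto simp: field_simps)
  obtain w' a where w': "w' \<in> carrier L" "w' \<sqsubseteq> w3" "\<not> w' \<sqsubseteq> v"
    and a: "\<And>i. i \<in> J \<Longrightarrow> w' \<sqsubseteq> f i ({0..} \<inter> {a i<..<a i+\<delta>})"
    using refine_coordinates[OF J(2,1) w3(1,4) v \<delta>(1)] by blast
  have "w' \<sqsubseteq> w2" using le_trans[OF w'(2) w3(2)] w' w3 w2 by simp
  then have w'1: "w' \<sqsubseteq> w1" using le_trans[OF _ w2(2)] w' w2 w1 by simp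
  then have w'w: "w' \<sqsubseteq> w" using le_trans[OF _ w1(2)] w' w w1 by simp
  have w's: "w' \<sqsubseteq> s ({0<..} \<inter> {c<..<c+k})" using le_trans[OF w'1 w1(3)] w' w1 c by simp
  have w'z: "w' \<sqsubseteq> z" using le_trans[OF w'(2) w3(3)] w' w3 box_closed[OF J(1)] A by simp
  have boxes: "(\<lambda>i. f i (A i)) ` J \<subseteq> carrier L" using A(2) J(1) f_closed by blast
  have w'A: "w' \<sqsubseteq> f i (A i)" if "i \<in> J" for i
    using w'z le_Inf_iff[OF boxes w'(1)] that unfolding A(1) by blast
  \<comment> \<open>Both sets have pullbacks above \<open>w'\<close>, which is not the bottom, so
    they intersect. Numbers in the intersections compare the left endpoints \<open>a i\<close> with
    the bound \<open>c\<close> valid on the box.\<close>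
  have "\<exists>x. x \<in> A i \<inter> ({0..} \<inter> {a i<..<a i+\<delta>})" if i: "i \<in> J" for i
  proof (rule ccontr)
    interpret fi: real_morphism L "{0..}" "f i" using J i by (intro f_morphism) auto
    assume "\<not> ?thesis"
    then have "A i \<inter> ({0..} \<inter> {a i<..<a i+\<delta>}) = {}" by blast
    then have "f i (A i) \<sqinter> f i ({0..} \<inter> {a i<..<a i+\<delta>}) = \<bottom>"
      using fi.meet[OF A(2)[OF i] fi.openin_Int[of "{a i<..<a i+\<delta>}"]] fi.bottom by simp
    then have "w' \<sqsubseteq> \<bottom>" using w'A[OF i] a[OF i] w'(1) A(2)[OF i] le_meet_iff[of "f i (A i)" "f i ({0..} \<inter> {a i<..<a i+\<delta>})" w'] by simp
    then show False using w'(1,3) le_trans[OF _ bottom_lower[OF v]] v by simp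
  qed
  then obtain x where x: "\<And>i. i \<in> J \<Longrightarrow> x i \<in> A i" "\<And>i. i \<in> J \<Longrightarrow> x i < a i + \<delta>"
    by (metis IntD1 IntD2 greaterThanLessThan_iff)
  have "c < (\<Sum>i\<in>J. x i)" using A(3) x(1) by blast
  also have "\<dots> \<le> (\<Sum>i\<in>J. a i + \<delta>)" using x(2) by (intro sum_mono) (auto intro: less_imp_le)
  also have "\<dots> = (\<Sum>i\<in>J. a i) + card J * \<delta>" by (simp add: sum.distrib)
  finally have suma: "c - k < (\<Sum>i\<in>J. a i)" using \<delta>(2) by linarith
  \<comment> \<open>For the other indices the interval from \<open>- e / 2\<close> to
    \<open>e / 2\<close> has length \<open>e\<close> and a negative left endpoint, as
    \<open>level\<close> requires; on the half-line it says that the value is below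
    \<open>e / 2\<close>.\<close>
  define b where "b i = (if i \<in> J then a i else - e / 2)" for i
  have "w' \<sqsubseteq> f i ({0..} \<inter> {b i<..<b i+e})" if i: "i \<in> I" for i
  proof -
    interpret fi: real_morphism L "{0..}" "f i" by (rule f_morphism[OF i])
    show ?thesis
    proof (cases "i \<in> J")
      case True
      have "f i ({0..} \<inter> {a i<..<a i+\<delta>}) \<sqsubseteq> f i ({0..} \<inter> {b i<..<b i+e})"
        using \<delta>(3) True unfolding b_def by (intro fi.mono_Int) auto
      then show ?thesis using le_trans[OF a[OF True]] w'(1) by simp
    next
      case False
      \<comment> \<open>On the part \<open>?u\<close> where \<open>f i\<close> exceeds
        \<open>2 * k\<close>, the sum over \<open>insert i J\<close> exceeds
        \<open>(c - k) + 2 * k = c + k\<close>, against the upper bound on \<open>s\<close>. Hence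
        \<open>?u\<close> is empty.\<close>
      let ?B = "{0..} \<inter> {2*k<..}"
      define B where "B j = {0..} \<inter> (if j = i then {2*k<..} else {a j<..})" for j
      let ?u = "w' \<sqinter> f i ?B"
      have u: "?u \<in> carrier L" "?u \<sqsubseteq> w'" "?u \<sqsubseteq> f i ?B" using w'(1) meet_left meet_right by auto
      have "?u \<sqsubseteq> s ({0<..} \<inter> {c+k<..})"
      proof (rule box_le[of "insert i J" B])
        fix j assume j: "j \<in> insert i J"
        show "openin (top_of_set {0..}) (B j)" unfolding B_def by (simp add: openin_open_Int)
        show "?u \<sqsubseteq> f j (B j)"
        proof (cases "j = i")
          case True
          then show ?thesis using u(3) unfolding B_def by simp
        next
          case False
          then have j': "j \<in> J" using j by simp
          interpret fj: real_morphism L "{0..}" "f j" using J j' by (intro f_morphism) auto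
          have "f j ({0..} \<inter> {a j<..<a j+\<delta>}) \<sqsubseteq> f j ({0..} \<inter> {a j<..})" by (intro fj.mono_Int) auto
          then have "w' \<sqsubseteq> f j ({0..} \<inter> {a j<..})" using le_trans[OF a[OF j']] w'(1) by simp
          then show ?thesis using le_trans[OF u(2)] u(1) w'(1) False unfolding B_def by simp
        qed
      next
        fix x assume x: "\<And>j. j \<in> insert i J \<Longrightarrow> x j \<in> B j"
        have "a j \<le> x j" if "j \<in> J" for j using x[of j] that False unfolding B_def by (auto split: if_splits)
        then have "(\<Sum>j\<in>J. a j) \<le> (\<Sum>j\<in>J. x j)" by (rule sum_mono)
        moreover have "2*k < x i" using x[of i] unfolding B_def by auto
        ultimately show "c + k < (\<Sum>j\<in>insert i J. x j)" using suma J(2) False by simp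
      qed (use J i u in auto)
      moreover have "?u \<sqsubseteq> s ({0<..} \<inter> {c<..<c+k})" using le_trans[OF u(2) w's] u(1) w'(1) by simp
      ultimately have "?u \<sqsubseteq> s ({0<..} \<inter> {c+k<..}) \<sqinter> s ({0<..} \<inter> {c<..<c+k})"
        using u(1) by (simp add: le_meet_iff)
      also have "\<dots> = s ({0<..} \<inter> {c+k<..} \<inter> ({0<..} \<inter> {c<..<c+k}))"
        by (rule s.meet[symmetric]) (auto intro: s.openin_Int)
      also have "{0<..} \<inter> {c+k<..} \<inter> ({0<..} \<inter> {c<..<c+k}) = {}" by auto
      finally have "?u = \<bottom>" using s.bottom u(1) le_bottom_iff by simp
      then have "w' \<sqsubseteq> f i ({0..} \<inter> {-e/2<..<-e/2+e})"
        using k by (intro le_of_cover[OF i w'(1) _ _ _ \<open>?u = \<bottom>\<close>]) (auto simp: openin_open_Int k_def)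
      then show ?thesis using False unfolding b_def by simp
    qed
  qed
  moreover have "(\<Sum>i\<in>J. b i) = (\<Sum>i\<in>J. a i)" unfolding b_def by simp
  then have "c + k < (\<Sum>i\<in>J. b i) + e" "c + k < c + e" using suma k unfolding k_def by auto
  moreover have "\<forall>i\<in>I-J. b i < 0" using e unfolding b_def by auto
  ultimately have "level e w'" unfolding level_def using J(1,2) c(1) w's by blast
  then show ?thesis using w' w'w by blast
qed

section \<open>Evaluation of a partition at generic filters\<close>

definition generic :: "'l set \<Rightarrow> bool" where
  "generic p \<longleftrightarrow> proper_filter p \<and> (\<forall>e>0. \<exists>w\<in>p. level e w)"

lemma generic_proper: "generic p \<Longrightarrow> proper_filter p"
  unfolding generic_def by blast

lemma genericI:
  assumes p: "proper_filter p" and ev: "\<And>e. 0 < e \<Longrightarrow> \<exists>e'\<le>e. \<exists>w\<in>p. level e' w"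
  shows "generic p"
  unfolding generic_def
proof (intro conjI p allI impI)
  fix e :: real assume "0 < e"
  then obtain e' w where "e' \<le> e" "w \<in> p" "level e' w" using ev by blast
  then show "\<exists>w\<in>p. level e w" using level_mono[of e' w e w] proper_filterD(1)[OF p] le_refl by blast
qed

lemma generic_level:
  assumes p: "generic p" and e: "0 < e"
  obtains J a c d where "J \<subseteq> I" "finite J" "0 < c" "d < c + e" "d < (\<Sum>i\<in>J. a i) + e"
    "s ({0<..} \<inter> {c<..<d}) \<in> p" "\<And>i. i \<in> I \<Longrightarrow> f i ({0..} \<inter> {a i<..<a i+e}) \<in> p"
proof -
  obtain w where w: "w \<in> p" "level e w" and pf: "proper_filter p" using p e unfolding generic_def by blast
  have "x \<in> p" if "w \<sqsubseteq> x" "x \<in> carrier L" for x using proper_filterD(5)[OF pf w(1)] that by blast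
  then show thesis using w(2) that unfolding level_def by (auto simp: openin_open_Int)
qed

lemma decides_f:
  assumes p: "generic p" and i: "i \<in> I"
  shows "real_morphism.decides L {0..} (f i) p"
  unfolding real_morphism.decides_def[OF f_morphism[OF i]]
  using p i generic_level[OF p] unfolding generic_def by metis

lemma decides_s:
  assumes p: "generic p"
  shows "s.decides p"
  unfolding s.decides_def
proof (intro conjI allI impI)
  show "proper_filter p" using p unfolding generic_def by blast
  fix e :: real assume "0 < e"
  then obtain c d where cd: "d < c + e" "s ({0<..} \<inter> {c<..<d}) \<in> p" using generic_level[OF p] by metis
  have "s ({0<..} \<inter> {c<..<c+e}) \<in> p"
    using cd(1) by (intro s.mem_mono[OF generic_proper[OF p] _ _ cd(2)]) auto
  then show "\<exists>a. s ({0<..} \<inter> {a<..<a+e}) \<in> p" by blast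
qed

abbreviation coordinate :: "'i \<Rightarrow> 'l set \<Rightarrow> real" where
  "coordinate i p \<equiv> filter_value {0..} (f i) p"

abbreviation mass :: "'l set \<Rightarrow> real" where
  "mass p \<equiv> filter_value {0<..} s p"

lemma coordinate_nonneg:
  assumes p: "generic p" and i: "i \<in> I"
  shows "0 \<le> coordinate i p"
proof (rule ccontr)
  interpret fi: real_morphism L "{0..}" "f i" by (rule f_morphism[OF i])
  let ?x = "coordinate i p"
  assume "\<not> ?thesis"
  \<comment> \<open>For negative \<open>?x\<close> this radius makes the interval end at 0, so it
    misses the half-line.\<close>
  then have "f i ({0..} \<inter> {?x-(-?x)<..<?x+(-?x)}) \<in> p" by (intro fi.filter_value decides_f p i) simp
  moreover have "{0..} \<inter> {?x-(-?x)<..<?x+(-?x)} = {}" by auto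
  ultimately show False using fi.bottom p proper_filterD(3) unfolding generic_def by metis
qed

text \<open>The clause \<open>0 < c\<close> of \<open>level\<close> bounds the sum away from 0; a
  limit of positive numbers could otherwise vanish.\<close>

lemma mass_pos:
  assumes p: "generic p"
  shows "0 < mass p"
proof -
  obtain c d where cd: "0 < c" "s ({0<..} \<inter> {c<..<d}) \<in> p" using generic_level[OF p zero_less_one] by metis
  have "s ({0<..} \<inter> {c<..}) \<in> p"
    by (rule s.mem_mono[OF generic_proper[OF p] _ _ cd(2)]) auto
  then show ?thesis using s.filter_value_ge[OF decides_s[OF p]] cd(1) by fastforce
qed

text \<open>Small intervals around finitely many coordinates form a box in the filter, and
  \<open>box_le\<close> turns it into a lower bound for the mass.\<close>

lemma sum_coordinates_le:
  assumes p: "generic p" and J: "J \<subseteq> I" "finite J"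
  shows "(\<Sum>i\<in>J. coordinate i p) \<le> mass p"
proof (rule ccontr)
  assume "\<not> ?thesis"
  then obtain g where g: "0 < g" "(\<Sum>i\<in>J. coordinate i p) - mass p = g" by simp
  \<comment> \<open>Widening all coordinates by this amount costs at most half of the supposed
    excess \<open>g\<close>.\<close>
  define \<delta> where "\<delta> = g / (2 * (real (card J) + 1))"
  have "(card J + 1) * \<delta> = g / 2" unfolding \<delta>_def by (simp add: field_simps)
  then have \<delta>: "0 < \<delta>" "(card J + 1) * \<delta> < (\<Sum>i\<in>J. coordinate i p) - mass p"
  proof -
    show "0 < \<delta>" using g(1) unfolding \<delta>_def by (intro divide_pos_pos) auto
    show "(card J + 1) * \<delta> < (\<Sum>i\<in>J. coordinate i p) - mass p"
      using g \<open>(card J + 1) * \<delta> = g / 2\<close> by linarith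
  qed
  note pf = generic_proper[OF p]
  let ?A = "\<lambda>i. {0..} \<inter> {coordinate i p - \<delta><..<coordinate i p + \<delta>}"
  let ?a = "(\<Sum>i\<in>J. coordinate i p) - (card J + 1) * \<delta>"
  have mem: "f i (?A i) \<in> p" if "i \<in> J" for i
    using real_morphism.filter_value[OF f_morphism decides_f[OF p] \<delta>(1)] J that by blast
  then have w: "\<Sqinter>((\<lambda>i. f i (?A i)) ` J) \<in> p" using J by (intro proper_filter_Inf[OF pf]) auto
  have "\<Sqinter>((\<lambda>i. f i (?A i)) ` J) \<sqsubseteq> s ({0<..} \<inter> {?a<..})"
  proof (rule box_le[OF J])
    show "openin (top_of_set {0..}) (?A i)" for i by (simp add: openin_open_Int)
    show "\<Sqinter>((\<lambda>i. f i (?A i)) ` J) \<in> carrier L" using w proper_filterD(1)[OF pf] by blast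
    show "\<Sqinter>((\<lambda>i. f i (?A i)) ` J) \<sqsubseteq> f i (?A i)" if "i \<in> J" for i
      using that mem proper_filterD(1)[OF pf] by (intro inf_lower) auto
    fix x assume x: "\<And>i. i \<in> J \<Longrightarrow> x i \<in> ?A i"
    have "(\<Sum>i\<in>J. coordinate i p - \<delta>) \<le> (\<Sum>i\<in>J. x i)" using x by (intro sum_mono) force
    then show "?a < (\<Sum>i\<in>J. x i)" using \<delta>(1) by (simp add: sum_subtractf distrib_right)
  qed
  then have "s ({0<..} \<inter> {?a<..}) \<in> p" using proper_filterD(5)[OF pf w] by simp
  then have "?a \<le> mass p" by (rule s.filter_value_ge[OF decides_s[OF p]])
  then show False using \<delta>(2) by linarith
qed

text \<open>No mass is lost in the limit, thanks to the clause of \<open>level\<close> by which the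
  left endpoints over a finite \<open>J\<close> reach the upper bound \<open>d\<close> up to
  \<open>e\<close>.\<close>

lemma has_sum_coordinates:
  assumes p: "generic p"
  shows "((\<lambda>i. coordinate i p) has_sum mass p) I"
proof -
  have summ: "(\<lambda>i. coordinate i p) summable_on I"
    using sum_coordinates_le[OF p] coordinate_nonneg[OF p]
    by (intro nonneg_bdd_above_summable_on bdd_aboveI[of _ "mass p"]) auto
  have "(\<Sum>\<^sub>\<infinity>i\<in>I. coordinate i p) \<le> mass p"
    using sum_coordinates_le[OF p] by (intro infsum_le_finite_sums[OF summ]) auto
  moreover have "mass p \<le> (\<Sum>\<^sub>\<infinity>i\<in>I. coordinate i p)"
  proof (rule field_le_epsilon)
    fix e :: real assume e: "0 < e"
    obtain J a c d where J: "J \<subseteq> I" "finite J" "d < (\<Sum>i\<in>J. a i) + e" and sp: "s ({0<..} \<inter> {c<..<d}) \<in> p"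
      and fp: "\<And>i. i \<in> I \<Longrightarrow> f i ({0..} \<inter> {a i<..<a i+e}) \<in> p"
      using generic_level[OF p e] by metis
    note pf = generic_proper[OF p]
    have "s ({0<..} \<inter> {..<d}) \<in> p" by (rule s.mem_mono[OF pf _ _ sp]) auto
    then have "mass p \<le> d" by (rule s.filter_value_le[OF decides_s[OF p]])
    also have "\<dots> \<le> (\<Sum>i\<in>J. a i) + e" using J(3) by simp
    also have "(\<Sum>i\<in>J. a i) \<le> (\<Sum>i\<in>J. coordinate i p)"
    proof (rule sum_mono)
      fix i assume "i \<in> J"
      then have i: "i \<in> I" using J(1) by blast
      interpret fi: real_morphism L "{0..}" "f i" by (rule f_morphism[OF i])
      have "f i ({0..} \<inter> {a i<..}) \<in> p" by (rule fi.mem_mono[OF pf _ _ fp[OF i]]) auto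
      then show "a i \<le> coordinate i p" by (rule fi.filter_value_ge[OF decides_f[OF p i]])
    qed
    also have "(\<Sum>i\<in>J. coordinate i p) \<le> (\<Sum>\<^sub>\<infinity>i\<in>I. coordinate i p)"
      using J coordinate_nonneg[OF p] by (intro finite_sum_le_infsum[OF summ]) auto
    finally show "mass p \<le> (\<Sum>\<^sub>\<infinity>i\<in>I. coordinate i p) + e" by simp
  qed
  ultimately show ?thesis using has_sum_infsum[OF summ] by simp
qed

text \<open>The converse may fail, since a filter can contain \<open>f i {0<..}\<close> and still
  have coordinate 0. This direction suffices to place the pulled-back supports inside the
  cover.\<close>

lemma coordinate_posD:
  assumes p: "generic p" and i: "i \<in> I" and pos: "0 < coordinate i p"
  shows "f i {0<..} \<in> p"
proof -
  interpret fi: real_morphism L "{0..}" "f i" by (rule f_morphism[OF i])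
  note pf = generic_proper[OF p]
  obtain b where b: "0 < b" "f i ({0..} \<inter> {b<..}) \<in> p"
    using fi.less_filter_value_iff[OF decides_f[OF p i]] pos by blast
  then have "f i ({0..} \<inter> {0<..}) \<in> p" by (intro fi.mem_mono[OF pf _ _ b(2)]) auto
  moreover have "{0..} \<inter> {0::real<..} = {0<..}" by auto
  ultimately show ?thesis by simp
qed

lemma numerable_coordinates:
  assumes P: "\<And>y. y \<in> topspace Y \<Longrightarrow> generic (P y)"
    and op: "\<And>u. u \<in> carrier L \<Longrightarrow> openin Y {y \<in> topspace Y. u \<in> P y}"
  shows "numerable Y I (\<lambda>i. {y \<in> topspace Y. 0 < coordinate i (P y)})"
proof -
  have part: "positive_partition Y I (\<lambda>i y. coordinate i (P y))"
  proof (rule positive_partitionI[OF _ _ has_sum_coordinates[OF P]])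
    show "continuous_map Y euclideanreal (\<lambda>y. coordinate i (P y))" if "i \<in> I" for i
      using real_morphism.continuous_map_filter_value[OF f_morphism[OF that] decides_f[OF P that] op] .
    show "continuous_map Y euclideanreal (\<lambda>y. mass (P y))"
      using s.continuous_map_filter_value[OF decides_s[OF P] op] .
  qed (use coordinate_nonneg[OF P] mass_pos[OF P] in auto)
  have "\<exists>i\<in>I. 0 < coordinate i (P y)" if "y \<in> topspace Y" for y
  proof (rule ccontr)
    assume "\<not> ?thesis"
    then have "coordinate i (P y) = 0" if "i \<in> I" for i
      using coordinate_nonneg[OF P[OF \<open>y \<in> topspace Y\<close>] that] that by force
    then show False using positive_partitionD(5)[OF part that] by (simp add: infsum_0)
  qed
  then have "open_cover Y I (\<lambda>i. {y \<in> topspace Y. 0 < coordinate i (P y)})"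
    unfolding open_cover_def using openin_superlevel[OF positive_partitionD(1)[OF part]] by auto
  then show ?thesis unfolding numerable_def using part by blast
qed

end

lemma locale_positive_partitionE:
  assumes "locale_positive_partition L I f" "frame L"
  obtains s where "locale_partition L I f s"
  using assms unfolding locale_positive_partition_def locale_partition_def locale_partition_axioms_def by blast

section \<open>Numerable covers of locales\<close>

lemma (in frame) separating_filtersI:
  fixes R :: "nat \<Rightarrow> 'a \<Rightarrow> bool"
  assumes dense: "\<And>n v w. v \<in> carrier L \<Longrightarrow> w \<in> carrier L \<Longrightarrow> \<not> w \<sqsubseteq> v \<Longrightarrow>
      \<exists>w'\<in>carrier L. w' \<sqsubseteq> w \<and> \<not> w' \<sqsubseteq> v \<and> R n w'"
    and uv: "u \<in> carrier L" "v \<in> carrier L" "\<not> u \<sqsubseteq> v"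
  shows "\<exists>p\<in>{p. proper_filter p \<and> (\<forall>n. \<exists>w\<in>p. R n w)}. u \<in> p \<and> v \<notin> p"
proof (rule rasiowa_sikorski[where R = R, OF uv dense[OF uv(2)]])
  fix p assume "proper_filter p" "u \<in> p" "v \<notin> p" and R: "\<And>n. \<exists>w\<in>p. R n w"
  moreover have "\<forall>n. \<exists>w\<in>p. R n w" using R by (rule allI)
  ultimately show ?thesis by blast
qed

lemma (in locale_partition) generic_if_levels:
  assumes "proper_filter p" "\<And>n. \<exists>w\<in>p. level (1 / Suc n) w"
  shows "generic p"
proof (rule genericI[OF assms(1)])
  fix e :: real assume "0 < e"
  then obtain n where "1 / Suc n < e" using nat_approx_posE by metis
  then show "\<exists>e'\<le>e. \<exists>w\<in>p. level e' w" using assms(2)[of n] by (meson less_imp_le)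
qed

text \<open>The reduction to spaces. The opens \<open>U i\<close> are in general not pulled back
  from the space of filters; the pullback of a numerable cover merely refines them index by
  index.\<close>

lemma locale_numerableE:
  fixes L :: "'l gorder"
  assumes "locale_numerable L I U"
  obtains X :: "'l set topology" and h W
  where "spatial_morphism L X h" "numerable X I W" "\<And>i. i \<in> I \<Longrightarrow> h (W i) \<sqsubseteq>\<^bsub>L\<^esub> U i"
    "\<And>i. i \<in> I \<Longrightarrow> U i \<in> carrier L" "frame L"
proof -
  obtain f where f: "locale_positive_partition L I f" and fU: "\<And>i. i \<in> I \<Longrightarrow> f i {0<..} \<sqsubseteq>\<^bsub>L\<^esub> U i"
    and L: "frame L" and U: "\<And>i. i \<in> I \<Longrightarrow> U i \<in> carrier L"
    using assms unfolding locale_numerable_def locale_open_cover_def by blast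
  obtain s where "locale_partition L I f s" using locale_positive_partitionE[OF f L] .
  then interpret locale_partition L I f s .
  define Q where "Q = {p. proper_filter p \<and> (\<forall>n. \<exists>w\<in>p. level (1 / Suc n) w)}"
  interpret separating_filters L Q
  proof
    show "proper_filter p" if "p \<in> Q" for p using that unfolding Q_def by blast
    show "\<exists>p\<in>Q. u \<in> p \<and> v \<notin> p" if "u \<in> carrier L" "v \<in> carrier L" "\<not> u \<sqsubseteq>\<^bsub>L\<^esub> v" for u v
      unfolding Q_def 
      by (rule separating_filtersI[OF _ that]) (rule dense_level, auto)
  qed
  have gen: "generic p" if "p \<in> Q" for p
    using that unfolding Q_def by (intro generic_if_levels) auto
  let ?W = "\<lambda>i. {p \<in> Q. 0 < coordinate i p}"
  have num: "numerable (filter_space Q) I ?W"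
    using numerable_coordinates[of "filter_space Q" "\<lambda>p. p"] gen openin_basic by simp
  have le: "open_of (?W i) \<sqsubseteq>\<^bsub>L\<^esub> U i" if i: "i \<in> I" for i
  proof -
    have "openin (top_of_set {0..}) ({0..} \<inter> {0::real<..})" by (simp add: openin_open_Int)
    moreover have "{0..} \<inter> {0::real<..} = {0<..}" by auto
    ultimately have c: "f i {0<..} \<in> carrier L" using f_closed[OF i] by simp
    then have "open_of (?W i) \<sqsubseteq>\<^bsub>L\<^esub> f i {0<..}"
      using coordinate_posD[OF gen i] by (intro open_of_le) auto
    then show ?thesis using le_trans[OF _ fU[OF i]] c U[OF i] by simp
  qed
  show thesis by (rule that[OF spatial_morphism_open_of num le U L])
qed

text \<open>Since \<open>V\<close> does not come from the space, the cover \<open>W\<close> of the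
  space is regrouped along the choice \<open>r\<close> instead, and its coarsening \<open>W'\<close>
  is pulled back.\<close>

lemma locale_numerable_coarsening:
  fixes L :: "'l gorder"
  assumes num: "locale_numerable L I U" and cov: "locale_open_cover L J V"
    and ref: "\<forall>i\<in>I. \<exists>j\<in>J. U i \<sqsubseteq>\<^bsub>L\<^esub> V j"
  shows "locale_numerable L J V"
proof -
  obtain X :: "'l set topology" and h W where "spatial_morphism L X h" and W: "numerable X I W"
    and le: "\<And>i. i \<in> I \<Longrightarrow> h (W i) \<sqsubseteq>\<^bsub>L\<^esub> U i" and U: "\<And>i. i \<in> I \<Longrightarrow> U i \<in> carrier L"
    and "frame L"
    by (rule locale_numerableE[OF num]) (rule that)
  then interpret spatial_morphism L X h by blast
  obtain r where r: "\<And>i. i \<in> I \<Longrightarrow> r i \<in> J \<and> U i \<sqsubseteq>\<^bsub>L\<^esub> V (r i)" using ref by metis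
  have V: "V j \<in> carrier L" if "j \<in> J" for j using cov that unfolding locale_open_cover_def by blast
  define W' where "W' j = (\<Union>i\<in>{i \<in> I. r i = j}. W i)" for j
  have opW: "openin X (W i)" if "i \<in> I" for i
    using W that unfolding numerable_def open_cover_def by blast
  have "openin X (W' j)" for j unfolding W'_def using opW by blast
  moreover have "(\<Union>j\<in>J. W' j) = (\<Union>i\<in>I. W i)" unfolding W'_def using r by blast
  ultimately have "open_cover X J W'" using W unfolding numerable_def open_cover_def by simp
  then have "numerable X J W'"
    by (rule numerable_coarsening[OF W]) (use r in \<open>auto simp: W'_def\<close>)
  then show ?thesis
  proof (rule locale_numerableI[OF _ V])
    fix j assume j: "j \<in> J"
    have "h (W' j) = \<Squnion>\<^bsub>L\<^esub>((\<lambda>i. h (W i)) ` {i \<in> I. r i = j})"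
      unfolding W'_def using opW by (intro UN) auto
    also have "\<dots> \<sqsubseteq>\<^bsub>L\<^esub> V j"
    proof (rule sup_least)
      fix w assume "w \<in> (\<lambda>i. h (W i)) ` {i \<in> I. r i = j}"
      then obtain i where i: "i \<in> I" "r i = j" "w = h (W i)" by blast
      have "U i \<sqsubseteq>\<^bsub>L\<^esub> V j" using r[OF i(1)] i(2) by blast
      then show "w \<sqsubseteq>\<^bsub>L\<^esub> V j" using le_trans[OF le[OF i(1)]] U[OF i(1)] V[OF j] opW[OF i(1)] i(3) by simp
    qed (use opW V[OF j] in auto)
    finally show "h (W' j) \<sqsubseteq>\<^bsub>L\<^esub> V j" .
  qed
qed

text \<open>No partition is given here, so the filters are those that contain some member of the
  cover. Proper filters contain at most one member of a disjoint family, which makes the resulting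
  cover of the space disjoint.\<close>

lemma locale_numerable_disjoint:
  fixes L :: "'l gorder"
  assumes cov: "locale_open_cover L I U"
    and dis: "\<forall>i\<in>I. \<forall>j\<in>I. i \<noteq> j \<longrightarrow> U i \<sqinter>\<^bsub>L\<^esub> U j = \<bottom>\<^bsub>L\<^esub>"
  shows "locale_numerable L I U"
proof -
  interpret frame L using cov unfolding locale_open_cover_def by blast
  have U: "\<And>i. i \<in> I \<Longrightarrow> U i \<in> carrier L" and top: "\<Squnion>\<^bsub>L\<^esub>(U ` I) = \<top>\<^bsub>L\<^esub>"
    using cov unfolding locale_open_cover_def by blast+
  \<comment> \<open>There is only one demand, so \<open>n\<close> is a dummy parameter.\<close>
  define R where "R = (\<lambda>(n::nat) w. \<exists>i\<in>I. w \<sqsubseteq>\<^bsub>L\<^esub> U i)"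
  define Q where "Q = {p. proper_filter p \<and> (\<forall>n. \<exists>w\<in>p. R n w)}"
  interpret separating_filters L Q
  proof
    show "proper_filter p" if "p \<in> Q" for p using that unfolding Q_def by blast
    show "\<exists>p\<in>Q. u \<in> p \<and> v \<notin> p" if "u \<in> carrier L" "v \<in> carrier L" "\<not> u \<sqsubseteq>\<^bsub>L\<^esub> v" for u v
      unfolding Q_def
    proof (rule separating_filtersI[OF _ that])
      fix v w assume vw: "v \<in> carrier L" "w \<in> carrier L" "\<not> w \<sqsubseteq>\<^bsub>L\<^esub> v"
      have le: "w \<sqsubseteq>\<^bsub>L\<^esub> \<Squnion>\<^bsub>L\<^esub>(U ` I)" using top_higher vw(2) top by simp
      obtain x w' where "x \<in> U ` I" "w' \<in> carrier L" "w' \<sqsubseteq>\<^bsub>L\<^esub> w" "w' \<sqsubseteq>\<^bsub>L\<^esub> x" "\<not> w' \<sqsubseteq>\<^bsub>L\<^esub> v"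
        by (rule refine_Sup[OF _ vw(2) le vw(1,3)]) (use U in auto)
      then show "\<exists>w'\<in>carrier L. w' \<sqsubseteq>\<^bsub>L\<^esub> w \<and> \<not> w' \<sqsubseteq>\<^bsub>L\<^esub> v \<and> R n w'" for n unfolding R_def by blast
    qed
  qed
  have mem: "\<exists>i\<in>I. U i \<in> p" if p: "p \<in> Q" for p
  proof -
    obtain w i where w: "w \<in> p" "i \<in> I" "w \<sqsubseteq>\<^bsub>L\<^esub> U i" using p unfolding Q_def R_def by blast
    then show ?thesis using proper_filterD(5)[OF filter[OF p] w(1) U[OF w(2)] w(3)] by blast
  qed
  let ?W = "\<lambda>i. {p \<in> Q. U i \<in> p}"
  have "open_cover (filter_space Q) I ?W"
    unfolding open_cover_def using openin_basic mem by auto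
  moreover have "disjoint_family_on ?W I"
    unfolding disjoint_family_on_def
  proof (intro ballI impI)
    fix i j assume ij: "i \<in> I" "j \<in> I" "i \<noteq> j"
    have "False" if p: "p \<in> Q" "U i \<in> p" "U j \<in> p" for p
      using proper_filterD(4)[OF filter[OF p(1)] p(2,3)] proper_filterD(3)[OF filter[OF p(1)]] dis ij by auto
    then show "?W i \<inter> ?W j = {}" by blast
  qed
  ultimately have num: "numerable (filter_space Q) I ?W" by (rule numerable_disjoint)
  show ?thesis
    by (rule spatial_morphism.locale_numerableI[OF spatial_morphism_open_of num U]) (auto intro: open_of_le U)
qed

lemma locale_morphismD:
  assumes "locale_morphism L M f"
  shows "f \<in> carrier M \<rightarrow> carrier L" "isotone M L f"
    "A \<subseteq> carrier M \<Longrightarrow> finite A \<Longrightarrow> f (\<Sqinter>\<^bsub>M\<^esub>A) = \<Sqinter>\<^bsub>L\<^esub>(f ` A)"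
    "A \<subseteq> carrier M \<Longrightarrow> f (\<Squnion>\<^bsub>M\<^esub>A) = \<Squnion>\<^bsub>L\<^esub>(f ` A)"
  using assms unfolding locale_morphism_def by blast+

lemma locale_morphism_compose:
  assumes g: "locale_morphism M L g" and h: "locale_morphism L N h"
  shows "locale_morphism M N (g \<circ> h)"
  unfolding locale_morphism_def
proof (intro conjI allI impI)
  show "g \<circ> h \<in> carrier N \<rightarrow> carrier M"
    using locale_morphismD(1)[OF g] locale_morphismD(1)[OF h] by (auto simp: Pi_iff)
  show "isotone N M (g \<circ> h)"
    using locale_morphismD(1,2)[OF h] locale_morphismD(1,2)[OF g] by (rule iso_compose)
  fix A
  have im: "h ` A \<subseteq> carrier L" if "A \<subseteq> carrier N" using locale_morphismD(1)[OF h] that by blast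
  show "(g \<circ> h) (\<Sqinter>\<^bsub>N\<^esub>A) = \<Sqinter>\<^bsub>M\<^esub>((g \<circ> h) ` A)" if A: "A \<subseteq> carrier N \<and> finite A"
    using locale_morphismD(3)[OF h, of A] locale_morphismD(3)[OF g im] A by (simp add: image_comp)
  show "(g \<circ> h) (\<Squnion>\<^bsub>N\<^esub>A) = \<Squnion>\<^bsub>M\<^esub>((g \<circ> h) ` A)" if A: "A \<subseteq> carrier N"
    using locale_morphismD(4)[OF h, of A] locale_morphismD(4)[OF g im] A by (simp add: image_comp)
qed

lemma locale_numerable_isomorphism:
  fixes L :: "'l gorder"
  assumes num: "locale_numerable L I U" and M: "frame M" and iso: "locale_isomorphism L M f g"
  shows "locale_numerable M I (\<lambda>i. g (U i))"
proof -
  obtain X :: "'l set topology" and h W where h: "spatial_morphism L X h" and W: "numerable X I W"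
    and le: "\<And>i. i \<in> I \<Longrightarrow> h (W i) \<sqsubseteq>\<^bsub>L\<^esub> U i" and U: "\<And>i. i \<in> I \<Longrightarrow> U i \<in> carrier L"
    and "frame L"
    by (rule locale_numerableE[OF num]) (rule that)
  have g: "locale_morphism M L g" using iso unfolding locale_isomorphism_def by blast
  have "spatial_morphism M X (g \<circ> h)"
    using locale_morphism_compose[OF g spatial_morphism.morphism[OF h]] M
    unfolding spatial_morphism_def spatial_morphism_axioms_def by blast
  then show ?thesis
  proof (rule spatial_morphism.locale_numerableI[OF _ W])
    fix i assume i: "i \<in> I"
    show "g (U i) \<in> carrier M" using g U[OF i] unfolding locale_morphism_def by blast
    have "h (W i) \<in> carrier L"
      using spatial_morphism.closed[OF h] W i unfolding numerable_def open_cover_def by blast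
    then show "(g \<circ> h) (W i) \<sqsubseteq>\<^bsub>M\<^esub> g (U i)"
      using g le[OF i] U[OF i] unfolding locale_morphism_def isotone_def by simp
  qed
qed

text \<open>One space of filters must carry the outer partition and, over the locus where
  \<open>f i\<close> is positive, the inner partition of \<open>U i\<close>. Infinitely many inner
  partitions cannot be refined one by one, but at each precision all except finitely many
  \<open>f i\<close> are already negligible.\<close>

lemma locale_numerable_composition:
  fixes L :: "'l gorder"
  assumes num: "locale_numerable L I U"
    and num': "\<And>i. i \<in> I \<Longrightarrow> locale_numerable (open_sublocale L (U i)) (J i) (V i)"
    and k: "bij_betw k K (SIGMA i:I. J i)"
  shows "locale_numerable L K (\<lambda>x. case k x of (i, j) \<Rightarrow> V i j)"
proof -
  obtain f where f: "locale_positive_partition L I f" and fU: "\<And>i. i \<in> I \<Longrightarrow> f i {0<..} \<sqsubseteq>\<^bsub>L\<^esub> U i"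
    and L: "frame L" and U: "\<And>i. i \<in> I \<Longrightarrow> U i \<in> carrier L"
    using num unfolding locale_numerable_def locale_open_cover_def by blast
  obtain s where "locale_partition L I f s" using locale_positive_partitionE[OF f L] .
  then interpret locale_partition L I f s .
  note sub = open_sublocale_simps[OF L U]
  have "\<exists>g t. locale_partition (open_sublocale L (U i)) (J i) g t \<and>
      (\<forall>j\<in>J i. g j {0<..} \<sqsubseteq>\<^bsub>L\<^esub> V i j \<and> V i j \<in> carrier L)" if i: "i \<in> I" for i
  proof -
    obtain g where g: "locale_positive_partition (open_sublocale L (U i)) (J i) g"
      "\<forall>j\<in>J i. g j {0<..} \<sqsubseteq>\<^bsub>open_sublocale L (U i)\<^esub> V i j"
      "frame (open_sublocale L (U i))" "\<forall>j\<in>J i. V i j \<in> carrier (open_sublocale L (U i))"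
      using num'[OF i] unfolding locale_numerable_def locale_open_cover_def by blast
    obtain t where "locale_partition (open_sublocale L (U i)) (J i) g t"
      using locale_positive_partitionE[OF g(1,3)] .
    then show ?thesis using g(2,4) sub[OF i] by auto
  qed
  then obtain g t where g: "\<And>i. i \<in> I \<Longrightarrow> locale_partition (open_sublocale L (U i)) (J i) (g i) (t i)"
    and gV: "\<And>i j. i \<in> I \<Longrightarrow> j \<in> J i \<Longrightarrow> g i j {0<..} \<sqsubseteq>\<^bsub>L\<^esub> V i j"
    and V: "\<And>i j. i \<in> I \<Longrightarrow> j \<in> J i \<Longrightarrow> V i j \<in> carrier L"
    by metis
  let ?S = "\<lambda>i. open_sublocale L (U i)"
  define slevel where "slevel i = locale_partition.level (?S i) (J i) (g i) (t i)" for i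
  \<comment> \<open>For every index either the outer function is negligible at this precision, or
    the inner partition is known at the same precision.\<close>
  define R where "R n w \<longleftrightarrow> level (1 / Suc n) w \<and> (\<forall>i\<in>I. w \<sqsubseteq>\<^bsub>L\<^esub> f i ({0..} \<inter> {..<1 / Suc n}) \<or>
      (w \<sqsubseteq>\<^bsub>L\<^esub> U i \<and> slevel i (1 / Suc n) w))" for n w
  have f0: "f i ({0..} \<inter> {..<a}) \<in> carrier L" "f i {0<..} \<in> carrier L" if "i \<in> I" for i a
  proof -
    have "openin (top_of_set {0..}) ({0..} \<inter> {0::real<..})" by (simp add: openin_open_Int)
    moreover have "{0..} \<inter> {0::real<..} = {0<..}" by auto
    ultimately show "f i ({0..} \<inter> {..<a}) \<in> carrier L" "f i {0<..} \<in> carrier L"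
      using f_closed[OF that] by (simp_all add: openin_open_Int)
  qed
  have down: "slevel i e w'" if "i \<in> I" "slevel i e w" "w \<in> carrier L" "w \<sqsubseteq>\<^bsub>L\<^esub> U i" "w' \<in> carrier L" "w' \<sqsubseteq>\<^bsub>L\<^esub> w"
    for i e w w'
    using locale_partition.level_mono[OF g[OF that(1)], of e w e w'] that sub[OF that(1)]
      le_trans[OF that(6,4)] U[OF that(1)] unfolding slevel_def by simp
  have dense: "\<exists>w'\<in>carrier L. w' \<sqsubseteq>\<^bsub>L\<^esub> w \<and> \<not> w' \<sqsubseteq>\<^bsub>L\<^esub> v \<and> R n w'"
    if v: "v \<in> carrier L" and w: "w \<in> carrier L" "\<not> w \<sqsubseteq>\<^bsub>L\<^esub> v" for n v w
  proof -
    define e :: real where "e = 1 / Suc n"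
    have e: "0 < e" unfolding e_def by simp
    let ?R = "\<lambda>i w. w \<sqsubseteq>\<^bsub>L\<^esub> f i ({0..} \<inter> {..<e}) \<or> (w \<sqsubseteq>\<^bsub>L\<^esub> U i \<and> slevel i e w)"
    have downR: "?R i w''" if "?R i w'" "i \<in> I" "w' \<in> carrier L" "w'' \<in> carrier L" "w'' \<sqsubseteq>\<^bsub>L\<^esub> w'" for i w' w''
      using that(1)
    proof
      assume "w' \<sqsubseteq>\<^bsub>L\<^esub> f i ({0..} \<inter> {..<e})"
      then show ?thesis using le_trans[OF that(5)] that f0 by simp
    next
      assume *: "w' \<sqsubseteq>\<^bsub>L\<^esub> U i \<and> slevel i e w'"
      then show ?thesis using le_trans[OF that(5)] that U down[of i e w' w''] by simp
    qed
    obtain w1 where w1: "w1 \<in> carrier L" "w1 \<sqsubseteq>\<^bsub>L\<^esub> w" "\<not> w1 \<sqsubseteq>\<^bsub>L\<^esub> v" "level e w1"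
      using dense_level[OF w v e] by blast
    obtain J0 a where J0: "J0 \<subseteq> I" "finite J0" "\<forall>i\<in>I-J0. a i < 0"
      and wa: "\<forall>i\<in>I. w1 \<sqsubseteq>\<^bsub>L\<^esub> f i ({0..} \<inter> {a i<..<a i+e})"
      using w1(4) unfolding level_def by blast
    \<comment> \<open>A negative left endpoint puts the whole interval below \<open>e\<close>, so
      these indices satisfy the first alternative.\<close>
    have far: "?R i w1" if i: "i \<in> I - J0" for i
    proof -
      interpret fi: real_morphism L "{0..}" "f i" using i by (intro f_morphism) simp
      have "f i ({0..} \<inter> {a i<..<a i+e}) \<sqsubseteq>\<^bsub>L\<^esub> f i ({0..} \<inter> {..<e})"
      proof -
        have "a i < 0" using J0(3) i by blast
        then show ?thesis by (intro fi.mono_Int) auto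
      qed
      then show ?thesis using le_trans[of w1 "f i ({0..} \<inter> {a i<..<a i+e})"] wa i w1(1) by simp
    qed
    have "\<exists>w'\<in>carrier L. w' \<sqsubseteq>\<^bsub>L\<^esub> w1 \<and> \<not> w' \<sqsubseteq>\<^bsub>L\<^esub> v \<and> (\<forall>i\<in>J0. ?R i w')"
      using J0(2,1)
    proof (induction J0)
      case empty
      then show ?case using w1 le_refl by blast
    next
      case (insert i J0)
      then obtain w2 where w2: "w2 \<in> carrier L" "w2 \<sqsubseteq>\<^bsub>L\<^esub> w1" "\<not> w2 \<sqsubseteq>\<^bsub>L\<^esub> v" "\<forall>i\<in>J0. ?R i w2" by blast
      have i: "i \<in> I" using insert.prems by blast
      interpret fi: real_morphism L "{0..}" "f i" by (rule f_morphism[OF i])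
      have "\<exists>w3\<in>carrier L. w3 \<sqsubseteq>\<^bsub>L\<^esub> w2 \<and> \<not> w3 \<sqsubseteq>\<^bsub>L\<^esub> v \<and> ?R i w3"
      \<comment> \<open>If the part where \<open>f i\<close> is positive is below \<open>v\<close>,
        refinement must go into the part where \<open>f i\<close> is below \<open>e\<close>.
        Otherwise it goes into the positive part, which lies in \<open>U i\<close>; there the
        density of the inner levels applies relative to \<open>?v\<close>, the trace of
        \<open>v\<close> on \<open>U i\<close>.\<close>
      proof (cases "w2 \<sqinter>\<^bsub>L\<^esub> f i {0<..} \<sqsubseteq>\<^bsub>L\<^esub> v")
        case True
        have "{0..} \<inter> {..<e} \<union> {0<..} = {0..}" using e by auto
        moreover have "openin (top_of_set {0..}) {0::real<..}"
          using fi.openin_Int[of "{0<..}"] by (simp add: Int_absorb1 subset_iff)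
        ultimately have "\<top>\<^bsub>L\<^esub> = \<Squnion>\<^bsub>L\<^esub>{f i ({0..} \<inter> {..<e}), f i {0<..}}"
          using fi.Sup[of "{{0..} \<inter> {..<e}, {0<..}}"] fi.top fi.openin_Int[of "{..<e}"] by auto
        then have top: "w2 \<sqsubseteq>\<^bsub>L\<^esub> \<Squnion>\<^bsub>L\<^esub>{f i ({0..} \<inter> {..<e}), f i {0<..}}" using top_higher[OF w2(1)] by metis
        obtain x w3 where x: "x \<in> {f i ({0..} \<inter> {..<e}), f i {0<..}}"
          and w3: "w3 \<in> carrier L" "w3 \<sqsubseteq>\<^bsub>L\<^esub> w2" "w3 \<sqsubseteq>\<^bsub>L\<^esub> x" "\<not> w3 \<sqsubseteq>\<^bsub>L\<^esub> v"
          by (rule refine_Sup[OF _ w2(1) top v w2(3)]) (use f0[OF i] in auto)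
        have "x \<noteq> f i {0<..}"
        proof
          assume "x = f i {0<..}"
          then have "w3 \<sqsubseteq>\<^bsub>L\<^esub> w2 \<sqinter>\<^bsub>L\<^esub> f i {0<..}" using w3 w2(1) f0[OF i] by (simp add: le_meet_iff)
          then show False using le_trans[OF _ True] w3(1,4) w2(1) f0[OF i] v by simp
        qed
        then show ?thesis using x w3 by blast
      next
        case False
        let ?u = "w2 \<sqinter>\<^bsub>L\<^esub> f i {0<..}"
        have u: "?u \<in> carrier L" "?u \<sqsubseteq>\<^bsub>L\<^esub> w2" "?u \<sqsubseteq>\<^bsub>L\<^esub> f i {0<..}"
          using w2(1) f0[OF i] meet_left meet_right by auto
        have uU: "?u \<sqsubseteq>\<^bsub>L\<^esub> U i" using le_trans[OF u(3) fU[OF i]] u(1) f0[OF i] U[OF i] by simp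
        let ?v = "v \<sqinter>\<^bsub>L\<^esub> U i"
        have v': "?v \<in> carrier (?S i)" using v U[OF i] sub[OF i] meet_right by simp
        have "\<not> ?u \<sqsubseteq>\<^bsub>L\<^esub> ?v" using False u(1) v U[OF i] by (simp add: le_meet_iff)
        then obtain w3 where w3: "w3 \<in> carrier (?S i)" "w3 \<sqsubseteq>\<^bsub>L\<^esub> ?u" "\<not> w3 \<sqsubseteq>\<^bsub>L\<^esub> ?v" "slevel i e w3"
          using locale_partition.dense_level[OF g[OF i], of ?u ?v e] u(1) uU v' e sub[OF i]
          unfolding slevel_def by auto
        then have "w3 \<in> carrier L" "w3 \<sqsubseteq>\<^bsub>L\<^esub> U i" using sub[OF i] by auto
        moreover have "w3 \<sqsubseteq>\<^bsub>L\<^esub> w2" using le_trans[OF w3(2) u(2)] calculation(1) u(1) w2(1) by simp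
        moreover have "\<not> w3 \<sqsubseteq>\<^bsub>L\<^esub> v" using w3(3) calculation v U[OF i] by (simp add: le_meet_iff)
        ultimately show ?thesis using w3(4) by blast
      qed
      then obtain w3 where w3: "w3 \<in> carrier L" "w3 \<sqsubseteq>\<^bsub>L\<^esub> w2" "\<not> w3 \<sqsubseteq>\<^bsub>L\<^esub> v" "?R i w3" by blast
      have "w3 \<sqsubseteq>\<^bsub>L\<^esub> w1" using le_trans[OF w3(2) w2(2)] w3(1) w2(1) w1(1) by simp
      moreover have "?R j w3" if "j \<in> J0" for j
        using downR[of w2 j w3] w2(1,4) w3(1,2) that insert.prems by blast
      ultimately show ?case using w3 by (intro bexI[of _ w3]) auto
    qed
    then obtain w' where w': "w' \<in> carrier L" "w' \<sqsubseteq>\<^bsub>L\<^esub> w1" "\<not> w' \<sqsubseteq>\<^bsub>L\<^esub> v" "\<forall>i\<in>J0. ?R i w'" by blast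
    have "?R i w'" if "i \<in> I" for i
      using w'(4) downR[OF far _ w1(1) w'(1,2), of i] that by blast
    moreover have "level e w'" using level_mono[OF w1(4) order_refl w1(1) w'(1,2)] .
    ultimately have "R n w'" unfolding R_def e_def by blast
    moreover have "w' \<sqsubseteq>\<^bsub>L\<^esub> w" using le_trans[OF w'(2) w1(2)] w'(1) w1(1) w(1) by simp
    ultimately show ?thesis using w' by blast
  qed
  define Q where "Q = {p. proper_filter p \<and> (\<forall>n. \<exists>w\<in>p. R n w)}"
  interpret separating_filters L Q
  proof
    show "proper_filter p" if "p \<in> Q" for p using that unfolding Q_def by blast
    show "\<exists>p\<in>Q. u \<in> p \<and> v \<notin> p" if "u \<in> carrier L" "v \<in> carrier L" "\<not> u \<sqsubseteq>\<^bsub>L\<^esub> v" for u v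
      unfolding Q_def 
      by (rule separating_filtersI[OF dense that])
  qed
  have gen: "generic p" if "p \<in> Q" for p
    using that unfolding Q_def R_def by (intro generic_if_levels) blast+
  let ?X = "filter_space Q"
  define W where "W i = {p \<in> Q. 0 < coordinate i p}" for i
  have num1: "numerable ?X I W"
    using numerable_coordinates[of ?X "\<lambda>p. p"] gen openin_basic unfolding W_def by simp
  have WQ: "W i \<subseteq> Q" for i unfolding W_def by blast
  have topW: "topspace (subtopology ?X (W i)) = W i" for i using WQ[of i] by auto
  have UW: "U i \<in> p" if "i \<in> I" "p \<in> W i" for i p
    using coordinate_posD[OF gen that(1)] proper_filterD(5)[OF filter _ U[OF that(1)] fU[OF that(1)]] that(2)
    unfolding W_def by blast
  \<comment> \<open>A filter containing \<open>U i\<close> restricts to a proper filter of the open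
    sublocale.\<close>
  define P where "P i p = p \<inter> carrier (?S i)" for i and p :: "'l set"
  have Pgen: "locale_partition.generic (?S i) (J i) (g i) (t i) (P i p)" if i: "i \<in> I" and p: "p \<in> W i" for i p
  proof (rule locale_partition.genericI[OF g[OF i]])
    interpret S: frame "?S i" using g[OF i] unfolding locale_partition_def by blast
    have pf: "proper_filter p" using filter p WQ by blast
    note pD = proper_filterD[OF pf]
    show "S.proper_filter (P i p)"
      unfolding S.proper_filter_def
    proof (intro conjI ballI impI)
      show "P i p \<subseteq> carrier (?S i)" unfolding P_def by blast
      show "\<top>\<^bsub>?S i\<^esub> \<in> P i p"
        using top_open_sublocale[OF L U[OF i]] UW[OF i p] S.top_closed unfolding P_def by simp
      show "\<bottom>\<^bsub>?S i\<^esub> \<notin> P i p"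
        using bottom_open_sublocale[OF L U[OF i]] pD(3) unfolding P_def by simp
      show "a \<sqinter>\<^bsub>?S i\<^esub> b \<in> P i p" if "a \<in> P i p" "b \<in> P i p" for a b
        using that pD(4)[of a b] S.meet_closed[of a b] meet_open_sublocale[OF L U[OF i], of a b] unfolding P_def by simp
      show "b \<in> P i p" if "a \<in> P i p" "b \<in> carrier (?S i)" "a \<sqsubseteq>\<^bsub>?S i\<^esub> b" for a b
        using that pD(5)[of a b] sub[OF i] unfolding P_def by simp
    qed
    fix e :: real assume e: "0 < e"
    interpret fi: real_morphism L "{0..}" "f i" by (rule f_morphism[OF i])
    let ?x = "coordinate i p"
    have pQ: "p \<in> Q" and x: "0 < ?x" using p unfolding W_def by auto
    \<comment> \<open>Precision finer than the coordinate itself excludes the first alternative in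
      \<open>R\<close>, so the inner partition must be known.\<close>
    then obtain n where n: "1 / Suc n < min e ?x" using nat_approx_posE[of "min e ?x"] e by (metis min_less_iff_conj)
    obtain w where w: "w \<in> p" "R n w" using pQ unfolding Q_def by blast
    have wL: "w \<in> carrier L" using pD(1) w(1) by blast
    have "\<not> w \<sqsubseteq>\<^bsub>L\<^esub> f i ({0..} \<inter> {..<1 / Suc n})"
    proof
      assume "w \<sqsubseteq>\<^bsub>L\<^esub> f i ({0..} \<inter> {..<1 / Suc n})"
      then have "f i ({0..} \<inter> {..<1 / Suc n}) \<in> p" using pD(5)[OF w(1) f0(1)[OF i]] by blast
      then have "?x \<le> 1 / Suc n" by (rule fi.filter_value_le[OF decides_f[OF gen[OF pQ] i]])
      then show False using n by simp
    qed
    then have "w \<sqsubseteq>\<^bsub>L\<^esub> U i" "slevel i (1 / Suc n) w" using w(2) i unfolding R_def by blast+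
    then have "w \<in> P i p" using w(1) wL sub[OF i] unfolding P_def by simp
    then show "\<exists>e'\<le>e. \<exists>w\<in>P i p. locale_partition.level (?S i) (J i) (g i) (t i) e' w"
      using \<open>slevel i (1 / Suc n) w\<close> n unfolding slevel_def by (intro exI[of _ "1 / Suc n"]) auto
  qed
  define W' where "W' i j = {p \<in> W i. 0 < filter_value {0..} (g i j) (P i p)}" for i j
  have num2: "numerable (subtopology ?X (W i)) (J i) (W' i)" if i: "i \<in> I" for i
  proof -
    have "openin (subtopology ?X (W i)) {p \<in> W i. u \<in> P i p}" if u: "u \<in> carrier (?S i)" for u
    proof -
      have "{p \<in> W i. u \<in> P i p} = W i \<inter> {p \<in> Q. u \<in> p}" using u WQ unfolding P_def by blast
      then show ?thesis using openin_subtopology_Int2[OF openin_basic] by simp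
    qed
    then show ?thesis
      using locale_partition.numerable_coordinates[OF g[OF i], of "subtopology ?X (W i)" "P i"] Pgen[OF i]
      unfolding topW W'_def by blast
  qed
  have "numerable ?X K (\<lambda>x. case k x of (i, j) \<Rightarrow> W' i j)"
    by (rule numerable_composition[OF num1 num2 k])
  then show ?thesis
  proof (rule spatial_morphism.locale_numerableI[OF spatial_morphism_open_of])
    fix x assume "x \<in> K"
    then obtain i j where x: "k x = (i, j)" and i: "i \<in> I" and j: "j \<in> J i" using k unfolding bij_betw_def by blast
    show "(case k x of (i, j) \<Rightarrow> V i j) \<in> carrier L" using x V[OF i j] by simp
    have "V i j \<in> p" if p: "p \<in> W' i j" for p
    proof -
      have pW: "p \<in> W i" "0 < filter_value {0..} (g i j) (P i p)" using p unfolding W'_def by auto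
      have "g i j {0<..} \<in> P i p"
        by (rule locale_partition.coordinate_posD[OF g[OF i] Pgen[OF i pW(1)] j pW(2)])
      then have "g i j {0<..} \<in> p" unfolding P_def by blast
      then show ?thesis using proper_filterD(5)[OF filter _ V[OF i j] gV[OF i j]] pW(1) WQ by blast
    qed
    then have "W' i j \<subseteq> {p \<in> Q. V i j \<in> p}" using WQ unfolding W'_def by blast
    then show "open_of (case k x of (i, j) \<Rightarrow> W' i j) \<sqsubseteq>\<^bsub>L\<^esub> (case k x of (i, j) \<Rightarrow> V i j)"
      using x open_of_le[OF V[OF i j]] by simp
  qed
qed

lemma locale_admissible_numerable: "locale_admissible_cover_class locale_numerable"
  unfolding locale_admissible_cover_class_def
proof (intro conjI allI impI; (elim conjE)?)
  fix L M :: "'l gorder" and I J K :: "'i set" and U V h f g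
  show "locale_open_cover L I U" if "locale_numerable L I U" using that unfolding locale_numerable_def by blast
  show "locale_numerable L I U"
    if "locale_open_cover L I U" "\<forall>i\<in>I. \<forall>j\<in>I. i \<noteq> j \<longrightarrow> U i \<sqinter>\<^bsub>L\<^esub> U j = \<bottom>\<^bsub>L\<^esub>"
    using that by (rule locale_numerable_disjoint)
  show "locale_numerable L J V"
    if "locale_numerable L I U" "locale_open_cover L J V" "\<forall>i\<in>I. \<exists>j\<in>J. U i \<sqsubseteq>\<^bsub>L\<^esub> V j"
    using that by (rule locale_numerable_coarsening)
  show "locale_numerable M I (\<lambda>i. g (U i))"
    if "locale_numerable L I U" "frame M" "locale_isomorphism L M f g"
    using that by (rule locale_numerable_isomorphism)
  show "locale_numerable L K (\<lambda>k. case h k of (i, j) \<Rightarrow> V i j)"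
    if "locale_numerable L I U" "\<forall>i\<in>I. locale_numerable (open_sublocale L (U i)) (J i) (V i)"
      "bij_betw h K (SIGMA i:I. J i)"
    for J and V :: "'i \<Rightarrow> 'i \<Rightarrow> 'l"
    using locale_numerable_composition[OF that(1) bspec[OF that(2)] that(3)] .
qed

section \<open>Minimality of the two classes\<close>

lemma numerable_minimal:
  fixes C :: "'a topology \<Rightarrow> 'i set \<Rightarrow> ('i \<Rightarrow> 'a set) \<Rightarrow> bool"
  assumes inf: "infinite (UNIV :: 'i set)" and C: "admissible_cover_class C" and num: "numerable X I U"
  shows "C X I U"
proof -
  have C':
    "\<And>X I U. C X I U \<Longrightarrow> open_cover X I U"
    "\<And>X I U. numerable X I U \<Longrightarrow> card I = 2 \<Longrightarrow> C X I U"
    "\<And>X I U. open_cover X I U \<Longrightarrow> disjoint_family_on U I \<Longrightarrow> C X I U"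
    "\<And>X I U J V. C X I U \<Longrightarrow> open_cover X J V \<Longrightarrow> \<forall>i\<in>I. \<exists>j\<in>J. U i \<subseteq> V j \<Longrightarrow> C X J V"
    "\<And>X I U J V K h. C X I U \<Longrightarrow> \<forall>i\<in>I. C (subtopology X (U i)) (J i) (V i) \<Longrightarrow>
       bij_betw h K (SIGMA i:I. J i) \<Longrightarrow> C X K (\<lambda>k. case h k of (i, j) \<Rightarrow> V i j)"
    using C unfolding admissible_cover_class_def by - (elim conjE; metis)+
  have "C (subtopology X (topspace X)) I U"
  proof (rule numerable_cover_induct[where D = "\<lambda>W. C (subtopology X W)", OF inf _ _ _ _ num])
    show "C (subtopology X W) I U" if "numerable (subtopology X W) I U" "card I = 2" for W I U
      using C'(2) that .
    show "C (subtopology X W) I U" if "open_cover (subtopology X W) I U" "disjoint_family_on U I" for W I U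
      using C'(3) that .
    show "C (subtopology X W) J V" if "C (subtopology X W) I U" "open_cover (subtopology X W) J V"
        "\<forall>i\<in>I. \<exists>j\<in>J. U i \<subseteq> V j" for W I U J V
      using C'(4) that .
    show "C (subtopology X W) K (\<lambda>k. case h k of (i, j) \<Rightarrow> V i j)"
      if W: "openin X W" and U: "open_cover (subtopology X W) I U" "C (subtopology X W) I U"
        and V: "\<forall>i\<in>I. C (subtopology X (U i)) (J i) (V i)" and h: "bij_betw h K (SIGMA i:I. J i)"
      for W I U J V K h
    proof -
      have "U i \<subseteq> W" if "i \<in> I" for i
        using U(1) that openin_open_subtopology[OF W] unfolding open_cover_def by blast
      then have "\<forall>i\<in>I. C (subtopology (subtopology X W) (U i)) (J i) (V i)"
        using V by (simp add: subtopology_subtopology Int_absorb1)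
      then show ?thesis by (rule C'(5)[OF U(2) _ h])
    qed
  qed
  then show ?thesis by simp
qed

text \<open>The class speaks of locales only, so the induction on the space of filters carries the
  images under \<open>h\<close> of its covers. At the end the image of \<open>W\<close> is coarsened
  to \<open>U\<close>.\<close>

lemma locale_numerable_minimal:
  fixes C :: "'l gorder \<Rightarrow> 'i set \<Rightarrow> ('i \<Rightarrow> 'l) \<Rightarrow> bool"
  assumes inf: "infinite (UNIV :: 'i set)" and C: "locale_admissible_cover_class C" and num: "locale_numerable L I U"
  shows "C L I U"
proof -
  have C':
    "\<And>L I U. C L I U \<Longrightarrow> locale_open_cover L I U"
    "\<And>L I U. locale_numerable L I U \<Longrightarrow> card I = 2 \<Longrightarrow> C L I U"
    "\<And>L I U. locale_open_cover L I U \<Longrightarrow> \<forall>i\<in>I. \<forall>j\<in>I. i \<noteq> j \<longrightarrow> U i \<sqinter>\<^bsub>L\<^esub> U j = \<bottom>\<^bsub>L\<^esub> \<Longrightarrow> C L I U"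
    "\<And>L I U J V. C L I U \<Longrightarrow> locale_open_cover L J V \<Longrightarrow> \<forall>i\<in>I. \<exists>j\<in>J. U i \<sqsubseteq>\<^bsub>L\<^esub> V j \<Longrightarrow> C L J V"
    "\<And>L I U J V K h. C L I U \<Longrightarrow> \<forall>i\<in>I. C (open_sublocale L (U i)) (J i) (V i) \<Longrightarrow>
       bij_betw h K (SIGMA i:I. J i) \<Longrightarrow> C L K (\<lambda>k. case h k of (i, j) \<Rightarrow> V i j)"
    using C unfolding locale_admissible_cover_class_def by - (elim conjE; metis)+
  obtain X :: "'l set topology" and h W where "spatial_morphism L X h" and W: "numerable X I W"
    and le: "\<And>i. i \<in> I \<Longrightarrow> h (W i) \<sqsubseteq>\<^bsub>L\<^esub> U i" and "\<And>i. i \<in> I \<Longrightarrow> U i \<in> carrier L" and L: "frame L"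
    by (rule locale_numerableE[OF num]) (rule that)
  then interpret spatial_morphism L X h by blast
  let ?S = "\<lambda>A. open_sublocale L (h A)"
  have op: "openin X A" "A \<subseteq> B" if "openin X B" "openin (subtopology X B) A" for A B
    using that openin_open_subtopology by auto
  \<comment> \<open>The first conjunct records that the members are open in the space; only on opens
    is \<open>h\<close> known to be monotone and to preserve covers.\<close>
  let ?D = "\<lambda>A I U. open_cover (subtopology X A) I U \<and> C (?S A) I (\<lambda>i. h (U i))"
  have "?D (topspace X) I W"
  proof (rule numerable_cover_induct[where D = ?D, OF inf _ _ _ _ W])
    fix A and I :: "'i set" and U :: "'i \<Rightarrow> 'l set set"
    assume A: "openin X A"
    interpret A: spatial_morphism "?S A" "subtopology X A" h by (rule spatial_morphism_subtopology[OF A])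
    note sub = open_sublocale_simps[OF L closed[OF A]]
    show "?D A I U" if U: "numerable (subtopology X A) I U" "card I = 2"
    proof -
      have cov: "open_cover (subtopology X A) I U" using U(1) unfolding numerable_def by blast
      then have "h (U i) \<in> carrier (?S A)" if "i \<in> I" for i
        using that unfolding open_cover_def by (intro A.closed) blast
      then have "locale_numerable (?S A) I (\<lambda>i. h (U i))"
        by (intro A.locale_numerableI[OF U(1)] A.le_refl)
      then show ?thesis using C'(2) U(2) cov by blast
    qed
    show "?D A I U" if U: "open_cover (subtopology X A) I U" "disjoint_family_on U I"
    proof -
      have "h (U i) \<sqinter>\<^bsub>?S A\<^esub> h (U j) = \<bottom>\<^bsub>?S A\<^esub>" if "i \<in> I" "j \<in> I" "i \<noteq> j" for i j
      proof -
        have "U i \<inter> U j = {}" using U(2) that unfolding disjoint_family_on_def by blast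
        then show ?thesis using A.meet[of "U i" "U j"] A.bottom U(1) that unfolding open_cover_def by simp
      qed
      then show ?thesis using C'(3) A.locale_open_cover_image[OF U(1)] U(1) by blast
    qed
    show "?D A J V" if U: "?D A I U"
      and V: "open_cover (subtopology X A) J V" "\<forall>i\<in>I. \<exists>j\<in>J. U i \<subseteq> V j" for J V
    proof -
      have "\<exists>j\<in>J. h (U i) \<sqsubseteq>\<^bsub>?S A\<^esub> h (V j)" if i: "i \<in> I" for i
      proof -
        obtain j where j: "j \<in> J" "U i \<subseteq> V j" using V(2) i by blast
        have "openin (subtopology X A) (U i)" "openin (subtopology X A) (V j)"
          using U V(1) i j(1) unfolding open_cover_def by blast+
        then show ?thesis using A.mono j by blast
      qed
      then show ?thesis using C'(4) A.locale_open_cover_image[OF V(1)] U V(1) by blast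
    qed
    show "?D A K (\<lambda>k. case k' k of (i, j) \<Rightarrow> V i j)"
      if U: "open_cover (subtopology X A) I U" "?D A I U"
        and V: "\<forall>i\<in>I. ?D (U i) (J i) (V i)" and k': "bij_betw k' K (SIGMA i:I. J i)"
      for J V K and k' :: "'i \<Rightarrow> 'i \<times> 'i"
    proof
      have Ui: "openin X (U i)" "U i \<subseteq> A" if i: "i \<in> I" for i
        using U(1) i op[OF A] unfolding open_cover_def by blast+
      have "subtopology (subtopology X A) (U i) = subtopology X (U i)" if i: "i \<in> I" for i
        using Ui[OF i] by (simp add: subtopology_subtopology Int_absorb1)
      then show "open_cover (subtopology X A) K (\<lambda>k. case k' k of (i, j) \<Rightarrow> V i j)"
        using V by (intro open_cover_composition[OF U(1) _ k']) simp
      \<comment> \<open>Passing to an open sublocale twice is the same as passing to the smaller one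
        directly, by monotonicity of \<open>h\<close>.\<close>
      have "open_sublocale (?S A) (h (U i)) = ?S (U i)" if i: "i \<in> I" for i
      proof -
        have "{v \<in> carrier L. v \<sqsubseteq>\<^bsub>L\<^esub> h A \<and> v \<sqsubseteq>\<^bsub>L\<^esub> h (U i)} = {v \<in> carrier L. v \<sqsubseteq>\<^bsub>L\<^esub> h (U i)}"
          using le_trans[OF _ mono[OF Ui(1)[OF i] A Ui(2)[OF i]]] closed[OF A] closed[OF Ui(1)[OF i]] by blast
        then show ?thesis unfolding open_sublocale_def by simp
      qed
      then have "\<forall>i\<in>I. C (open_sublocale (?S A) (h (U i))) (J i) (\<lambda>j. h (V i j))" using V by simp
      then have "C (?S A) K (\<lambda>k. case k' k of (i, j) \<Rightarrow> h (V i j))"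
        using U(2) by (intro C'(5)[OF _ _ k']) auto
      then show "C (?S A) K (\<lambda>k. h (case k' k of (i, j) \<Rightarrow> V i j))" by (simp add: case_prod_unfold)
    qed
  qed
  moreover have "?S (topspace X) = L"
  proof -
    have "{v \<in> carrier L. v \<sqsubseteq>\<^bsub>L\<^esub> \<top>\<^bsub>L\<^esub>} = carrier L" using top_higher by blast
    then show ?thesis unfolding top open_sublocale_def by simp
  qed
  ultimately have "C L I (\<lambda>i. h (W i))" by simp
  moreover have "locale_open_cover L I U" using num unfolding locale_numerable_def by blast
  ultimately show ?thesis using C'(4) le by blast
qed

theorem theorem1p2:
  assumes "infinite (UNIV :: 'i set)"
  shows "admissible_cover_class
           (numerable :: 'a topology \<Rightarrow> 'i set \<Rightarrow> ('i \<Rightarrow> 'a set) \<Rightarrow> bool) \<and>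
         (\<forall>C. admissible_cover_class C \<longrightarrow>
            (\<forall>(X :: 'a topology) (I :: 'i set) U. numerable X I U \<longrightarrow> C X I U)) \<and>
         locale_admissible_cover_class
           (locale_numerable :: 'l gorder \<Rightarrow> 'i set \<Rightarrow> ('i \<Rightarrow> 'l) \<Rightarrow> bool) \<and>
         (\<forall>C. locale_admissible_cover_class C \<longrightarrow>
            (\<forall>(L :: 'l gorder) (I :: 'i set) U. locale_numerable L I U \<longrightarrow> C L I U))"
  using admissible_numerable numerable_minimal[OF assms]
    locale_admissible_numerable locale_numerable_minimal[OF assms]
  by (intro conjI allI impI)

end
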